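(* Let $C\subseteq D$ be a unital inclusion of C*-algebras. Suppose that $B\subseteq D$ is a C*-algebra containing $C$ such that there exists a faithful conditional expectation $E_B^D:D\to B$. Suppose that $A\subseteq D$ is another C*-algebra containing $C$ with a finite index conditional expectation $E_C^A:A\to C$, and that $d(A,B)\le\gamma<10^{-6}$. Then there exists a unitary $u\in C'\cap D$ such that $uAu^*=B$ and $$\|u-1\|\le 16\sqrt{110}\,\gamma^{1/2}+880\,\gamma.$$
   Context: For closed linear subspaces $X,Y$ of a C*-algebra, with closed unit balls $X_1,Y_1$, the Kadison–Kastler distance is $$d(X,Y)=\max\Big\{\sup_{y\in Y_1}\inf_{x\in X_1}\|x-y\|,\ \sup_{x\in X_1}\inf_{y\in Y_1}\|x-y\|\Big\}.$$ A conditional expectation $E:A\to C$ onto a C*-subalgebra $C\subseteq A$ is of finite index if there is a finite set $v_1,\dots,v_n\in A$ (a quasi-basis for $E$) such that $x=\sum_{i=1}^n v_iE(v_i^*x)$ for all $x\in A$. $C'\cap D$ is the relative commutant of $C$ in $D$. A unital inclusion $C\subseteq D$ means $C$ and $D$ are unital with the same unit. *)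

theory Defs
  imports "HOL-Analysis.Analysis"
begin

text \<open>Unital complex C*-algebras as a type class on top of the real Banach algebras of the library.
  As usual for unital C*-algebras, the unit is required to be nonzero (and hence of norm one);
  this is part of \<^class>\<open>real_normed_algebra_1\<close>.\<close>

class cstar_algebra_1 = real_normed_algebra_1 + banach +
  fixes scaleC :: "complex \<Rightarrow> 'a \<Rightarrow> 'a" (infixr \<open>*\<^sub>C\<close> 75)
    and star :: "'a \<Rightarrow> 'a" (\<open>_\<^sup>\<star>\<close> [1000] 999)
  assumes scaleC_add_right: "c *\<^sub>C (x + y) = c *\<^sub>C x + c *\<^sub>C y"
    and scaleC_add_left: "(c + d) *\<^sub>C x = c *\<^sub>C x + d *\<^sub>C x"
    and scaleC_scaleC: "c *\<^sub>C (d *\<^sub>C x) = (c * d) *\<^sub>C x"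
    and scaleR_eq_scaleC: "r *\<^sub>R x = complex_of_real r *\<^sub>C x"
    and mult_scaleC_left: "(c *\<^sub>C x) * y = c *\<^sub>C (x * y)"
    and mult_scaleC_right: "x * (c *\<^sub>C y) = c *\<^sub>C (x * y)"
    and norm_scaleC: "norm (c *\<^sub>C x) = cmod c * norm x"
    and star_star: "(x\<^sup>\<star>)\<^sup>\<star> = x"
    and star_add: "(x + y)\<^sup>\<star> = x\<^sup>\<star> + y\<^sup>\<star>"
    and star_scaleC: "(c *\<^sub>C x)\<^sup>\<star> = cnj c *\<^sub>C x\<^sup>\<star>"
    and star_mult: "(x * y)\<^sup>\<star> = y\<^sup>\<star> * x\<^sup>\<star>"
    and norm_star_mult_self: "norm (x\<^sup>\<star> * x) = (norm x)\<^sup>2"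

instantiation complex :: cstar_algebra_1
begin

definition scaleC_complex :: "complex \<Rightarrow> complex \<Rightarrow> complex"
  where "scaleC_complex c x = c * x"

definition star_complex :: "complex \<Rightarrow> complex"
  where "star_complex x = cnj x"

instance
  by standard
    (auto simp: scaleC_complex_def star_complex_def algebra_simps norm_mult power2_eq_square
      scaleR_conv_of_real)

end

definition cstar_subalgebra :: "'a::cstar_algebra_1 set \<Rightarrow> bool"
  where "cstar_subalgebra S \<longleftrightarrow>
    closed S \<and> 0 \<in> S \<and>
    (\<forall>x\<in>S. \<forall>y\<in>S. x + y \<in> S) \<and>
    (\<forall>c. \<forall>x\<in>S. c *\<^sub>C x \<in> S) \<and>
    (\<forall>x\<in>S. \<forall>y\<in>S. x * y \<in> S) \<and>
    (\<forall>x\<in>S. x\<^sup>\<star> \<in> S)"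

definition unitary :: "'a::cstar_algebra_1 \<Rightarrow> bool"
  where "unitary u \<longleftrightarrow> u\<^sup>\<star> * u = 1 \<and> u * u\<^sup>\<star> = 1"

definition relative_commutant :: "'a::cstar_algebra_1 set \<Rightarrow> 'a set \<Rightarrow> 'a set"
  where "relative_commutant C D = {x \<in> D. \<forall>c\<in>C. c * x = x * c}"

definition positive_elements :: "'a::cstar_algebra_1 set \<Rightarrow> 'a set"
  where "positive_elements S = {y\<^sup>\<star> * y | y. y \<in> S}"

text \<open>Maps \<open>E : A \<rightarrow> C\<close> are represented by functions on the ambient type, only their values on
  \<open>A\<close> being relevant.\<close>

definition conditional_expectation ::
    "'a::cstar_algebra_1 set \<Rightarrow> 'a set \<Rightarrow> ('a \<Rightarrow> 'a) \<Rightarrow> bool"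
  where "conditional_expectation A C E \<longleftrightarrow>
    C \<subseteq> A \<and>
    (\<forall>x\<in>A. E x \<in> C) \<and>
    (\<forall>x\<in>A. \<forall>y\<in>A. E (x + y) = E x + E y) \<and>
    (\<forall>c. \<forall>x\<in>A. E (c *\<^sub>C x) = c *\<^sub>C E x) \<and>
    (\<forall>c\<in>C. E c = c) \<and>
    (\<forall>x\<in>A. norm (E x) \<le> norm x) \<and>
    (\<forall>x\<in>positive_elements A. E x \<in> positive_elements C) \<and>
    (\<forall>c\<in>C. \<forall>x\<in>A. \<forall>d\<in>C. E (c * x * d) = c * E x * d)"

definition faithful_on :: "'a::cstar_algebra_1 set \<Rightarrow> ('a \<Rightarrow> 'a) \<Rightarrow> bool"
  where "faithful_on A E \<longleftrightarrow> (\<forall>x\<in>positive_elements A. E x = 0 \<longrightarrow> x = 0)"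

definition quasi_basis ::
    "'a::cstar_algebra_1 set \<Rightarrow> ('a \<Rightarrow> 'a) \<Rightarrow> nat \<Rightarrow> (nat \<Rightarrow> 'a) \<Rightarrow> bool"
  where "quasi_basis A E n v \<longleftrightarrow>
    (\<forall>i\<in>{1..n}. v i \<in> A) \<and>
    (\<forall>x\<in>A. x = (\<Sum>i=1..n. v i * E ((v i)\<^sup>\<star> * x)))"

definition finite_index :: "'a::cstar_algebra_1 set \<Rightarrow> ('a \<Rightarrow> 'a) \<Rightarrow> bool"
  where "finite_index A E \<longleftrightarrow> (\<exists>n v. quasi_basis A E n v)"

definition unit_ball :: "'a::cstar_algebra_1 set \<Rightarrow> 'a set"
  where "unit_ball X = {x \<in> X. norm x \<le> 1}"

text \<open>For subspaces \<open>X\<close>, \<open>Y\<close> the infima below are between \<open>0\<close> and \<open>1\<close> and all index sets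
  contain \<open>0\<close>, so the real-valued suprema and infima are the true ones.\<close>

definition kadison_kastler_dist :: "'a::cstar_algebra_1 set \<Rightarrow> 'a set \<Rightarrow> real"
  where "kadison_kastler_dist X Y =
    max (SUP y\<in>unit_ball Y. INF x\<in>unit_ball X. norm (x - y))
        (SUP x\<in>unit_ball X. INF y\<in>unit_ball Y. norm (x - y))"

end

theory Submission
  imports Defs
begin

text \<open>Write \<open>E : D \<rightarrow> B\<close> and \<open>F : A \<rightarrow> C\<close> for the two expectations and \<open>T = id - E\<close>, so that \<open>\<parallel>T x\<parallel> \<le> 2\<gamma> \<parallel>x\<parallel>\<close>
  on \<open>A\<close>. A quasi-basis of \<open>F\<close>, rescaled by the inverse square root of the index, gives \<open>w\<^sub>i \<in> A\<close> with
  \<open>\<Sum> w\<^sub>i w\<^sub>i\<^sup>\<star> = 1\<close> such that \<open>t x = \<Sum> w\<^sub>i E(w\<^sub>i\<^sup>\<star> x)\<close> commutes with left multiplication by \<open>A\<close> and right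
  multiplication by \<open>B\<close>. The point is that \<open>t\<close> is close to \<open>E\<close> with a bound independent of the index: the column
  norm of \<open>(T(w\<^sub>i\<^sup>\<star>))\<close> is \<open>O(\<gamma>)\<close>. For self-adjoint families this is a little Grothendieck inequality for \<open>T\<close>, proved
  with random signs and a truncation. It needs some a priori finite bound, provided by the \<open>C\<close>-linearity of \<open>T\<close> and the
  finite index. The general case follows by polar decomposition, since \<open>T(yh)\<close> is controlled by \<open>T(y)\<close> and \<open>T(h)\<close>.

  Since \<open>t\<close> is close to \<open>E\<close>, it has an eigenvector \<open>\<eta>\<close> near \<open>1\<close>, that is \<open>t \<eta> = \<eta> \<beta>\<close> with \<open>\<beta> \<in> B\<close>, found by the contraction
  principle. Uniqueness forces \<open>a \<eta> \<in> \<eta> B\<close> for \<open>a \<in> A\<close>. Correcting \<open>\<eta>\<close> twice by inverse square roots turns it into a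
  unitary conjugating \<open>A\<close> into \<open>B\<close>. As the image is closed and close to \<open>B\<close>, it is all of \<open>B\<close>.\<close>

subsection \<open>The involution and the norm\<close>

lemma star_zero [simp]: "(0::'a::cstar_algebra_1)\<^sup>\<star> = 0"
  using star_add[of "0::'a" 0] by simp

lemma star_minus [simp]: "(- x)\<^sup>\<star> = - (x::'a::cstar_algebra_1)\<^sup>\<star>"
  using star_add[of x "-x"] by (simp add: eq_neg_iff_add_eq_0 add.commute)

lemma star_diff: "(x - y)\<^sup>\<star> = (x::'a::cstar_algebra_1)\<^sup>\<star> - y\<^sup>\<star>"
  using star_add[of x "-y"] by simp

lemma star_scaleR: "(r *\<^sub>R x)\<^sup>\<star> = r *\<^sub>R (x::'a::cstar_algebra_1)\<^sup>\<star>"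
  by (simp add: scaleR_eq_scaleC star_scaleC)

lemma star_one [simp]: "(1::'a::cstar_algebra_1)\<^sup>\<star> = 1"
  by (metis mult.left_neutral mult.right_neutral star_mult star_star)

lemma star_sum: "(\<Sum>i\<in>I. f i)\<^sup>\<star> = (\<Sum>i\<in>I. (f i :: 'a::cstar_algebra_1)\<^sup>\<star>)"
  by (induction I rule: infinite_finite_induct) (auto simp: star_add)

lemma norm_star [simp]: "norm (x\<^sup>\<star>) = norm (x::'a::cstar_algebra_1)"
proof -
  have *: "norm y \<le> norm (y\<^sup>\<star>)" for y :: 'a
  proof (cases "y = 0")
    case False
    have "norm y * norm y \<le> norm (y\<^sup>\<star>) * norm y"
      using norm_mult_ineq[of "y\<^sup>\<star>" y] by (simp add: norm_star_mult_self power2_eq_square)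
    with False show ?thesis by simp
  qed simp
  from *[of x] *[of "x\<^sup>\<star>"] show ?thesis by (simp add: star_star)
qed

lemma bounded_linear_star: "bounded_linear (star :: 'a::cstar_algebra_1 \<Rightarrow> 'a)"
  by (rule bounded_linear_intro[where K = 1]) (auto simp: star_add star_scaleR)

lemma norm_selfadjoint_square:
  fixes x :: "'a::cstar_algebra_1"
  assumes "x\<^sup>\<star> = x"
  shows "norm (x * x) = (norm x)\<^sup>2"
  using norm_star_mult_self[of x] assms by simp

lemma scaleC_minus_right: "c *\<^sub>C (- x) = - (c *\<^sub>C (x::'a::cstar_algebra_1))"
proof -
  have "c *\<^sub>C (0::'a) = 0" using scaleC_add_right[of c "0::'a" 0] by simp
  then show ?thesis using scaleC_add_right[of c x "-x"] by (simp add: eq_neg_iff_add_eq_0 add.commute)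
qed

lemma scaleC_minus_left: "(- c) *\<^sub>C x = - (c *\<^sub>C (x::'a::cstar_algebra_1))"
  using scaleC_scaleC[of "- 1" c x] scaleR_eq_scaleC[of "-1" "c *\<^sub>C x"] by simp

lemma scaleC_diff_right: "c *\<^sub>C (x - y) = c *\<^sub>C x - c *\<^sub>C (y::'a::cstar_algebra_1)"
  using scaleC_add_right[of c x "-y"] by (simp add: scaleC_minus_right)

lemma scaleC_one: "1 *\<^sub>C x = (x::'a::cstar_algebra_1)"
  using scaleR_eq_scaleC[of 1 x] by simp

text \<open>The element \<open>u = x + \<i> *\<^sub>C y\<close> satisfies
  \<open>u\<^sup>\<star> * u = x * x + y * y\<close>, since the cross terms cancel, and
  \<open>x\<close> is its real part. This norm comparison is available before there is any
  order.\<close>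

lemma norm_square_le_sum_squares:
  fixes x y :: "'a::cstar_algebra_1"
  assumes "x\<^sup>\<star> = x" "y\<^sup>\<star> = y" "x * y = y * x"
  shows "(norm x)\<^sup>2 \<le> norm (x * x + y * y)"
proof -
  define u where "u = x + \<i> *\<^sub>C y"
  have us: "u\<^sup>\<star> = x + (- \<i>) *\<^sub>C y" by (simp add: u_def star_add star_scaleC assms)
  have i2: "\<i> *\<^sub>C (\<i> *\<^sub>C z) = - z" for z :: 'a
    using scaleC_scaleC[of \<i> \<i> z] scaleR_eq_scaleC[of "-1" z] by simp
  have "u\<^sup>\<star> * u = x * x + y * y"
    unfolding us unfolding u_def scaleC_minus_left
    by (simp add: algebra_simps mult_scaleC_left mult_scaleC_right scaleC_diff_right
        scaleC_add_right i2 assms)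
  then have n: "(norm u)\<^sup>2 = norm (x * x + y * y)" by (simp flip: norm_star_mult_self)
  have "u + u\<^sup>\<star> = 2 *\<^sub>R x" unfolding us unfolding u_def scaleC_minus_left by (simp add: scaleR_2)
  then have "2 * norm x \<le> norm u + norm (u\<^sup>\<star>)"
    using norm_triangle_ineq[of u "u\<^sup>\<star>"] by simp
  then have "norm x \<le> norm u" by simp
  then show ?thesis unfolding n[symmetric] by (simp add: power_mono)
qed

subsection \<open>Square roots and positivity\<close>

text \<open>The Taylor coefficients of sqrt(1 - s) at s = 0.\<close>

definition sqrt_coeff :: "nat \<Rightarrow> real" where
  "sqrt_coeff n = (1/2 gchoose n) * (- 1) ^ n"

lemma sqrt_coeff_0 [simp]: "sqrt_coeff 0 = 1"
  by (simp add: sqrt_coeff_def)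

lemma sqrt_coeff_rec: "sqrt_coeff (Suc n) * (real n + 1) = sqrt_coeff n * (real n - 1/2)"
proof -
  have "(1/2 gchoose Suc n) * (real n + 1) = (1/2 gchoose n) * (1/2 - real n)"
    using gbinomial_mult_1[of "1/2::real" n] by (simp add: algebra_simps)
  then have "(1/2 gchoose Suc n) * (real n + 1) * (- 1) ^ Suc n
      = (1/2 gchoose n) * (1/2 - real n) * (- 1) ^ Suc n"
    by simp
  then show ?thesis
    by (simp add: sqrt_coeff_def algebra_simps)
qed

lemma sqrt_coeff_nonpos: "sqrt_coeff (Suc n) \<le> 0"
proof (induction n)
  case 0
  show ?case using sqrt_coeff_rec[of 0] by simp
next
  case (Suc n)
  have "sqrt_coeff (Suc (Suc n)) * (real (Suc n) + 1) \<le> 0"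
    unfolding sqrt_coeff_rec using Suc by (simp add: mult_le_0_iff)
  then show ?case by (simp add: mult_le_0_iff)
qed

text \<open>Partial sums are the coefficients of sqrt(1 - s) / (1 - s) = (1 - s)^(-1/2), which are
  nonnegative.\<close>

lemma sum_sqrt_coeff_nonneg: "(\<Sum>k\<le>n. sqrt_coeff k) \<ge> 0"
proof -
  have "(\<Sum>k\<le>n. sqrt_coeff k) = (- 1) ^ n * ((1/2 - 1 :: real) gchoose n)"
    unfolding sqrt_coeff_def by (rule gbinomial_sum_lower_neg)
  also have "(1/2 - 1 :: real) gchoose n = (- 1) ^ n * pochhammer (1/2) n / fact n"
    by (simp add: gbinomial_pochhammer)
  also have "(- 1) ^ n * ((- 1) ^ n * pochhammer (1/2) n / fact n) = pochhammer (1/2::real) n / fact n"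
    by (simp flip: power_mult_distrib mult.assoc)
  also have "\<dots> \<ge> 0" by (simp add: pochhammer_nonneg)
  finally show ?thesis .
qed

text \<open>All coefficients after the constant one are nonpositive, so their absolute values add up
  to one minus a partial sum. Hence the series converges absolutely up to norm one, boundary
  included.\<close>

lemma sum_abs_sqrt_coeff: "(\<Sum>k<n. \<bar>sqrt_coeff (Suc k)\<bar>) \<le> 1"
proof -
  have "(\<Sum>k\<le>n. sqrt_coeff k) = 1 + (\<Sum>k<n. sqrt_coeff (Suc k))"
    by (subst sum.atMost_shift) simp
  moreover have "(\<Sum>k<n. \<bar>sqrt_coeff (Suc k)\<bar>) = (\<Sum>k<n. - sqrt_coeff (Suc k))"
    by (rule sum.cong) (auto simp: sqrt_coeff_nonpos abs_of_nonpos)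
  ultimately show ?thesis
    using sum_sqrt_coeff_nonneg[of n] by (simp add: sum_negf)
qed

lemma summable_abs_sqrt_coeff_Suc: "summable (\<lambda>k. \<bar>sqrt_coeff (Suc k)\<bar>)"
  by (rule summableI_nonneg_bounded[where x = 1]) (auto simp: sum_abs_sqrt_coeff)

definition sqrt_one_minus :: "'a::cstar_algebra_1 \<Rightarrow> 'a" where
  "sqrt_one_minus k = (\<Sum>n. sqrt_coeff n *\<^sub>R k ^ n)"

lemma norm_power_le_one: "norm (k ^ n) \<le> 1" if "norm k \<le> 1" for k :: "'a::real_normed_algebra_1"
  using norm_power_ineq[of k n] power_mono[OF that, of n] by simp

lemma summable_norm_sqrt_series_Suc:
  assumes "norm (k::'a::cstar_algebra_1) \<le> 1"
  shows "summable (\<lambda>n. norm (sqrt_coeff (Suc n) *\<^sub>R k ^ Suc n))"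
proof (rule summable_comparison_test'[OF summable_abs_sqrt_coeff_Suc])
  fix n
  show "norm (norm (sqrt_coeff (Suc n) *\<^sub>R k ^ Suc n)) \<le> \<bar>sqrt_coeff (Suc n)\<bar>"
    using norm_power_le_one[OF assms, of "Suc n"] by (simp add: mult_left_le del: power_Suc)
qed

lemma summable_norm_sqrt_series:
  assumes "norm (k::'a::cstar_algebra_1) \<le> 1"
  shows "summable (\<lambda>n. norm (sqrt_coeff n *\<^sub>R k ^ n))"
  using summable_norm_sqrt_series_Suc[OF assms]
    summable_Suc_iff[of "\<lambda>n. norm (sqrt_coeff n *\<^sub>R k ^ n)"] by blast

lemma summable_sqrt_series:
  assumes "norm (k::'a::cstar_algebra_1) \<le> 1"
  shows "summable (\<lambda>n. sqrt_coeff n *\<^sub>R k ^ n)"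
  using summable_norm_cancel[OF summable_norm_sqrt_series[OF assms]] .

text \<open>By Vandermonde's identity the Cauchy product of the series with itself has the
  coefficients of 1 - s.\<close>

lemma sqrt_one_minus_square:
  assumes "norm (k::'a::cstar_algebra_1) \<le> 1"
  shows "sqrt_one_minus k * sqrt_one_minus k = 1 - k"
proof -
  have coeff: "(\<Sum>i\<le>n. sqrt_coeff i * sqrt_coeff (n - i)) = (1 gchoose n) * (- 1) ^ n" for n
  proof -
    have "(\<Sum>i\<le>n. sqrt_coeff i * sqrt_coeff (n - i))
        = (\<Sum>i\<le>n. ((1/2 gchoose i) * (1/2 gchoose (n - i))) * (- 1) ^ n)"
    proof (intro sum.cong refl)
      fix i assume "i \<in> {..n}"
      then have "(- 1 :: real) ^ n = (- 1) ^ i * (- 1) ^ (n - i)" by (simp flip: power_add)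
      then show "sqrt_coeff i * sqrt_coeff (n - i) = ((1/2 gchoose i) * (1/2 gchoose (n - i))) * (- 1) ^ n"
        by (simp add: sqrt_coeff_def)
    qed
    also have "\<dots> = (\<Sum>i\<in>{0..n}. (1/2 gchoose i) * (1/2 gchoose (n - i))) * (- 1) ^ n"
      by (simp add: sum_distrib_right atMost_atLeast0)
    also have "\<dots> = (1 gchoose n) * (- 1) ^ n"
      by (subst gbinomial_Vandermonde) simp
    finally show ?thesis .
  qed
  have "(\<lambda>n. \<Sum>i\<le>n. (sqrt_coeff i *\<^sub>R k ^ i) * (sqrt_coeff (n - i) *\<^sub>R k ^ (n - i)))
      sums (sqrt_one_minus k * sqrt_one_minus k)"
    unfolding sqrt_one_minus_def
    by (rule Cauchy_product_sums) (rule summable_norm_sqrt_series[OF assms])+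
  also have "(\<lambda>n. \<Sum>i\<le>n. (sqrt_coeff i *\<^sub>R k ^ i) * (sqrt_coeff (n - i) *\<^sub>R k ^ (n - i)))
      = (\<lambda>n. ((1 gchoose n) * (- 1) ^ n) *\<^sub>R k ^ n)"
  proof
    fix n
    have "(\<Sum>i\<le>n. (sqrt_coeff i *\<^sub>R k ^ i) * (sqrt_coeff (n - i) *\<^sub>R k ^ (n - i)))
        = (\<Sum>i\<le>n. (sqrt_coeff i * sqrt_coeff (n - i)) *\<^sub>R k ^ n)"
      by (intro sum.cong refl) (simp flip: power_add)
    then show "(\<Sum>i\<le>n. (sqrt_coeff i *\<^sub>R k ^ i) * (sqrt_coeff (n - i) *\<^sub>R k ^ (n - i)))
        = ((1 gchoose n) * (- 1) ^ n) *\<^sub>R k ^ n"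
      by (simp only: coeff scaleR_sum_left[symmetric])
  qed
  finally have s: "(\<lambda>n. ((1 gchoose n) * (- 1) ^ n) *\<^sub>R k ^ n) sums (sqrt_one_minus k * sqrt_one_minus k)" .
  have "((1::real) gchoose n) = 0" if "n \<notin> {0, 1}" for n
    using that binomial_gbinomial[of 1 n, where 'a = real] by (simp add: binomial_eq_0)
  then have "(\<lambda>n. ((1 gchoose n) * (- 1) ^ n) *\<^sub>R k ^ n)
      sums (\<Sum>n\<in>{0, 1}. ((1 gchoose n) * (- 1) ^ n) *\<^sub>R k ^ n)"
    by (intro sums_finite) auto
  then show ?thesis using sums_unique2[OF s] by simp
qed

text \<open>The non-constant coefficients have absolute sum at most one. This bound is what makes
  the roots constructed below positive.\<close>

lemma norm_one_minus_sqrt: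
  assumes "norm (k::'a::cstar_algebra_1) \<le> 1"
  shows "norm (1 - sqrt_one_minus k) \<le> 1"
proof -
  have "sqrt_one_minus k = 1 + (\<Sum>n. sqrt_coeff (Suc n) *\<^sub>R k ^ Suc n)"
    unfolding sqrt_one_minus_def using suminf_split_head[OF summable_sqrt_series[OF assms]] by simp
  then have "norm (1 - sqrt_one_minus k) = norm (\<Sum>n. sqrt_coeff (Suc n) *\<^sub>R k ^ Suc n)"
    by (simp add: norm_minus_commute)
  also have "\<dots> \<le> (\<Sum>n. norm (sqrt_coeff (Suc n) *\<^sub>R k ^ Suc n))"
    by (rule summable_norm[OF summable_norm_sqrt_series_Suc[OF assms]])
  also have "\<dots> \<le> (\<Sum>n. \<bar>sqrt_coeff (Suc n)\<bar>)"
    using norm_power_le_one[OF assms]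
    by (intro suminf_le summable_norm_sqrt_series_Suc assms summable_abs_sqrt_coeff_Suc)
       (simp add: mult_left_le del: power_Suc)
  also have "\<dots> \<le> 1"
    by (rule suminf_le_const[OF summable_abs_sqrt_coeff_Suc sum_abs_sqrt_coeff])
  finally show ?thesis .
qed

text \<open>The relation passes to all powers, hence to the series. The case of different
  \<open>k\<close> and \<open>l\<close> is needed in \<open>star_mult_self_nonpos\<close>.\<close>

lemma sqrt_one_minus_intertwine:
  fixes x :: "'a::cstar_algebra_1"
  assumes "norm k \<le> 1" "norm l \<le> 1" "x * k = l * x"
  shows "x * sqrt_one_minus k = sqrt_one_minus l * x"
proof -
  have p: "x * k ^ n = l ^ n * x" for n
  proof (induction n)
    case (Suc n)
    have "x * k ^ Suc n = (x * k ^ n) * k" by (simp only: power_Suc2 mult.assoc)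
    also have "\<dots> = l ^ Suc n * x" by (simp only: Suc power_Suc2 mult.assoc assms)
    finally show ?case .
  qed simp
  have "x * sqrt_one_minus k = (\<Sum>n. x * (sqrt_coeff n *\<^sub>R k ^ n))"
    unfolding sqrt_one_minus_def by (rule suminf_mult[OF summable_sqrt_series[OF assms(1)], symmetric])
  also have "\<dots> = (\<Sum>n. (sqrt_coeff n *\<^sub>R l ^ n) * x)" by (simp add: p)
  also have "\<dots> = sqrt_one_minus l * x"
    unfolding sqrt_one_minus_def by (rule suminf_mult2[OF summable_sqrt_series[OF assms(2)], symmetric])
  finally show ?thesis .
qed

lemma star_power: "(x ^ n)\<^sup>\<star> = (x::'a::cstar_algebra_1)\<^sup>\<star> ^ n"
  by (induction n) (simp_all add: star_mult power_commutes)

lemma star_sqrt_one_minus: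
  assumes "norm (k::'a::cstar_algebra_1) \<le> 1"
  shows "(sqrt_one_minus k)\<^sup>\<star> = sqrt_one_minus (k\<^sup>\<star>)"
  unfolding sqrt_one_minus_def
  by (subst bounded_linear.suminf[OF bounded_linear_star summable_sqrt_series[OF assms]])
     (simp add: star_scaleR star_power)

text \<open>Real linear combinations, products and limits suffice for power series with real
  coefficients, so roots and inverses of elements of such a set stay in it.\<close>

definition real_subalgebra :: "'a::cstar_algebra_1 set \<Rightarrow> bool" where
  "real_subalgebra S \<longleftrightarrow> closed S \<and> subspace S \<and> 1 \<in> S \<and> (\<forall>x\<in>S. \<forall>y\<in>S. x * y \<in> S)"

lemma suminf_in_closed_subspace:
  fixes f :: "nat \<Rightarrow> 'a::real_normed_vector"
  assumes "closed S" "subspace S" "\<And>n. f n \<in> S" "summable f"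
  shows "suminf f \<in> S"
proof (rule closed_sequentially[OF assms(1)])
  show "(\<lambda>n. \<Sum>i<n. f i) \<longlonglongrightarrow> suminf f" by (rule summable_LIMSEQ[OF assms(4)])
  show "(\<Sum>i<n. f i) \<in> S" for n using assms by (intro subspace_sum) auto
qed

lemma real_subalgebra_power:
  assumes "real_subalgebra S" "k \<in> S"
  shows "k ^ n \<in> S"
  using assms by (induction n) (auto simp: real_subalgebra_def)

lemma sqrt_one_minus_in:
  assumes "real_subalgebra S" "k \<in> S" "norm k \<le> 1"
  shows "sqrt_one_minus k \<in> S"
  unfolding sqrt_one_minus_def
  using assms real_subalgebra_power[OF assms(1,2)]
  by (intro suminf_in_closed_subspace summable_sqrt_series)
     (auto simp: real_subalgebra_def subspace_scale)

text \<open>An element is called positive if it is self-adjoint and \<open>\<parallel>r - a\<parallel> \<le> r\<close> for some real \<open>r\<close>, which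
  says that its spectrum is contained in \<open>[0, 2r]\<close>.\<close>

definition pos :: "'a::cstar_algebra_1 \<Rightarrow> bool" where
  "pos a \<longleftrightarrow> a\<^sup>\<star> = a \<and> (\<exists>r. norm (r *\<^sub>R 1 - a) \<le> r)"

lemma pos_star: "pos a \<Longrightarrow> a\<^sup>\<star> = a"
  by (simp add: pos_def)

lemma posI: "a\<^sup>\<star> = a \<Longrightarrow> norm (r *\<^sub>R 1 - a) \<le> r \<Longrightarrow> pos a"
  by (auto simp: pos_def)

lemma pos_bound_mono:
  fixes a :: "'a::cstar_algebra_1"
  assumes "norm (r *\<^sub>R 1 - a) \<le> r" "r \<le> s"
  shows "norm (s *\<^sub>R 1 - a) \<le> s"
proof -
  have "s *\<^sub>R 1 - a = (s - r) *\<^sub>R 1 + (r *\<^sub>R 1 - a)" by (simp add: algebra_simps)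
  then have "norm (s *\<^sub>R 1 - a) \<le> norm ((s - r) *\<^sub>R (1::'a)) + norm (r *\<^sub>R 1 - a)"
    by (metis norm_triangle_ineq)
  with assms show ?thesis by simp
qed

lemma pos_add: "pos (a + b)" if "pos a" "pos b"
proof -
  obtain r s where "norm (r *\<^sub>R 1 - a) \<le> r" "norm (s *\<^sub>R 1 - b) \<le> s"
    using \<open>pos a\<close> \<open>pos b\<close> by (auto simp: pos_def)
  then have "norm ((r + s) *\<^sub>R 1 - (a + b)) \<le> r + s"
    using norm_triangle_ineq[of "r *\<^sub>R 1 - a" "s *\<^sub>R 1 - b"] by (simp add: algebra_simps)
  then show ?thesis using that by (intro posI) (auto simp: star_add pos_star)
qed

lemma pos_scaleR: "pos (t *\<^sub>R a)" if "pos a" "t \<ge> 0"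
proof -
  obtain r where r: "norm (r *\<^sub>R 1 - a) \<le> r" using \<open>pos a\<close> by (auto simp: pos_def)
  have "norm ((t * r) *\<^sub>R 1 - t *\<^sub>R a) = norm (t *\<^sub>R (r *\<^sub>R 1 - a))"
    by (simp add: scaleR_diff_right)
  also have "\<dots> \<le> t * r" using r that by (simp add: mult_left_mono)
  finally show ?thesis using that by (intro posI) (auto simp: star_scaleR pos_star)
qed

lemma pos_zero [simp]: "pos 0"
  by (rule posI[where r = 0]) auto

lemma pos_one [simp]: "pos 1"
  by (rule posI[where r = 1]) auto

lemma pos_scaleR_one_iff [simp]: "pos (t *\<^sub>R 1) \<longleftrightarrow> t \<ge> 0"
proof
  assume "pos (t *\<^sub>R 1 :: 'a::cstar_algebra_1)"
  then obtain r where "norm (r *\<^sub>R 1 - t *\<^sub>R (1::'a)) \<le> r" by (auto simp: pos_def)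
  then show "t \<ge> 0" by (simp flip: scaleR_diff_left)
qed (simp add: pos_scaleR)

lemma pos_sum: "(\<And>i. i \<in> I \<Longrightarrow> pos (f i)) \<Longrightarrow> pos (\<Sum>i\<in>I. f i)"
  by (induction I rule: infinite_finite_induct) (auto intro: pos_add)

section \<open>Square roots of positive elements\<close>

definition root_of :: "real \<Rightarrow> 'a::cstar_algebra_1 \<Rightarrow> 'a" where
  "root_of r a = sqrt r *\<^sub>R sqrt_one_minus (1 - (1/r) *\<^sub>R a)"

lemma norm_root_arg:
  fixes a :: "'a::cstar_algebra_1"
  assumes "r > 0" "norm (r *\<^sub>R 1 - a) \<le> r"
  shows "norm (1 - (1/r) *\<^sub>R a) \<le> 1"
proof -
  have "1 - (1/r) *\<^sub>R a = (1/r) *\<^sub>R (r *\<^sub>R 1 - a)"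
    using assms by (simp add: scaleR_diff_right)
  then show ?thesis using assms by (simp add: divide_simps)
qed

lemma
  fixes a :: "'a::cstar_algebra_1"
  assumes r: "r > 0" "norm (r *\<^sub>R 1 - a) \<le> r"
  shows root_of_square: "root_of r a * root_of r a = a"
    and pos_root_of: "a\<^sup>\<star> = a \<Longrightarrow> pos (root_of r a)"
    and root_of_in: "real_subalgebra S \<Longrightarrow> a \<in> S \<Longrightarrow> root_of r a \<in> S"
proof -
  note n = norm_root_arg[OF r]
  show "root_of r a * root_of r a = a"
    using r by (simp add: root_of_def sqrt_one_minus_square[OF n])
  have st: "(root_of r a)\<^sup>\<star> = root_of r a" if "a\<^sup>\<star> = a"
    using that by (simp add: root_of_def star_scaleR star_sqrt_one_minus[OF n] star_diff)
  have "norm (sqrt r *\<^sub>R 1 - root_of r a) = norm (sqrt r *\<^sub>R (1 - sqrt_one_minus (1 - (1/r) *\<^sub>R a)))"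
    by (simp add: root_of_def scaleR_diff_right)
  also have "\<dots> \<le> sqrt r" using norm_one_minus_sqrt[OF n] r by (simp add: mult_left_le)
  finally show "pos (root_of r a)" if "a\<^sup>\<star> = a" using st[OF that] by (intro posI)
  show "root_of r a \<in> S" if "real_subalgebra S" "a \<in> S"
    unfolding root_of_def using that sqrt_one_minus_in[OF that(1) _ n]
    by (auto simp: real_subalgebra_def subspace_scale subspace_diff)
qed

text \<open>Both roots are taken at the same scale \<open>r\<close>, so the arguments of the two
  series are intertwined as well. This is why \<open>root_of\<close> carries \<open>r\<close> as a
  parameter.\<close>

lemma root_of_intertwine:
  fixes x :: "'a::cstar_algebra_1"
  assumes "r > 0" "norm (r *\<^sub>R 1 - a) \<le> r" "norm (r *\<^sub>R 1 - b) \<le> r" "x * a = b * x"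
  shows "x * root_of r a = root_of r b * x"
  using sqrt_one_minus_intertwine[OF norm_root_arg[OF assms(1,2)] norm_root_arg[OF assms(1,3)], of x]
    assms(4) by (simp add: root_of_def algebra_simps)

lemma pos_obtain_bound:
  assumes "pos a"
  obtains r where "r > 0" "norm (r *\<^sub>R 1 - a) \<le> r" "r \<ge> s"
proof -
  obtain r where r: "norm (r *\<^sub>R 1 - a) \<le> r" using assms by (auto simp: pos_def)
  then have "r \<ge> 0" using norm_ge_zero order_trans by blast
  then show ?thesis using pos_bound_mono[OF r, of "max (r + 1) s"] that[of "max (r + 1) s"] by simp
qed

definition psqrt :: "'a::cstar_algebra_1 \<Rightarrow> 'a" where
  "psqrt a = root_of (SOME r. r > 0 \<and> norm (r *\<^sub>R 1 - a) \<le> r) a"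

lemma
  fixes a :: "'a::cstar_algebra_1"
  assumes a: "pos a"
  shows pos_psqrt: "pos (psqrt a)"
    and psqrt_square: "psqrt a * psqrt a = a"
    and psqrt_commute: "x * a = a * x \<Longrightarrow> x * psqrt a = psqrt a * x"
    and psqrt_in: "real_subalgebra S \<Longrightarrow> a \<in> S \<Longrightarrow> psqrt a \<in> S"
proof -
  define r where "r = (SOME r. r > 0 \<and> norm (r *\<^sub>R 1 - a) \<le> r)"
  have "\<exists>r. r > 0 \<and> norm (r *\<^sub>R 1 - a) \<le> r" using pos_obtain_bound[OF a] by blast
  then have "r > 0 \<and> norm (r *\<^sub>R 1 - a) \<le> r" unfolding r_def by (rule someI_ex)
  then have r: "r > 0" "norm (r *\<^sub>R 1 - a) \<le> r" by auto
  have eq: "psqrt a = root_of r a" by (simp add: psqrt_def r_def)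
  show "pos (psqrt a)" unfolding eq by (rule pos_root_of[OF r pos_star[OF a]])
  show "psqrt a * psqrt a = a" unfolding eq by (rule root_of_square[OF r])
  show "x * psqrt a = psqrt a * x" if "x * a = a * x"
    unfolding eq by (rule root_of_intertwine[OF r r(2) that])
  show "psqrt a \<in> S" if "real_subalgebra S" "a \<in> S"
    unfolding eq by (rule root_of_in[OF r that])
qed

text \<open>After scaling \<open>h\<close> to norm one, \<open>s = sqrt_one_minus (k * k)\<close>
  commutes with \<open>k\<close> and \<open>s * s + k * k = 1\<close>. Hence \<open>s\<close> has
  norm at most one, and so has \<open>1 - k * k = s * s\<close>.\<close>

lemma pos_square:
  fixes h :: "'a::cstar_algebra_1"
  assumes "h\<^sup>\<star> = h"
  shows "pos (h * h)"
proof (cases "h = 0")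
  case False
  define k where "k = (1 / norm h) *\<^sub>R h"
  have ks: "k\<^sup>\<star> = k" by (simp add: k_def star_scaleR assms)
  have "norm k = 1" using False by (simp add: k_def)
  then have kn: "norm (k * k) \<le> 1" by (simp add: norm_selfadjoint_square[OF ks])
  define s where "s = sqrt_one_minus (k * k)"
  have ss: "s\<^sup>\<star> = s" unfolding s_def star_sqrt_one_minus[OF kn] star_mult ks ..
  have s2: "s * s = 1 - k * k" unfolding s_def by (rule sqrt_one_minus_square[OF kn])
  have sk: "s * k = k * s"
    unfolding s_def by (rule sqrt_one_minus_intertwine[OF kn kn, symmetric]) (simp only: mult.assoc)
  have "(norm s)\<^sup>2 \<le> norm (s * s + k * k)"
    by (rule norm_square_le_sum_squares[OF ss ks sk])
  also have "\<dots> = 1" by (simp add: s2)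
  finally have "norm (1 - k * k) \<le> 1" using norm_selfadjoint_square[OF ss] by (simp only: s2)
  then have "pos (k * k)" by (intro posI[where r = 1]) (simp_all add: star_mult ks)
  then have "pos ((norm h)\<^sup>2 *\<^sub>R (k * k))" by (rule pos_scaleR) simp
  moreover have "(norm h)\<^sup>2 *\<^sub>R (k * k) = h * h"
    using False unfolding k_def by (simp add: power2_eq_square)
  ultimately show ?thesis by simp
qed simp

lemma norm_minus_pos: "a\<^sup>\<star> = a \<Longrightarrow> pos (norm a *\<^sub>R 1 - a)"
  by (rule posI[where r = "norm a"]) (auto simp: star_diff star_scaleR)

text \<open>The roots \<open>b\<close> of \<open>a\<close> and \<open>d\<close> of
  \<open>r *\<^sub>R 1 - a\<close> commute and their squares add up to \<open>r *\<^sub>R 1\<close>,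
  so \<open>norm_square_le_sum_squares\<close> bounds the square of the norm of \<open>b\<close> by
  \<open>r\<close>.\<close>

lemma norm_le_of_pos:
  fixes a :: "'a::cstar_algebra_1"
  assumes "pos a" "pos (r *\<^sub>R 1 - a)"
  shows "norm a \<le> r"
proof -
  have r: "r \<ge> 0" using pos_add[OF assms] by simp
  define b d where "b = psqrt a" and "d = psqrt (r *\<^sub>R 1 - a)"
  have b: "pos b" "b * b = a" and d: "pos d" "d * d = r *\<^sub>R 1 - a"
    using assms by (simp_all add: b_def d_def pos_psqrt psqrt_square)
  have "b * a = a * b" unfolding b(2)[symmetric] by (rule mult.assoc[symmetric])
  then have "b * (r *\<^sub>R 1 - a) = (r *\<^sub>R 1 - a) * b"
    by (simp only: right_diff_distrib left_diff_distrib) simp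
  then have bd: "b * d = d * b" unfolding d_def by (rule psqrt_commute[OF assms(2)])
  have "norm a \<le> (norm b)\<^sup>2" unfolding b(2)[symmetric] power2_eq_square by (rule norm_mult_ineq)
  also have "\<dots> \<le> norm (b * b + d * d)"
    by (rule norm_square_le_sum_squares[OF pos_star[OF b(1)] pos_star[OF d(1)] bd])
  also have "b * b + d * d = r *\<^sub>R 1" unfolding b(2) d(2) by simp
  finally show ?thesis using r by simp
qed

section \<open>Uniqueness of roots and positivity of \<open>x\<^sup>\<star> * x\<close>\<close>

lemma selfadjoint_cube_zero:
  fixes z :: "'a::cstar_algebra_1"
  assumes "z\<^sup>\<star> = z" "z * z * z = 0"
  shows "z = 0"
proof -
  have "(z * z) * (z * z) = 0" using assms(2) by (simp flip: mult.assoc)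
  then have "(norm (z * z))\<^sup>2 = 0"
    using norm_selfadjoint_square[of "z * z"] by (simp add: star_mult assms(1))
  then show ?thesis using norm_selfadjoint_square[OF assms(1)] by simp
qed

lemma star_mult_self_eq_zero: "(x::'a::cstar_algebra_1)\<^sup>\<star> * x = 0 \<Longrightarrow> x = 0"
  using norm_star_mult_self[of x] by simp

lemma pos_antisym: "pos a \<Longrightarrow> pos (- a) \<Longrightarrow> a = 0"
  using norm_le_of_pos[of a 0] by simp

text \<open>With \<open>e\<close> the root of \<open>c\<close>, the element is the square of the
  self-adjoint \<open>z * e\<close>. The version without commutation, \<open>pos_conj\<close>, rests
  on \<open>pos_star_mult_self\<close>, whose proof uses this one.\<close>

lemma pos_conj_commuting:
  assumes "pos c" "z\<^sup>\<star> = z" "z * c = c * z"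
  shows "pos (z * c * z)"
proof -
  define e where "e = psqrt c"
  have ze: "z * e = e * z" unfolding e_def by (rule psqrt_commute[OF assms(1,3)])
  have es: "e\<^sup>\<star> = e" and ee: "e * e = c"
    unfolding e_def using assms(1) by (simp_all add: pos_psqrt pos_star psqrt_square)
  have "z * c * z = (z * e) * (e * z)" unfolding ee[symmetric] by (simp only: mult.assoc)
  also have "\<dots> = (z * e) * (z * e)" unfolding ze ..
  finally show ?thesis using pos_square[of "z * e"] by (simp add: star_mult assms(2) es ze)
qed

text \<open>With \<open>z = c - d\<close> one has \<open>(c + d) * z = 0\<close>, so the positive
  elements \<open>z * c * z\<close> and \<open>z * d * z\<close> add up to zero. Both vanish, hence
  so does the cube of \<open>z\<close>.\<close>

lemma pos_root_unique:
  fixes c d :: "'a::cstar_algebra_1"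
  assumes "pos c" "pos d" "c * c = d * d" "c * d = d * c"
  shows "c = d"
proof -
  define z where "z = c - d"
  have zs: "z\<^sup>\<star> = z" by (simp add: z_def star_diff pos_star assms)
  have zc: "z * c = c * z" and zd: "z * d = d * z"
    by (simp_all add: z_def left_diff_distrib right_diff_distrib assms(4))
  have "(c + d) * z = 0" using assms by (simp add: z_def algebra_simps)
  then have sum: "z * c * z + z * d * z = 0"
    by (metis distrib_left distrib_right mult.assoc mult_zero_right)
  have "z * c * z = 0"
    using pos_antisym[OF pos_conj_commuting[OF assms(1) zs zc]] pos_conj_commuting[OF assms(2) zs zd] sum
    by (simp add: add_eq_0_iff)
  with sum have "z * (c - d) * z = 0" by (simp add: algebra_simps)
  then have "z = 0" using selfadjoint_cube_zero[OF zs] by (simp only: z_def)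
  then show ?thesis by (simp add: z_def)
qed

text \<open>Let \<open>a = - (x\<^sup>\<star> * x)\<close> and
  \<open>b = x * x\<^sup>\<star>\<close>. Real and imaginary parts of \<open>x\<close> show that
  \<open>b\<close> is positive too. From \<open>x * (a * a) = (b * b) * x\<close>, uniqueness of
  roots yields \<open>x * a = b * x\<close>. But \<open>x * a = - (b * x)\<close> by definition, so
  \<open>b * x = 0\<close>.\<close>

lemma star_mult_self_nonpos:
  fixes x :: "'a::cstar_algebra_1"
  assumes "pos (- (x\<^sup>\<star> * x))"
  shows "x = 0"
proof -
  define a b where "a = - (x\<^sup>\<star> * x)" and "b = x * x\<^sup>\<star>"
  have a: "pos a" using assms by (simp add: a_def)
  define P Q where "P = x + x\<^sup>\<star>" and "Q = \<i> *\<^sub>C (x - x\<^sup>\<star>)"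
  have Ps: "P\<^sup>\<star> = P" by (simp add: P_def star_add star_star add.commute)
  have Qs: "Q\<^sup>\<star> = Q"
    by (simp add: Q_def star_scaleC star_diff star_star scaleC_minus_left flip: scaleC_minus_right)
  have QQ: "Q * Q = - ((x - x\<^sup>\<star>) * (x - x\<^sup>\<star>))"
    using scaleR_eq_scaleC[of "-1" "(x - x\<^sup>\<star>) * (x - x\<^sup>\<star>)"]
    by (simp add: Q_def mult_scaleC_left mult_scaleC_right scaleC_scaleC)
  have "P * P + Q * Q = 2 *\<^sub>R (b - a)"
    unfolding QQ by (simp add: P_def a_def b_def algebra_simps scaleR_2)
  then have "b = (1/2) *\<^sub>R (P * P + Q * Q) + a" by simp
  then have b: "pos b"
    using pos_add[OF pos_scaleR[OF pos_add[OF pos_square[OF Ps] pos_square[OF Qs]], of "1/2"] a] by simp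
  obtain r0 where r0: "norm (r0 *\<^sub>R 1 - a * a) \<le> r0" "r0 > 0"
    using pos_obtain_bound[OF pos_square[OF pos_star[OF a]]] by blast
  \<comment> \<open>One scale for both squares, as \<open>root_of_intertwine\<close>
    demands.\<close>
  obtain r where r: "norm (r *\<^sub>R 1 - b * b) \<le> r" "r > 0" "r \<ge> r0"
    using pos_obtain_bound[OF pos_square[OF pos_star[OF b]]] by blast
  have ra: "norm (r *\<^sub>R 1 - a * a) \<le> r" by (rule pos_bound_mono[OF r0(1) r(3)])
  have sq: "c = root_of r (c * c)" if c: "pos c" "norm (r *\<^sub>R 1 - c * c) \<le> r" for c :: 'a
  proof (rule pos_root_unique[OF c(1)])
    show "pos (root_of r (c * c))"
      by (rule pos_root_of[OF r(2) c(2)]) (simp add: star_mult pos_star[OF c(1)])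
    show "c * c = root_of r (c * c) * root_of r (c * c)"
      by (rule root_of_square[OF r(2) c(2), symmetric])
    show "c * root_of r (c * c) = root_of r (c * c) * c"
      by (rule root_of_intertwine[OF r(2) c(2) c(2)]) (simp only: mult.assoc)
  qed
  have xab: "x * (a * a) = (b * b) * x" by (simp add: a_def b_def mult.assoc)
  have "x * a = b * x"
    using root_of_intertwine[OF r(2) ra r(1) xab] sq[OF a ra] sq[OF b r(1)] by simp
  moreover have "x * a = - (b * x)" by (simp add: a_def b_def mult.assoc)
  ultimately have "b * x + b * x = 0" by (metis add.right_inverse)
  then have "2 *\<^sub>R (b * x) = 0" by (simp only: scaleR_2)
  then have "b * x = 0" by simp
  then have "x\<^sup>\<star> * (b * x) = 0" by simp
  then have "(x\<^sup>\<star> * x)\<^sup>\<star> * (x\<^sup>\<star> * x) = 0" by (simp add: b_def star_mult star_star mult.assoc)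
  then have "x\<^sup>\<star> * x = 0" by (rule star_mult_self_eq_zero)
  then show "x = 0" by (rule star_mult_self_eq_zero)
qed

text \<open>If \<open>h = x\<^sup>\<star> x\<close> and \<open>g = |h| - h\<close>, then \<open>(x g)\<^sup>\<star> (x g) = - g |h| g\<close> is negative, which forces \<open>g = 0\<close>.\<close>

theorem pos_star_mult_self: "pos ((x::'a::cstar_algebra_1)\<^sup>\<star> * x)"
proof -
  define h where "h = x\<^sup>\<star> * x"
  have hs: "h\<^sup>\<star> = h" by (simp add: h_def star_mult star_star)
  define m where "m = psqrt (h * h)"
  have m: "pos m" unfolding m_def by (rule pos_psqrt[OF pos_square[OF hs]])
  have mm: "m * m = h * h" unfolding m_def by (rule psqrt_square[OF pos_square[OF hs]])
  have hm: "h * m = m * h" unfolding m_def by (rule psqrt_commute[OF pos_square[OF hs]]) (simp only: mult.assoc)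
  define g where "g = m - h"
  have gs: "g\<^sup>\<star> = g" by (simp add: g_def star_diff pos_star[OF m] hs)
  have gm: "g * m = m * g" by (simp add: g_def left_diff_distrib right_diff_distrib hm)
  have "(m + h) * g = 0" by (simp add: g_def algebra_simps mm hm)
  then have "g * ((m + h) * g) = 0" by simp
  then have sum: "g * m * g + g * h * g = 0" by (simp add: algebra_simps)
  have "(x * g)\<^sup>\<star> * (x * g) = g * h * g" by (simp add: star_mult gs h_def mult.assoc)
  moreover have "pos (- (g * h * g))"
    using pos_conj_commuting[OF m gs gm] sum by (simp add: eq_neg_iff_add_eq_0[symmetric])
  ultimately have "x * g = 0" using star_mult_self_nonpos[of "x * g"] by simp
  then have "g * h * g = 0" by (simp add: h_def mult.assoc)
  with sum have "g * (m - h) * g = 0" by (simp add: algebra_simps)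
  then have "g = 0" using selfadjoint_cube_zero[OF gs] by (simp only: g_def)
  then show ?thesis using m by (simp add: g_def h_def)
qed

lemma pos_self_mult_star: "pos ((x::'a::cstar_algebra_1) * x\<^sup>\<star>)"
  using pos_star_mult_self[of "x\<^sup>\<star>"] by (simp add: star_star)

lemma pos_conj:
  assumes "pos a"
  shows "pos (y\<^sup>\<star> * a * y)"
proof -
  have "y\<^sup>\<star> * a * y = (psqrt a * y)\<^sup>\<star> * (psqrt a * y)"
    unfolding star_mult pos_star[OF pos_psqrt[OF assms]]
    by (subst (1) psqrt_square[OF assms, symmetric]) (simp only: mult.assoc)
  then show ?thesis using pos_star_mult_self by metis
qed

subsection \<open>The order\<close>

definition cle :: "'a::cstar_algebra_1 \<Rightarrow> 'a \<Rightarrow> bool" (infix \<open>\<preceq>\<close> 50) where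
  "a \<preceq> b \<longleftrightarrow> pos (b - a)"

lemma cle_refl [simp]: "a \<preceq> a"
  by (simp add: cle_def)

lemma cle_trans [trans]: "a \<preceq> b \<Longrightarrow> b \<preceq> c \<Longrightarrow> a \<preceq> c"
  using pos_add[of "c - b" "b - a"] by (simp add: cle_def)

lemma cle_eq_trans [trans]: "a \<preceq> b \<Longrightarrow> b = c \<Longrightarrow> a \<preceq> c"
  and eq_cle_trans [trans]: "a = b \<Longrightarrow> b \<preceq> c \<Longrightarrow> a \<preceq> c"
  by simp_all

lemma cle_add_mono: "a \<preceq> b \<Longrightarrow> c \<preceq> d \<Longrightarrow> a + c \<preceq> b + d"
  using pos_add[of "b - a" "d - c"] by (simp add: cle_def algebra_simps)

lemma cle_sum_mono: "(\<And>i. i \<in> I \<Longrightarrow> f i \<preceq> g i) \<Longrightarrow> (\<Sum>i\<in>I. f i) \<preceq> (\<Sum>i\<in>I. g i)"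
  unfolding cle_def sum_subtractf[symmetric] by (rule pos_sum)

lemma cle_scaleR_mono: "a \<preceq> b \<Longrightarrow> t \<ge> 0 \<Longrightarrow> t *\<^sub>R a \<preceq> t *\<^sub>R b"
  unfolding cle_def scaleR_diff_right[symmetric] by (rule pos_scaleR)

lemma cle_scaleR_mono_left: "pos a \<Longrightarrow> s \<le> t \<Longrightarrow> s *\<^sub>R a \<preceq> t *\<^sub>R a"
  unfolding cle_def scaleR_diff_left[symmetric] by (rule pos_scaleR) auto

lemma cle_scaleR_one: "s \<le> t \<Longrightarrow> s *\<^sub>R 1 \<preceq> t *\<^sub>R 1"
  by (rule cle_scaleR_mono_left) auto

lemma pos_cle: "pos a \<Longrightarrow> a \<preceq> b \<Longrightarrow> pos b"
  using pos_add[of a "b - a"] by (simp add: cle_def)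

lemma cle_conj: "a \<preceq> b \<Longrightarrow> y\<^sup>\<star> * a * y \<preceq> y\<^sup>\<star> * b * y"
  using pos_conj[of "b - a" y] by (simp add: cle_def algebra_simps)

lemma cle_norm: "a\<^sup>\<star> = a \<Longrightarrow> a \<preceq> norm a *\<^sub>R 1"
  by (simp add: cle_def norm_minus_pos)

lemma norm_cle_iff: "pos a \<Longrightarrow> a \<preceq> r *\<^sub>R 1 \<longleftrightarrow> norm a \<le> r"
proof
  assume a: "pos a" and "norm a \<le> r"
  then show "a \<preceq> r *\<^sub>R 1" using cle_trans[OF cle_norm[OF pos_star[OF a]] cle_scaleR_one] by blast
qed (auto simp: cle_def intro: norm_le_of_pos)

lemma norm_cle_mono: "pos a \<Longrightarrow> a \<preceq> b \<Longrightarrow> norm a \<le> norm b"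
  using norm_cle_iff[of a "norm b"] cle_trans[of a b "norm b *\<^sub>R 1"] cle_norm[of b] pos_cle[of a b] pos_star
  by blast

lemma cle_mult_norm: "(x * y)\<^sup>\<star> * (x * y) \<preceq> (norm x)\<^sup>2 *\<^sub>R (y\<^sup>\<star> * y)"
proof -
  have "y\<^sup>\<star> * (x\<^sup>\<star> * x) * y \<preceq> y\<^sup>\<star> * ((norm x)\<^sup>2 *\<^sub>R 1) * y"
    by (rule cle_conj) (simp add: norm_cle_iff[OF pos_star_mult_self] norm_star_mult_self)
  then show ?thesis by (simp add: star_mult mult.assoc)
qed

lemma cle_star_mult_norm: "norm x \<le> r \<Longrightarrow> x\<^sup>\<star> * x \<preceq> r\<^sup>2 *\<^sub>R 1"
  by (simp add: norm_cle_iff[OF pos_star_mult_self] norm_star_mult_self power_mono)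

lemma norm_le_if_cle: "x\<^sup>\<star> * x \<preceq> r\<^sup>2 *\<^sub>R 1 \<Longrightarrow> r \<ge> 0 \<Longrightarrow> norm x \<le> r"
  by (simp add: norm_cle_iff[OF pos_star_mult_self] norm_star_mult_self)

lemma cle_square_add: "(a + b)\<^sup>\<star> * (a + b) \<preceq> 2 *\<^sub>R (a\<^sup>\<star> * a + b\<^sup>\<star> * b)"
proof -
  have "2 *\<^sub>R (a\<^sup>\<star> * a + b\<^sup>\<star> * b) - (a + b)\<^sup>\<star> * (a + b) = (a - b)\<^sup>\<star> * (a - b)"
    by (simp add: star_add star_diff algebra_simps scaleR_2)
  then show ?thesis unfolding cle_def using pos_star_mult_self by metis
qed

lemma cle_square_add3:
  "(a + b + c)\<^sup>\<star> * (a + b + c) \<preceq> 3 *\<^sub>R (a\<^sup>\<star> * a + b\<^sup>\<star> * b + c\<^sup>\<star> * c)"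
proof -
  have 3: "3 *\<^sub>R x = x + x + x" for x :: 'a using scaleR_add_left[of 2 1 x] by (simp add: scaleR_2)
  have "3 *\<^sub>R (a\<^sup>\<star> * a + b\<^sup>\<star> * b + c\<^sup>\<star> * c) - (a + b + c)\<^sup>\<star> * (a + b + c)
      = (a - b)\<^sup>\<star> * (a - b) + (b - c)\<^sup>\<star> * (b - c) + (a - c)\<^sup>\<star> * (a - c)"
    unfolding 3 by (simp add: star_add star_diff algebra_simps)
  then show ?thesis unfolding cle_def using pos_star_mult_self pos_add by metis
qed

text \<open>Cauchy-Schwarz for a row contraction: with \<open>z\<close> the sum on the left, expand
  the positive sum of the squares of \<open>b i - (a i)\<^sup>\<star> * z\<close>. The row bound
  absorbs the term quadratic in \<open>a\<close>.\<close>

lemma cle_row_column: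
  fixes a b :: "'i \<Rightarrow> 'a::cstar_algebra_1"
  assumes "(\<Sum>i\<in>I. a i * (a i)\<^sup>\<star>) \<preceq> 1"
  shows "(\<Sum>i\<in>I. a i * b i)\<^sup>\<star> * (\<Sum>i\<in>I. a i * b i) \<preceq> (\<Sum>i\<in>I. (b i)\<^sup>\<star> * b i)"
proof -
  define z where "z = (\<Sum>i\<in>I. a i * b i)"
  have zs: "z\<^sup>\<star> = (\<Sum>i\<in>I. (b i)\<^sup>\<star> * (a i)\<^sup>\<star>)" by (simp add: z_def star_sum star_mult)
  have "pos (\<Sum>i\<in>I. (b i - (a i)\<^sup>\<star> * z)\<^sup>\<star> * (b i - (a i)\<^sup>\<star> * z))"
    by (intro pos_sum pos_star_mult_self)
  also have "(\<Sum>i\<in>I. (b i - (a i)\<^sup>\<star> * z)\<^sup>\<star> * (b i - (a i)\<^sup>\<star> * z))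
    = (\<Sum>i\<in>I. (b i)\<^sup>\<star> * b i) - (\<Sum>i\<in>I. (b i)\<^sup>\<star> * (a i)\<^sup>\<star>) * z - z\<^sup>\<star> * (\<Sum>i\<in>I. a i * b i)
      + z\<^sup>\<star> * (\<Sum>i\<in>I. a i * (a i)\<^sup>\<star>) * z"
    by (simp add: star_diff star_mult star_star sum_distrib_left sum_distrib_right
        sum.distrib[symmetric] sum_subtractf[symmetric] algebra_simps)
  finally have "pos ((\<Sum>i\<in>I. (b i)\<^sup>\<star> * b i) - z\<^sup>\<star> * z - z\<^sup>\<star> * z + z\<^sup>\<star> * (\<Sum>i\<in>I. a i * (a i)\<^sup>\<star>) * z)"
    by (simp flip: zs z_def)
  moreover have "pos (z\<^sup>\<star> * z - z\<^sup>\<star> * (\<Sum>i\<in>I. a i * (a i)\<^sup>\<star>) * z)"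
    using cle_conj[OF assms, of z] by (simp add: cle_def)
  ultimately show ?thesis
    unfolding cle_def z_def[symmetric] using pos_add by fastforce
qed

subsection \<open>Inverses\<close>

definition neumann :: "'a::cstar_algebra_1 \<Rightarrow> 'a" where
  "neumann k = (\<Sum>n. k ^ n)"

lemma
  fixes k :: "'a::cstar_algebra_1"
  assumes k: "norm k < 1"
  shows neumann_left: "neumann k * (1 - k) = 1"
    and neumann_right: "(1 - k) * neumann k = 1"
    and neumann_in: "real_subalgebra S \<Longrightarrow> k \<in> S \<Longrightarrow> neumann k \<in> S"
proof -
  have "summable (\<lambda>n. norm k ^ n)" using k by (simp add: summable_geometric)
  then have s: "summable (\<lambda>n. k ^ n)"
    by (rule summable_comparison_test') (simp add: norm_power_ineq)
  have split: "neumann k = 1 + (\<Sum>n. k ^ Suc n)"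
    unfolding neumann_def using suminf_split_head[OF s] by simp
  have "(\<Sum>n. k ^ Suc n) = k * neumann k"
    unfolding neumann_def using suminf_mult[OF s, of k] by simp
  then show "(1 - k) * neumann k = 1" using split by (simp add: algebra_simps)
  have "(\<Sum>n. k ^ Suc n) = neumann k * k"
    unfolding neumann_def using suminf_mult2[OF s, of k] by (simp add: power_commutes)
  then show "neumann k * (1 - k) = 1" using split by (simp add: algebra_simps)
  show "neumann k \<in> S" if S: "real_subalgebra S" "k \<in> S"
    unfolding neumann_def
    using S real_subalgebra_power[OF S] by (intro suminf_in_closed_subspace s) (auto simp: real_subalgebra_def)
qed

definition cinv :: "'a::cstar_algebra_1 \<Rightarrow> 'a" where
  "cinv a = (1 / norm a) *\<^sub>R neumann (1 - (1 / norm a) *\<^sub>R a)"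

text \<open>For \<open>k = 1 - (1 / norm a) *\<^sub>R a\<close> the lower bound gives
  \<open>norm k \<le> 1 - \<delta> / norm a < 1\<close>, so the Neumann series converges. Positivity
  follows by writing \<open>cinv a\<close> as the conjugate of \<open>a\<close> by itself.\<close>

lemma
  fixes a :: "'a::cstar_algebra_1"
  assumes d: "\<delta> > 0" "\<delta> *\<^sub>R 1 \<preceq> a"
  shows cinv_right: "a * cinv a = 1" and cinv_left: "cinv a * a = 1"
    and cinv_in: "real_subalgebra S \<Longrightarrow> a \<in> S \<Longrightarrow> cinv a \<in> S"
    and pos_cinv: "pos (cinv a)"
proof -
  have p: "pos (\<delta> *\<^sub>R (1::'a))" using d by simp
  have a: "pos a" by (rule pos_cle[OF p d(2)])
  have n: "norm a \<ge> \<delta>" using norm_cle_mono[OF p d(2)] d by simp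
  then have a0: "a \<noteq> 0" using d by auto
  define k where "k = 1 - (1 / norm a) *\<^sub>R a"
  have k0: "pos k"
    using pos_scaleR[OF norm_minus_pos[OF pos_star[OF a]], of "1 / norm a"] a0
    by (simp add: k_def scaleR_diff_right)
  have "pos ((1 / norm a) *\<^sub>R (a - \<delta> *\<^sub>R 1))" using d(2) by (intro pos_scaleR) (auto simp: cle_def)
  then have "k \<preceq> (1 - \<delta> / norm a) *\<^sub>R 1" by (simp add: cle_def k_def algebra_simps)
  then have "norm k \<le> 1 - \<delta> / norm a" by (simp add: norm_cle_iff[OF k0])
  also have "\<dots> < 1" using n d a0 by simp
  finally have k: "norm k < 1" .
  have ak: "a = norm a *\<^sub>R (1 - k)" using a0 by (simp add: k_def)
  have c: "cinv a = (1 / norm a) *\<^sub>R neumann k" by (simp add: cinv_def k_def)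
  show 1: "a * cinv a = 1"
    unfolding c by (subst ak) (use a0 in \<open>simp add: neumann_right[OF k]\<close>)
  show 2: "cinv a * a = 1"
    unfolding c by (subst (2) ak) (use a0 in \<open>simp add: neumann_left[OF k]\<close>)
  show "cinv a \<in> S" if S: "real_subalgebra S" "a \<in> S"
  proof -
    have "k \<in> S" using S by (auto simp: k_def real_subalgebra_def subspace_scale subspace_diff)
    then show ?thesis using neumann_in[OF k S(1)] S by (auto simp: c real_subalgebra_def subspace_scale)
  qed
  have "(cinv a)\<^sup>\<star> * a = 1" using arg_cong[OF 1, of star] by (simp add: star_mult pos_star[OF a])
  then have "(cinv a)\<^sup>\<star> = cinv a" by (metis 1 mult.assoc mult.left_neutral mult.right_neutral)
  then have "cinv a = (cinv a)\<^sup>\<star> * a * cinv a" by (simp add: 1 2 mult.assoc)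
  then show "pos (cinv a)" using pos_conj[OF a, of "cinv a"] by simp
qed

lemma inverse_commute:
  fixes x :: "'a::monoid_mult"
  assumes "x * a = a * x" "a * b = 1" "b * a = 1"
  shows "x * b = b * x"
proof -
  have "b * (x * a) * b = b * (a * x) * b" using assms by simp
  moreover have "b * (x * a) * b = b * x * (a * b)" "b * (a * x) * b = (b * a) * x * b"
    by (simp_all only: mult.assoc)
  ultimately show ?thesis using assms(2,3) by simp
qed

definition isqrt :: "'a::cstar_algebra_1 \<Rightarrow> 'a" where
  "isqrt a = psqrt (cinv a)"

lemma
  fixes a :: "'a::cstar_algebra_1"
  assumes d: "\<delta> > 0" "\<delta> *\<^sub>R 1 \<preceq> a"
  shows pos_isqrt: "pos (isqrt a)"
    and isqrt_square_mult: "isqrt a * isqrt a * a = 1"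
    and isqrt_conj: "isqrt a * a * isqrt a = 1"
    and isqrt_commute: "x * a = a * x \<Longrightarrow> x * isqrt a = isqrt a * x"
    and isqrt_in: "real_subalgebra S \<Longrightarrow> a \<in> S \<Longrightarrow> isqrt a \<in> S"
proof -
  note p = pos_cinv[OF d]
  show "pos (isqrt a)" unfolding isqrt_def by (rule pos_psqrt[OF p])
  show 1: "isqrt a * isqrt a * a = 1"
    unfolding isqrt_def psqrt_square[OF p] by (rule cinv_left[OF d])
  show 2: "x * isqrt a = isqrt a * x" if "x * a = a * x" for x
    unfolding isqrt_def
    by (rule psqrt_commute[OF p inverse_commute[OF that cinv_right[OF d] cinv_left[OF d]]])
  show "isqrt a * a * isqrt a = 1" using 1 2[of a] by (simp add: mult.assoc)
  show "isqrt a \<in> S" if "real_subalgebra S" "a \<in> S"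
    unfolding isqrt_def by (rule psqrt_in[OF p that(1) cinv_in[OF d that]])
qed

text \<open>The square of \<open>g * g - 1\<close> exceeds that of \<open>g - 1\<close> by the
  square of \<open>(g - 1) * g\<close> plus twice \<open>(g - 1) * g * (g - 1)\<close>, both
  positive.\<close>

lemma norm_minus_one_le_square:
  fixes g :: "'a::cstar_algebra_1"
  assumes "pos g"
  shows "norm (g - 1) \<le> norm (g * g - 1)"
proof -
  note gs = pos_star[OF assms]
  have e: "(g * g - 1) * (g * g - 1) - (g - 1) * (g - 1)
      = ((g - 1) * g) * ((g - 1) * g) + 2 *\<^sub>R ((g - 1) * g * (g - 1))"
    by (simp add: algebra_simps scaleR_2)
  have "pos (((g - 1) * g) * ((g - 1) * g))"
    by (rule pos_square) (simp add: star_mult star_diff gs algebra_simps)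
  moreover have "pos ((g - 1) * g * (g - 1))"
    by (rule pos_conj_commuting[OF assms]) (simp_all add: star_diff gs algebra_simps)
  ultimately have "(g - 1) * (g - 1) \<preceq> (g * g - 1) * (g * g - 1)"
    unfolding cle_def e by (intro pos_add pos_scaleR) auto
  then have "norm ((g - 1) * (g - 1)) \<le> norm ((g * g - 1) * (g * g - 1))"
    by (rule norm_cle_mono[rotated]) (rule pos_square, simp add: star_diff gs)
  then have "(norm (g - 1))\<^sup>2 \<le> (norm (g * g - 1))\<^sup>2"
    by (simp add: norm_selfadjoint_square star_diff star_mult gs)
  then show ?thesis by simp
qed

subsection \<open>Conditional expectations\<close>

lemma cstar_subalgebra_scaleR: "cstar_subalgebra S \<Longrightarrow> x \<in> S \<Longrightarrow> r *\<^sub>R x \<in> S"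
  by (simp add: cstar_subalgebra_def scaleR_eq_scaleC)

lemma cstar_subalgebra_subspace: "cstar_subalgebra S \<Longrightarrow> subspace S"
  unfolding subspace_def using cstar_subalgebra_scaleR by (auto simp: cstar_subalgebra_def)

lemma cstar_subalgebra_real_subalgebra: "cstar_subalgebra S \<Longrightarrow> 1 \<in> S \<Longrightarrow> real_subalgebra S"
  using cstar_subalgebra_subspace by (auto simp: cstar_subalgebra_def real_subalgebra_def)

lemma cstar_subalgebra_UNIV: "cstar_subalgebra UNIV"
  by (simp add: cstar_subalgebra_def)

text \<open>It serves for both expectations. In \<open>close_pair\<close> the facts without prefix
  concern \<open>F : A \<rightarrow> C\<close>, and those with prefix \<open>B\<close> concern
  \<open>E\<close> from the whole algebra onto \<open>B\<close>.\<close>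

locale cond_exp =
  fixes A C :: "'a::cstar_algebra_1 set" and E :: "'a \<Rightarrow> 'a"
  assumes subalg_A: "cstar_subalgebra A" and subalg_C: "cstar_subalgebra C" and one_C: "1 \<in> C"
    and ce: "conditional_expectation A C E"
begin

lemma C_subset: "c \<in> C \<Longrightarrow> c \<in> A"
  using ce by (auto simp: conditional_expectation_def)

lemma one_A: "1 \<in> A"
  using C_subset one_C by blast

lemma subspace_A: "subspace A" and subspace_C: "subspace C"
  by (rule cstar_subalgebra_subspace, rule subalg_A, rule cstar_subalgebra_subspace, rule subalg_C)

lemma A_mult: "x \<in> A \<Longrightarrow> y \<in> A \<Longrightarrow> x * y \<in> A" and A_star: "x \<in> A \<Longrightarrow> x\<^sup>\<star> \<in> A"
  using subalg_A by (auto simp: cstar_subalgebra_def)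

lemmas A_add = subspace_add[OF subspace_A] and A_diff = subspace_diff[OF subspace_A]
  and A_scale = subspace_scale[OF subspace_A] and A_sum = subspace_sum[OF subspace_A]

lemma C_mult: "x \<in> C \<Longrightarrow> y \<in> C \<Longrightarrow> x * y \<in> C" and C_star: "x \<in> C \<Longrightarrow> x\<^sup>\<star> \<in> C"
  using subalg_C by (auto simp: cstar_subalgebra_def)

lemma E_in: "x \<in> A \<Longrightarrow> E x \<in> C"
  and E_add: "x \<in> A \<Longrightarrow> y \<in> A \<Longrightarrow> E (x + y) = E x + E y"
  and E_scaleC: "x \<in> A \<Longrightarrow> E (z *\<^sub>C x) = z *\<^sub>C E x"
  and E_id: "c \<in> C \<Longrightarrow> E c = c"
  and E_norm: "x \<in> A \<Longrightarrow> norm (E x) \<le> norm x"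
  and E_bimod: "c \<in> C \<Longrightarrow> x \<in> A \<Longrightarrow> d \<in> C \<Longrightarrow> E (c * x * d) = c * E x * d"
  and E_positive: "x \<in> positive_elements A \<Longrightarrow> E x \<in> positive_elements C"
  using ce by (auto simp: conditional_expectation_def)

lemma E_one: "E 1 = 1"
  by (rule E_id[OF one_C])

lemma E_left: "c \<in> C \<Longrightarrow> x \<in> A \<Longrightarrow> E (c * x) = c * E x"
  using E_bimod[of c x 1] one_C by simp

lemma E_right: "x \<in> A \<Longrightarrow> c \<in> C \<Longrightarrow> E (x * c) = E x * c"
  using E_bimod[of 1 x c] one_C by simp

lemma E_scaleR: "x \<in> A \<Longrightarrow> E (r *\<^sub>R x) = r *\<^sub>R E x"
  by (simp add: scaleR_eq_scaleC E_scaleC)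

lemma E_zero: "E 0 = 0"
  using E_id[of 0] subalg_C by (simp add: cstar_subalgebra_def)

lemma E_diff: "x \<in> A \<Longrightarrow> y \<in> A \<Longrightarrow> E (x - y) = E x - E y"
  using E_add[of "x - y" y] A_diff[of x y] by (simp add: algebra_simps)

lemma E_sum: "(\<And>i. i \<in> I \<Longrightarrow> f i \<in> A) \<Longrightarrow> E (\<Sum>i\<in>I. f i) = (\<Sum>i\<in>I. E (f i))"
  by (induction I rule: infinite_finite_induct) (auto simp: E_zero E_add A_sum)

lemma E_E: "x \<in> A \<Longrightarrow> E (E x) = E x"
  by (simp add: E_id E_in)

lemma E_pos:
  assumes "x \<in> A" "pos x"
  shows "pos (E x)"
proof -
  have "psqrt x \<in> A"
    by (rule psqrt_in[OF assms(2) cstar_subalgebra_real_subalgebra[OF subalg_A one_A] assms(1)])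
  moreover have "x = (psqrt x)\<^sup>\<star> * psqrt x"
    by (simp add: pos_star[OF pos_psqrt[OF assms(2)]] psqrt_square[OF assms(2)])
  ultimately have "x \<in> positive_elements A" unfolding positive_elements_def by blast
  from E_positive[OF this] obtain y where "E x = y\<^sup>\<star> * y" unfolding positive_elements_def by blast
  then show ?thesis by (simp add: pos_star_mult_self)
qed

lemma E_mono: "x \<in> A \<Longrightarrow> y \<in> A \<Longrightarrow> x \<preceq> y \<Longrightarrow> E x \<preceq> E y"
  using E_pos[of "y - x"] by (simp add: cle_def A_diff E_diff)

text \<open>For self-adjoint \<open>h\<close> the element \<open>norm h *\<^sub>R 1 - h\<close> is
  positive, so its image is self-adjoint. The general case follows by splitting \<open>x\<close>
  into real and imaginary parts.\<close>

lemma E_star: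
  assumes x: "x \<in> A"
  shows "E (x\<^sup>\<star>) = (E x)\<^sup>\<star>"
proof -
  have sa: "(E h)\<^sup>\<star> = E h" if h: "h \<in> A" "h\<^sup>\<star> = h" for h
  proof -
    have "pos (E (norm h *\<^sub>R 1 - h))"
      by (intro E_pos norm_minus_pos h A_diff A_scale one_A)
    then have "(E (norm h *\<^sub>R 1 - h))\<^sup>\<star> = E (norm h *\<^sub>R 1 - h)" by (rule pos_star)
    then show ?thesis by (simp add: E_diff E_scaleR h one_A A_scale E_one star_diff star_scaleR)
  qed
  define P Q where "P = x + x\<^sup>\<star>" and "Q = \<i> *\<^sub>C (x - x\<^sup>\<star>)"
  have D: "x - x\<^sup>\<star> \<in> A" by (intro A_diff A_star x)
  have PQ: "P \<in> A" "Q \<in> A" "P\<^sup>\<star> = P" "Q\<^sup>\<star> = Q"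
    using subalg_A D
    by (auto simp: P_def Q_def cstar_subalgebra_def x A_add A_star star_add star_star star_scaleC
        star_diff scaleC_minus_left add.commute simp flip: scaleC_minus_right)
  have i2: "(- \<i>) *\<^sub>C (\<i> *\<^sub>C y) = y" for y :: 'a by (simp add: scaleC_scaleC scaleC_one)
  have sumd: "E x + E (x\<^sup>\<star>) = E P" by (simp add: P_def E_add x A_star)
  have "E x - E (x\<^sup>\<star>) = (- \<i>) *\<^sub>C E Q"
    unfolding Q_def E_scaleC[OF D] i2 by (simp add: E_diff x A_star)
  moreover have "((- \<i>) *\<^sub>C E Q)\<^sup>\<star> = - ((- \<i>) *\<^sub>C E Q)"
    by (simp add: star_scaleC sa PQ scaleC_minus_left)
  ultimately have d: "(E x)\<^sup>\<star> - (E (x\<^sup>\<star>))\<^sup>\<star> = - (E x - E (x\<^sup>\<star>))"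
    by (simp flip: star_diff)
  have s: "(E x)\<^sup>\<star> + (E (x\<^sup>\<star>))\<^sup>\<star> = E x + E (x\<^sup>\<star>)"
    using sa[OF PQ(1,3)] by (simp add: sumd flip: star_add)
  have "2 *\<^sub>R (E x)\<^sup>\<star> = ((E x)\<^sup>\<star> + (E (x\<^sup>\<star>))\<^sup>\<star>) + ((E x)\<^sup>\<star> - (E (x\<^sup>\<star>))\<^sup>\<star>)"
    by (simp add: scaleR_2)
  also have "\<dots> = 2 *\<^sub>R E (x\<^sup>\<star>)" unfolding s d by (simp add: scaleR_2)
  finally show ?thesis by simp
qed

text \<open>Apply \<open>E\<close> to the square of \<open>x - E x\<close> and use the bimodule
  property.\<close>

lemma E_schwarz:
  assumes x: "x \<in> A"
  shows "(E x)\<^sup>\<star> * E x \<preceq> E (x\<^sup>\<star> * x)"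
proof -
  define y where "y = x - E x"
  have Ex: "E x \<in> A" "E x \<in> C" "(E x)\<^sup>\<star> \<in> C" "(E x)\<^sup>\<star> \<in> A"
    using x by (auto intro: E_in C_subset C_star)
  have "pos (E (y\<^sup>\<star> * y))" using x Ex by (intro E_pos pos_star_mult_self) (auto simp: y_def A_mult A_star A_diff)
  moreover have "y\<^sup>\<star> * y = x\<^sup>\<star> * x - x\<^sup>\<star> * E x - (E x)\<^sup>\<star> * x + (E x)\<^sup>\<star> * E x"
    by (simp add: y_def star_diff algebra_simps)
  moreover have "E (x\<^sup>\<star> * x - x\<^sup>\<star> * E x - (E x)\<^sup>\<star> * x + (E x)\<^sup>\<star> * E x) = E (x\<^sup>\<star> * x) - (E x)\<^sup>\<star> * E x"
    using x Ex by (simp add: E_add E_diff A_diff A_mult A_star E_left E_right E_star E_E C_mult)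
  ultimately show ?thesis by (simp add: cle_def)
qed

end

subsection \<open>Quasi-bases\<close>

locale quasi_basis_exp = cond_exp A C E for A C :: "'a::cstar_algebra_1 set" and E +
  fixes n :: nat and v :: "nat \<Rightarrow> 'a"
  assumes qb: "quasi_basis A E n v"
begin

lemma v_in: "i \<in> {1..n} \<Longrightarrow> v i \<in> A"
  using qb by (auto simp: quasi_basis_def)

lemma expansion: "x \<in> A \<Longrightarrow> x = (\<Sum>i=1..n. v i * E ((v i)\<^sup>\<star> * x))"
  using qb by (auto simp: quasi_basis_def)

lemma expansion_left:
  assumes "x \<in> A"
  shows "x = (\<Sum>i=1..n. E (x * v i) * (v i)\<^sup>\<star>)"
proof -
  have "x = (\<Sum>i=1..n. v i * E ((v i)\<^sup>\<star> * x\<^sup>\<star>))\<^sup>\<star>"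
    using expansion[OF A_star[OF assms]] by (metis star_star)
  also have "\<dots> = (\<Sum>i=1..n. E (x * v i) * (v i)\<^sup>\<star>)"
    by (auto simp: star_sum star_mult star_star A_mult A_star assms v_in simp flip: E_star intro!: sum.cong)
  finally show ?thesis .
qed

text \<open>The Watatani index of \<open>E\<close>.\<close>

definition Ind :: 'a where
  "Ind = (\<Sum>i=1..n. v i * (v i)\<^sup>\<star>)"

lemma Ind_in: "Ind \<in> A"
  unfolding Ind_def by (intro A_sum A_mult A_star v_in)

text \<open>Expand each \<open>x * v i\<close> in the quasi-basis, swap the sums, and recombine
  \<open>(v j)\<^sup>\<star> * x\<close> by the adjoint expansion.\<close>

lemma Ind_central:
  assumes x: "x \<in> A"
  shows "x * Ind = Ind * x"
proof -
  have "x * Ind = (\<Sum>i=1..n. (x * v i) * (v i)\<^sup>\<star>)"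
    by (simp add: Ind_def sum_distrib_left mult.assoc)
  also have "\<dots> = (\<Sum>i=1..n. (\<Sum>j=1..n. v j * E ((v j)\<^sup>\<star> * (x * v i))) * (v i)\<^sup>\<star>)"
    by (intro sum.cong refl arg_cong2[where f = "(*)"] expansion A_mult x v_in)
  also have "\<dots> = (\<Sum>i=1..n. \<Sum>j=1..n. v j * E ((v j)\<^sup>\<star> * x * v i) * (v i)\<^sup>\<star>)"
    by (simp add: sum_distrib_right mult.assoc)
  also have "\<dots> = (\<Sum>j=1..n. \<Sum>i=1..n. v j * E ((v j)\<^sup>\<star> * x * v i) * (v i)\<^sup>\<star>)"
    by (rule sum.swap)
  also have "\<dots> = (\<Sum>j=1..n. v j * (\<Sum>i=1..n. E (((v j)\<^sup>\<star> * x) * v i) * (v i)\<^sup>\<star>))"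
    by (simp add: sum_distrib_left mult.assoc)
  also have "\<dots> = (\<Sum>j=1..n. v j * ((v j)\<^sup>\<star> * x))"
    by (intro sum.cong refl arg_cong2[where f = "(*)"] expansion_left[symmetric] A_mult A_star x v_in)
  also have "\<dots> = Ind * x" by (simp add: Ind_def sum_distrib_right mult.assoc)
  finally show ?thesis .
qed

text \<open>The positive sum of the squares of \<open>v i - t *\<^sub>R E (v i)\<close> equals
  \<open>Ind - (2 * t) *\<^sub>R 1 + (t * t) *\<^sub>R L\<close>, because the expansions of 1
  evaluate the cross terms.\<close>

lemma Ind_bounded_below:
  obtains \<delta> where "\<delta> > 0" "\<delta> *\<^sub>R 1 \<preceq> Ind"
proof -
  define L where "L = (\<Sum>i=1..n. E (v i) * (E (v i))\<^sup>\<star>)"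
  define l where "l = norm L + 1"
  have "l > 0" by (simp add: l_def add_nonneg_pos)
  \<comment> \<open>This value maximises \<open>2 * t - t * t * l\<close>, and the maximum is
    \<open>t\<close> itself.\<close>
  define t where "t = 1 / l"
  have t: "t > 0" using \<open>l > 0\<close> by (simp add: t_def)
  have L: "pos L" unfolding L_def by (intro pos_sum pos_self_mult_star)
  have "L \<preceq> l *\<^sub>R 1" using norm_cle_iff[OF L, of l] by (simp add: l_def)
  have 1: "(\<Sum>i=1..n. v i * (E (v i))\<^sup>\<star>) = 1"
    using expansion[OF one_A] by (simp add: E_star v_in)
  have 2: "(\<Sum>i=1..n. E (v i) * (v i)\<^sup>\<star>) = 1"
    using expansion_left[OF one_A] by simp
  have "pos (\<Sum>i=1..n. (v i - t *\<^sub>R E (v i)) * (v i - t *\<^sub>R E (v i))\<^sup>\<star>)"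
    by (intro pos_sum pos_self_mult_star)
  also have "(\<Sum>i=1..n. (v i - t *\<^sub>R E (v i)) * (v i - t *\<^sub>R E (v i))\<^sup>\<star>)
      = Ind - t *\<^sub>R (\<Sum>i=1..n. v i * (E (v i))\<^sup>\<star>) - t *\<^sub>R (\<Sum>i=1..n. E (v i) * (v i)\<^sup>\<star>) + (t * t) *\<^sub>R L"
    by (simp add: Ind_def L_def star_diff star_scaleR scaleR_sum_right sum.distrib[symmetric]
        sum_subtractf[symmetric] algebra_simps)
  finally have "pos (Ind - (2 * t) *\<^sub>R 1 + (t * t) *\<^sub>R L)"
    unfolding 1 2 by (simp add: algebra_simps flip: scaleR_2)
  moreover have "pos ((t * t) *\<^sub>R (l *\<^sub>R 1 - L))"
    using \<open>L \<preceq> l *\<^sub>R 1\<close> by (intro pos_scaleR) (auto simp: cle_def)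
  ultimately have "pos ((Ind - (2 * t) *\<^sub>R 1 + (t * t) *\<^sub>R L) + (t * t) *\<^sub>R (l *\<^sub>R 1 - L))"
    by (rule pos_add)
  moreover have "(Ind - (2 * t) *\<^sub>R 1 + (t * t) *\<^sub>R L) + (t * t) *\<^sub>R (l *\<^sub>R 1 - L)
      = Ind - (2 * t - t * t * l) *\<^sub>R 1"
    by (simp add: scaleR_diff_right scaleR_diff_left)
  moreover have "2 * t - t * t * l = t" using \<open>l > 0\<close> by (simp add: t_def)
  ultimately have "t *\<^sub>R 1 \<preceq> Ind" by (simp add: cle_def)
  with t show ?thesis by (rule that)
qed

definition w :: "nat \<Rightarrow> 'a" where
  "w i = isqrt Ind * v i"

lemma
  shows w_in: "i \<in> {1..n} \<Longrightarrow> w i \<in> A"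
    and isqrt_Ind_central: "x \<in> A \<Longrightarrow> x * isqrt Ind = isqrt Ind * x"
    and isqrt_Ind_star: "(isqrt Ind)\<^sup>\<star> = isqrt Ind"
    and sum_w: "(\<Sum>i=1..n. w i * (w i)\<^sup>\<star>) = 1"
proof -
  obtain \<delta> where d: "\<delta> > 0" "\<delta> *\<^sub>R 1 \<preceq> Ind" by (rule Ind_bounded_below)
  have g: "isqrt Ind \<in> A"
    by (rule isqrt_in[OF d cstar_subalgebra_real_subalgebra[OF subalg_A one_A] Ind_in])
  show "i \<in> {1..n} \<Longrightarrow> w i \<in> A" unfolding w_def by (intro A_mult g v_in)
  show "x \<in> A \<Longrightarrow> x * isqrt Ind = isqrt Ind * x" by (intro isqrt_commute[OF d] Ind_central)
  show gs: "(isqrt Ind)\<^sup>\<star> = isqrt Ind" by (rule pos_star[OF pos_isqrt[OF d]])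
  have "w i * (w i)\<^sup>\<star> = isqrt Ind * (v i * (v i)\<^sup>\<star>) * isqrt Ind" for i
    by (simp add: w_def star_mult gs mult.assoc)
  then have "(\<Sum>i=1..n. w i * (w i)\<^sup>\<star>) = isqrt Ind * (\<Sum>i=1..n. v i * (v i)\<^sup>\<star>) * isqrt Ind"
    by (simp add: sum_distrib_left sum_distrib_right)
  then show "(\<Sum>i=1..n. w i * (w i)\<^sup>\<star>) = 1" by (simp only: Ind_def[symmetric] isqrt_conj[OF d])
qed

end

section \<open>List sums in the order, and a scaled row and column inequality\<close>

lemma cle_sum_list_mono: "(\<And>x. x \<in> set xs \<Longrightarrow> f x \<preceq> g x) \<Longrightarrow> (\<Sum>x\<leftarrow>xs. f x) \<preceq> (\<Sum>x\<leftarrow>xs. g x)"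
  by (induction xs) (auto intro: cle_add_mono)

lemma pos_sum_list: "(\<And>x. x \<in> set xs \<Longrightarrow> pos (f x)) \<Longrightarrow> pos (\<Sum>x\<leftarrow>xs. f x)"
  by (induction xs) (auto intro: pos_add)

lemma scaleR_sum_list: "r *\<^sub>R (\<Sum>x\<leftarrow>xs. f x) = (\<Sum>x\<leftarrow>xs. r *\<^sub>R (f x :: 'a::real_vector))"
  by (induction xs) (auto simp: scaleR_add_right)

lemma sum_list_const_scaleR: "(\<Sum>x\<leftarrow>xs. c) = real (length xs) *\<^sub>R (c :: 'a::real_vector)"
  by (induction xs) (auto simp: scaleR_add_left)

lemma cle_row_column_bound:
  fixes a b :: "'i \<Rightarrow> 'a::cstar_algebra_1"
  assumes "(\<Sum>i\<in>I. a i * (a i)\<^sup>\<star>) \<preceq> R *\<^sub>R 1" "R > 0"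
  shows "(\<Sum>i\<in>I. a i * b i)\<^sup>\<star> * (\<Sum>i\<in>I. a i * b i) \<preceq> R *\<^sub>R (\<Sum>i\<in>I. (b i)\<^sup>\<star> * b i)"
proof -
  define a' where "a' i = (1 / sqrt R) *\<^sub>R a i" for i
  have "(\<Sum>i\<in>I. a' i * (a' i)\<^sup>\<star>) = (1 / R) *\<^sub>R (\<Sum>i\<in>I. a i * (a i)\<^sup>\<star>)"
    using assms(2) by (simp add: a'_def star_scaleR scaleR_sum_right)
  also have "\<dots> \<preceq> (1 / R) *\<^sub>R R *\<^sub>R 1" by (rule cle_scaleR_mono) (use assms in auto)
  finally have "(\<Sum>i\<in>I. a' i * (a' i)\<^sup>\<star>) \<preceq> 1" using assms(2) by simp
  from cle_scaleR_mono[OF cle_row_column[OF this, of b], of R]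
  have "R *\<^sub>R ((\<Sum>i\<in>I. a' i * b i)\<^sup>\<star> * (\<Sum>i\<in>I. a' i * b i)) \<preceq> R *\<^sub>R (\<Sum>i\<in>I. (b i)\<^sup>\<star> * b i)"
    using assms(2) by simp
  moreover have "(\<Sum>i\<in>I. a' i * b i) = (1 / sqrt R) *\<^sub>R (\<Sum>i\<in>I. a i * b i)"
    by (simp add: a'_def scaleR_sum_right)
  ultimately show ?thesis using assms(2) by (simp add: star_scaleR)
qed

subsection \<open>Random signs\<close>

text \<open>Every choice of signs contributes one entry, repetitions included, so dividing a list
  sum by the length gives the expectation over independent random signs.\<close>

fun signed_sums :: "'a::ab_group_add list \<Rightarrow> 'a list" where
  "signed_sums [] = [0]"
| "signed_sums (h # hs) = map (\<lambda>x. x + h) (signed_sums hs) @ map (\<lambda>x. x - h) (signed_sums hs)"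

lemma length_signed_sums: "length (signed_sums hs) = 2 ^ length hs"
  by (induction hs) auto

lemma signed_sums_closed:
  assumes "\<And>x y. P x \<Longrightarrow> P y \<Longrightarrow> P (x + y)" "\<And>x y. P x \<Longrightarrow> P y \<Longrightarrow> P (x - y)" "P 0"
  shows "(\<And>h. h \<in> set hs \<Longrightarrow> P h) \<Longrightarrow> x \<in> set (signed_sums hs) \<Longrightarrow> P x"
  using assms by (induction hs arbitrary: x) auto

text \<open>The cross terms cancel between \<open>x + h\<close> and \<open>x - h\<close>. The middle
  factor \<open>k\<close> is needed for the fourth moment.\<close>

lemma signed_sums_second_moment:
  fixes k :: "'a::real_algebra_1"
  shows "(\<Sum>x\<leftarrow>signed_sums hs. x * k * x) = 2 ^ length hs *\<^sub>R (\<Sum>h\<leftarrow>hs. h * k * h)"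
proof (induction hs)
  case (Cons h hs)
  let ?X = "signed_sums hs"
  have "(\<Sum>x\<leftarrow>signed_sums (h # hs). x * k * x) = (\<Sum>x\<leftarrow>?X. (x + h) * k * (x + h) + (x - h) * k * (x - h))"
    by (simp add: comp_def sum_list_addf)
  also have "\<dots> = (\<Sum>x\<leftarrow>?X. 2 *\<^sub>R (x * k * x) + 2 *\<^sub>R (h * k * h))"
    by (rule arg_cong[where f = sum_list], rule map_cong) (simp_all add: algebra_simps scaleR_2)
  also have "\<dots> = 2 *\<^sub>R (\<Sum>x\<leftarrow>?X. x * k * x) + (2 * 2 ^ length hs) *\<^sub>R (h * k * h)"
    by (simp add: sum_list_addf scaleR_sum_list sum_list_const_scaleR length_signed_sums mult.commute)
  finally show ?case by (simp add: Cons scaleR_add_right)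
qed simp

text \<open>Noncommutative form of the fourth moment bound for random signs. Adding the cases
  \<open>x + h\<close> and \<open>x - h\<close> leaves the squares of \<open>x * x + h * h\<close>
  and of \<open>x * h + h * x\<close>; the second is split by \<open>cle_square_add\<close>, and all
  remaining averages are second moments.\<close>

lemma signed_sums_fourth_moment:
  fixes hs :: "'a::cstar_algebra_1 list"
  assumes "\<And>h. h \<in> set hs \<Longrightarrow> h\<^sup>\<star> = h"
  defines "S \<equiv> (\<Sum>h\<leftarrow>hs. h * h)"
  shows "(\<Sum>x\<leftarrow>signed_sums hs. x * x * (x * x)) \<preceq> 2 ^ length hs *\<^sub>R (S * S + 2 *\<^sub>R (\<Sum>h\<leftarrow>hs. h * S * h))"
  using assms(1) unfolding S_def
proof (induction hs)
  case (Cons h hs)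
  define X where "X = signed_sums hs"
  define N :: real where "N = 2 ^ length hs"
  define S where "S = (\<Sum>h\<leftarrow>hs. h * h)"
  define W where "W = (\<Sum>h\<leftarrow>hs. h * S * h)"
  define V where "V = (\<Sum>y\<leftarrow>hs. y * (h * h) * y)"
  have N: "N \<ge> 0" by (simp add: N_def)
  have hh: "h\<^sup>\<star> = h" using Cons.prems by simp
  have Xs: "x\<^sup>\<star> = x" if "x \<in> set X" for x
    using signed_sums_closed[where P = "\<lambda>x. x\<^sup>\<star> = x" and hs = hs and x = x] that Cons.prems
    by (auto simp: X_def star_add star_diff)
  have IH: "(\<Sum>x\<leftarrow>X. x * x * (x * x)) \<preceq> N *\<^sub>R (S * S + 2 *\<^sub>R W)"
    using Cons unfolding X_def N_def S_def W_def by simp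
  have m2: "(\<Sum>x\<leftarrow>X. x * k * x) = N *\<^sub>R (\<Sum>y\<leftarrow>hs. y * k * y)" for k
    unfolding X_def N_def by (rule signed_sums_second_moment)
  have m1: "(\<Sum>x\<leftarrow>X. x * x) = N *\<^sub>R S" using m2[of 1] by (simp add: S_def)
  have lX: "real (length X) = N" by (simp add: X_def N_def length_signed_sums)
  have "(\<Sum>x\<leftarrow>signed_sums (h # hs). x * x * (x * x))
      = (\<Sum>x\<leftarrow>X. (x + h) * (x + h) * ((x + h) * (x + h)) + (x - h) * (x - h) * ((x - h) * (x - h)))"
    by (simp add: comp_def sum_list_addf X_def)
  also have "\<dots> = (\<Sum>x\<leftarrow>X. 2 *\<^sub>R ((x * x + h * h) * (x * x + h * h)) + 2 *\<^sub>R ((x * h + h * x) * (x * h + h * x)))"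
    by (rule arg_cong[where f = sum_list], rule map_cong) (simp_all add: algebra_simps scaleR_2)
  also have "\<dots> \<preceq> (\<Sum>x\<leftarrow>X. 2 *\<^sub>R ((x * x + h * h) * (x * x + h * h))
      + 2 *\<^sub>R 2 *\<^sub>R (h * (x * x) * h + x * (h * h) * x))"
  proof (intro cle_sum_list_mono cle_add_mono cle_refl cle_scaleR_mono)
    fix x assume "x \<in> set X"
    then show "(x * h + h * x) * (x * h + h * x) \<preceq> 2 *\<^sub>R (h * (x * x) * h + x * (h * h) * x)"
      using cle_square_add[of "x * h" "h * x"] by (simp add: star_add star_mult hh Xs mult.assoc add.commute)
  qed simp
  also have "\<dots> = 2 *\<^sub>R (\<Sum>x\<leftarrow>X. x * x * (x * x)) + 2 *\<^sub>R ((\<Sum>x\<leftarrow>X. x * x) * (h * h))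
      + 2 *\<^sub>R (h * h * (\<Sum>x\<leftarrow>X. x * x)) + 2 *\<^sub>R (\<Sum>x\<leftarrow>X. h * h * (h * h))
      + 4 *\<^sub>R (h * (\<Sum>x\<leftarrow>X. x * x) * h) + 4 *\<^sub>R (\<Sum>x\<leftarrow>X. x * (h * h) * x)"
    by (simp add: scaleR_sum_list sum_list_addf[symmetric] sum_list_const_mult[symmetric]
        sum_list_mult_const[symmetric] algebra_simps)
  also have "\<dots> = 2 *\<^sub>R (\<Sum>x\<leftarrow>X. x * x * (x * x)) + (2 * N) *\<^sub>R (S * (h * h) + h * h * S + h * h * (h * h)
      + 2 *\<^sub>R (h * S * h) + 2 *\<^sub>R V)"
    unfolding m1 m2 V_def[symmetric] sum_list_const_scaleR lX by (simp add: algebra_simps)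
  \<comment> \<open>Besides using the induction hypothesis, this adds the positive term
    \<open>2 *\<^sub>R (h * (h * h) * h)\<close>, which completes the middle factor \<open>S\<close>
    to \<open>h * h + S\<close>.\<close>
  also have "\<dots> \<preceq> 2 *\<^sub>R (N *\<^sub>R (S * S + 2 *\<^sub>R W)) + (2 * N) *\<^sub>R (S * (h * h) + h * h * S + h * h * (h * h)
      + 2 *\<^sub>R (h * S * h) + 2 *\<^sub>R V + 2 *\<^sub>R (h * (h * h) * h))"
  proof (rule cle_add_mono[OF cle_scaleR_mono[OF IH] cle_scaleR_mono])
    have "pos (2 *\<^sub>R ((h * h)\<^sup>\<star> * (h * h)))" by (intro pos_scaleR pos_star_mult_self) auto
    then show "S * (h * h) + h * h * S + h * h * (h * h) + 2 *\<^sub>R (h * S * h) + 2 *\<^sub>R V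
      \<preceq> S * (h * h) + h * h * S + h * h * (h * h) + 2 *\<^sub>R (h * S * h) + 2 *\<^sub>R V + 2 *\<^sub>R (h * (h * h) * h)"
      by (simp add: cle_def star_mult hh mult.assoc)
  qed (use N in auto)
  also have "\<dots> = (2 * N) *\<^sub>R ((h * h + S) * (h * h + S) + 2 *\<^sub>R (h * (h * h + S) * h + (W + V)))"
    by (simp add: algebra_simps)
  also have "W + V = (\<Sum>y\<leftarrow>hs. y * (h * h + S) * y)"
    by (simp add: W_def V_def sum_list_addf[symmetric] algebra_simps)
  finally show ?case by (simp add: N_def S_def)
qed simp

text \<open>The truncation is \<open>b = X (1 + X\<^sup>2/3)\<^sup>-\<^sup>1\<close>.\<close>

lemma truncation:
  fixes X :: "'a::cstar_algebra_1"
  assumes X: "X\<^sup>\<star> = X" and S: "real_subalgebra S" "X \<in> S"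
  obtains b k where "b \<in> S" "k \<in> S" "X = b + k" "b\<^sup>\<star> = b" "k\<^sup>\<star> = k"
    "b * b \<preceq> (3/4) *\<^sub>R 1" "12 *\<^sub>R (k * k) \<preceq> X * X * (X * X)"
proof -
  define D where "D = 1 + (1/3) *\<^sub>R (X * X)"
  have D: "1 *\<^sub>R 1 \<preceq> D" by (simp add: cle_def D_def pos_scaleR pos_square[OF X])
  define c where "c = cinv D"
  have Dc: "D * c = 1" and cD: "c * D = 1" and cp: "pos c"
    unfolding c_def using cinv_right[OF _ D] cinv_left[OF _ D] pos_cinv[OF _ D] by auto
  have cs: "c\<^sup>\<star> = c" by (rule pos_star[OF cp])
  have XD: "X * D = D * X" by (simp add: D_def algebra_simps)
  have Xc: "X * c = c * X" by (rule inverse_commute[OF XD Dc cD])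
  have "D \<in> S" using S by (auto simp: D_def real_subalgebra_def subspace_add subspace_scale)
  then have cS: "c \<in> S" unfolding c_def using cinv_in[OF _ D S(1)] by simp
  define b where "b = X * c"
  define k where "k = X - b"
  have bS: "b \<in> S" using S cS by (auto simp: b_def real_subalgebra_def)
  have bs: "b\<^sup>\<star> = b" by (simp add: b_def star_mult cs X Xc)
  have split: "y = c * (D * y * D) * c" for y
  proof -
    have "c * (D * y * D) * c = (c * D) * y * (D * c)" by (simp only: mult.assoc)
    then show ?thesis by (simp add: cD Dc)
  qed
  have bb: "b * b = c * (X * X) * c" using Xc by (simp add: b_def mult.assoc)
  define z where "z = (1 - (1/3) *\<^sub>R (X * X)) * c"
  have zs: "z\<^sup>\<star> = c * (1 - (1/3) *\<^sub>R (X * X))"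
    by (simp add: z_def star_mult star_diff star_scaleR cs X)
  \<comment> \<open>The scalar function s / (1 + s^2/3) has largest square 3/4, attained at s^2 = 3.
    Accordingly the difference is a positive multiple of a square.\<close>
  have "(3/4) *\<^sub>R 1 - b * b = c * ((3/4) *\<^sub>R (D * D) - X * X) * c"
    using split[of "(3/4) *\<^sub>R 1"] by (simp add: bb algebra_simps)
  also have "(3/4) *\<^sub>R (D * D) - X * X
      = (3/4) *\<^sub>R ((1 - (1/3) *\<^sub>R (X * X)) * (1 - (1/3) *\<^sub>R (X * X)))"
    by (simp add: D_def algebra_simps) (simp add: algebra_simps flip: scaleR_add_left)
  also have "c * ((3/4) *\<^sub>R ((1 - (1/3) *\<^sub>R (X * X)) * (1 - (1/3) *\<^sub>R (X * X)))) * c = (3/4) *\<^sub>R (z\<^sup>\<star> * z)"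
    unfolding zs by (simp add: z_def mult.assoc)
  finally have b1: "b * b \<preceq> (3/4) *\<^sub>R 1"
    by (simp add: cle_def pos_scaleR pos_star_mult_self)
  have "X = X * (D * c)" by (simp add: Dc)
  then have kc: "k = (1/3) *\<^sub>R (X * X * X * c)"
    by (simp add: k_def b_def D_def algebra_simps)
  have kc': "k = (1/3) *\<^sub>R (c * (X * X * X))"
    unfolding kc by (metis Xc mult.assoc)
  have DX: "D * (X * X * (X * X)) * D = X * X * (D * D) * (X * X)"
    by (simp add: D_def algebra_simps)
  \<comment> \<open>Here 12 is the largest usable constant: s^4 - 12 (s^3 / (3 + s^2))^2 is again a
    square, with a zero at s^2 = 3.\<close>
  have "X * X * (X * X) - 12 *\<^sub>R (k * k) = c * (X * X * (D * D) * (X * X)) * c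
      - 12 *\<^sub>R (((1/3) *\<^sub>R (c * (X * X * X))) * ((1/3) *\<^sub>R (X * X * X * c)))"
    using split[of "X * X * (X * X)"] kc kc' DX by simp
  also have "\<dots> = c * (X * X * (D * D - (4/3) *\<^sub>R (X * X)) * (X * X)) * c"
    by (simp add: algebra_simps)
  also have "D * D - (4/3) *\<^sub>R (X * X) = (1 - (1/3) *\<^sub>R (X * X)) * (1 - (1/3) *\<^sub>R (X * X))"
    by (simp add: D_def algebra_simps) (simp add: algebra_simps flip: scaleR_add_left,
      use scaleR_add_left[of 1 "1/3" "X * X"] in simp)
  also have "c * (X * X * ((1 - (1/3) *\<^sub>R (X * X)) * (1 - (1/3) *\<^sub>R (X * X))) * (X * X)) * c
      = ((1 - (1/3) *\<^sub>R (X * X)) * (X * X) * c)\<^sup>\<star> * ((1 - (1/3) *\<^sub>R (X * X)) * (X * X) * c)"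
    by (simp add: star_mult star_diff star_scaleR cs X mult.assoc)
  finally have k1: "12 *\<^sub>R (k * k) \<preceq> X * X * (X * X)"
    unfolding cle_def using pos_star_mult_self by metis
  have "k \<in> S" using S bS by (auto simp: k_def real_subalgebra_def subspace_diff)
  moreover have "k\<^sup>\<star> = k" by (simp add: k_def star_diff X bs)
  moreover have "X = b + k" by (simp add: k_def)
  ultimately show thesis using bS bs b1 k1 by (intro that[of b k])
qed

subsection \<open>A little Grothendieck inequality\<close>

text \<open>In the intended application \<open>\<tau> = 2\<gamma>\<close>.\<close>

locale close_pair = quasi_basis_exp A C F n v + B: cond_exp UNIV B E
  for A C :: "'a::cstar_algebra_1 set" and F n v B E +
  fixes \<tau> :: real
  assumes C_sub_B: "C \<subseteq> B" and tau: "\<tau> \<ge> 0"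
    and close: "x \<in> A \<Longrightarrow> norm (x - E x) \<le> \<tau> * norm x"
begin

definition T :: "'a \<Rightarrow> 'a" where
  "T x = x - E x"

lemma T_add: "T (x + y) = T x + T y"
  and T_diff: "T (x - y) = T x - T y"
  and T_scaleR: "T (r *\<^sub>R x) = r *\<^sub>R T x"
  and T_star: "T (x\<^sup>\<star>) = (T x)\<^sup>\<star>"
  and T_sum: "T (\<Sum>i\<in>I. f i) = (\<Sum>i\<in>I. T (f i))"
  and E_T: "E (T x) = 0"
  by (simp_all add: T_def B.E_add B.E_diff B.E_scaleR B.E_star star_diff B.E_sum sum_subtractf
      scaleR_diff_right B.E_E)

lemma T_right: "c \<in> C \<Longrightarrow> T (x * c) = T x * c"
  using C_sub_B by (auto simp: T_def B.E_right algebra_simps)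

lemma T_norm: "x \<in> A \<Longrightarrow> norm (T x) \<le> \<tau> * norm x"
  unfolding T_def by (rule close)

lemma T_square_le:
  assumes "x \<in> A" "norm x \<le> r"
  shows "(T x)\<^sup>\<star> * T x \<preceq> (\<tau>\<^sup>2 * r\<^sup>2) *\<^sub>R 1"
proof -
  have "norm (T x) \<le> \<tau> * r"
    using T_norm[OF assms(1)] mult_left_mono[OF assms(2) tau] by linarith
  from cle_star_mult_norm[OF this] show ?thesis by (simp add: power_mult_distrib)
qed

text \<open>Families of every length are allowed, since \<open>T_bound_step\<close> applies the
  bound for a family to the much longer list of remainders of its signed sums.\<close>

definition T_bound :: "real \<Rightarrow> bool" where
  "T_bound L \<longleftrightarrow> (\<forall>hs. (\<forall>h\<in>set hs. h \<in> A \<and> h\<^sup>\<star> = h) \<longrightarrow> (\<Sum>h\<leftarrow>hs. h * h) \<preceq> 1 \<longrightarrow>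
    (\<Sum>h\<leftarrow>hs. T h * T h) \<preceq> L *\<^sub>R 1)"

lemma signed_sums_T: "signed_sums (map T hs) = map T (signed_sums hs)"
  using B.E_zero by (induction hs) (simp_all add: T_add T_diff, simp add: T_def)

text \<open>Truncation of the random sum \<open>X\<close>: its bounded part \<open>b\<close> is controlled by the norm of \<open>T\<close>, and the
  fourth moment bound makes the remainder \<open>k\<close> small enough to recover only half of \<open>L\<close>.\<close>

lemma T_bound_step:
  assumes L: "T_bound L" "L \<ge> 0"
  shows "T_bound (3/2 * \<tau>\<^sup>2 + L / 2)"
  unfolding T_bound_def
proof (intro allI impI)
  fix hs
  assume hs: "\<forall>h\<in>set hs. h \<in> A \<and> h\<^sup>\<star> = h" and le1: "(\<Sum>h\<leftarrow>hs. h * h) \<preceq> 1"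
  define N :: real where "N = 2 ^ length hs"
  have N: "N > 0" by (simp add: N_def)
  define X where "X = signed_sums hs"
  have lX: "real (length X) = N" by (simp add: X_def N_def length_signed_sums)
  have XA: "x \<in> A \<and> x\<^sup>\<star> = x" if "x \<in> set X" for x
    using signed_sums_closed[where P = "\<lambda>x. x \<in> A \<and> x\<^sup>\<star> = x" and hs = hs and x = x] that hs
    by (auto simp: X_def star_add star_diff A_add A_diff subspace_0[OF subspace_A])
  define S where "S = (\<Sum>h\<leftarrow>hs. h * h)"
  have S: "pos S" unfolding S_def using hs by (intro pos_sum_list pos_square) auto
  have nS: "norm S \<le> 1" using norm_cle_iff[OF S, of 1] le1 by (simp add: S_def)
  have "S * S \<preceq> 1" using cle_star_mult_norm[OF nS] by (simp add: pos_star[OF S])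
  moreover have "(\<Sum>h\<leftarrow>hs. h * S * h) \<preceq> 1"
  proof -
    have "(\<Sum>h\<leftarrow>hs. h * S * h) \<preceq> (\<Sum>h\<leftarrow>hs. h * h)"
    proof (rule cle_sum_list_mono)
      fix h assume "h \<in> set hs"
      then show "h * S * h \<preceq> h * h" using cle_conj[OF le1, of h] hs by (simp add: S_def)
    qed
    then show ?thesis using le1 cle_trans by blast
  qed
  ultimately have "S * S + 2 *\<^sub>R (\<Sum>h\<leftarrow>hs. h * S * h) \<preceq> 1 + 2 *\<^sub>R 1"
    by (intro cle_add_mono cle_scaleR_mono) auto
  then have m4a: "N *\<^sub>R (S * S + 2 *\<^sub>R (\<Sum>h\<leftarrow>hs. h * S * h)) \<preceq> N *\<^sub>R (1 + 2 *\<^sub>R 1)"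
    using N by (intro cle_scaleR_mono) auto
  have m4b: "(\<Sum>x\<leftarrow>X. x * x * (x * x)) \<preceq> N *\<^sub>R (S * S + 2 *\<^sub>R (\<Sum>h\<leftarrow>hs. h * S * h))"
    unfolding X_def N_def S_def by (rule signed_sums_fourth_moment) (use hs in auto)
  have "1 + 2 *\<^sub>R 1 = 3 *\<^sub>R (1::'a)" using scaleR_add_left[of 1 2 "1::'a"] by simp
  then have m4c: "N *\<^sub>R (1 + 2 *\<^sub>R 1) = (3 * N) *\<^sub>R (1::'a)" by simp
  have m4: "(\<Sum>x\<leftarrow>X. x * x * (x * x)) \<preceq> (3 * N) *\<^sub>R 1"
    unfolding m4c[symmetric] by (rule cle_trans[OF m4b m4a])
  define Q where "Q x b k \<longleftrightarrow> b \<in> A \<and> k \<in> A \<and> x = b + k \<and> b\<^sup>\<star> = b \<and> k\<^sup>\<star> = k \<and>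
      b * b \<preceq> (3/4) *\<^sub>R 1 \<and> 12 *\<^sub>R (k * k) \<preceq> x * x * (x * x)" for x b k
  have "\<exists>b k. Q x b k" if x: "x \<in> set X" for x
  proof -
    obtain b k where "Q x b k"
      using truncation[OF conjunct2[OF XA[OF x]] cstar_subalgebra_real_subalgebra[OF subalg_A one_A]
          conjunct1[OF XA[OF x]]] unfolding Q_def by blast
    then show ?thesis by blast
  qed
  then obtain b k where "\<And>x. x \<in> set X \<Longrightarrow> Q x (b x) (k x)" by metis
  then have bk: "b x \<in> A" "k x \<in> A" "x = b x + k x" "(b x)\<^sup>\<star> = b x" "(k x)\<^sup>\<star> = k x"
    "b x * b x \<preceq> (3/4) *\<^sub>R 1" "12 *\<^sub>R (k x * k x) \<preceq> x * x * (x * x)" if "x \<in> set X" for x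
    using that unfolding Q_def by blast+
  have "(\<Sum>x\<leftarrow>X. 12 *\<^sub>R (k x * k x)) \<preceq> (\<Sum>x\<leftarrow>X. x * x * (x * x))"
    by (rule cle_sum_list_mono) (rule bk(7))
  then have "(\<Sum>x\<leftarrow>X. 12 *\<^sub>R (k x * k x)) \<preceq> (3 * N) *\<^sub>R 1" using m4 by (rule cle_trans)
  then have "12 *\<^sub>R (\<Sum>x\<leftarrow>X. k x * k x) \<preceq> (3 * N) *\<^sub>R 1" by (simp add: scaleR_sum_list)
  from cle_scaleR_mono[OF this, of "1 / (3 * N)"]
  have k1: "(4 / N) *\<^sub>R (\<Sum>x\<leftarrow>X. k x * k x) \<preceq> 1" using N by simp
  \<comment> \<open>The remainders satisfy 12 times the sum of squares at most \<open>3 * N\<close>,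
    so this scaling makes the sum of squares at most one. Undoing it gives the factor 1/4, which
    \<open>cle_square_add\<close> later doubles to the 1/2 in front of \<open>L\<close>.\<close>
  define q where "q x = (2 / sqrt N) *\<^sub>R k x" for x
  have "(\<Sum>y\<leftarrow>map q X. y * y) = (4 / N) *\<^sub>R (\<Sum>x\<leftarrow>X. k x * k x)"
    using N by (simp add: comp_def q_def scaleR_sum_list)
  with k1 have "(\<Sum>y\<leftarrow>map q X. y * y) \<preceq> 1" by simp
  moreover have "\<forall>y\<in>set (map q X). y \<in> A \<and> y\<^sup>\<star> = y"
    using bk(2,5) by (auto simp: q_def A_scale star_scaleR)
  ultimately have "(\<Sum>y\<leftarrow>map q X. T y * T y) \<preceq> L *\<^sub>R 1"
    using L(1) unfolding T_bound_def by blast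
  moreover have "(\<Sum>y\<leftarrow>map q X. T y * T y) = (4 / N) *\<^sub>R (\<Sum>x\<leftarrow>X. T (k x) * T (k x))"
    using N by (simp add: comp_def q_def scaleR_sum_list T_scaleR)
  ultimately have "(4 / N) *\<^sub>R (\<Sum>x\<leftarrow>X. T (k x) * T (k x)) \<preceq> L *\<^sub>R 1" by simp
  from cle_scaleR_mono[OF this, of "N / 4"]
  have Tk: "(\<Sum>x\<leftarrow>X. T (k x) * T (k x)) \<preceq> (N * L / 4) *\<^sub>R 1" using N by simp
  have Tb: "(\<Sum>x\<leftarrow>X. T (b x) * T (b x)) \<preceq> (N * (\<tau>\<^sup>2 * (3/4))) *\<^sub>R 1"
  proof -
    have "(\<Sum>x\<leftarrow>X. T (b x) * T (b x)) \<preceq> (\<Sum>x\<leftarrow>X. (\<tau>\<^sup>2 * (3/4)) *\<^sub>R 1)"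
    proof (rule cle_sum_list_mono)
      fix x assume x: "x \<in> set X"
      have "norm (b x) \<le> sqrt (3/4)"
        by (rule norm_le_if_cle) (use bk(4,6)[OF x] in auto)
      from T_square_le[OF bk(1)[OF x] this] bk(4)[OF x]
      show "T (b x) * T (b x) \<preceq> (\<tau>\<^sup>2 * (3/4)) *\<^sub>R 1" by (simp flip: T_star)
    qed
    then show ?thesis by (simp only: sum_list_const_scaleR lX scaleR_scaleR)
  qed
  have "N *\<^sub>R (\<Sum>h\<leftarrow>hs. T h * T h) = (\<Sum>x\<leftarrow>X. T x * T x)"
    using signed_sums_second_moment[where hs = "map T hs" and k = 1]
    by (simp add: signed_sums_T X_def N_def comp_def)
  also have "\<dots> \<preceq> (\<Sum>x\<leftarrow>X. 2 *\<^sub>R (T (b x) * T (b x) + T (k x) * T (k x)))"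
  proof (rule cle_sum_list_mono)
    fix x assume x: "x \<in> set X"
    have "T x = T (b x) + T (k x)" using T_add[of "b x" "k x"] unfolding bk(3)[OF x, symmetric] .
    moreover have "(T (b x))\<^sup>\<star> = T (b x)" "(T (k x))\<^sup>\<star> = T (k x)"
      using bk(4,5)[OF x] T_star[of "b x"] T_star[of "k x"] by simp_all
    ultimately show "T x * T x \<preceq> 2 *\<^sub>R (T (b x) * T (b x) + T (k x) * T (k x))"
      using cle_square_add[of "T (b x)" "T (k x)"] by (simp add: star_add)
  qed
  also have "\<dots> = 2 *\<^sub>R ((\<Sum>x\<leftarrow>X. T (b x) * T (b x)) + (\<Sum>x\<leftarrow>X. T (k x) * T (k x)))"
    by (simp add: sum_list_addf scaleR_sum_list scaleR_add_right)
  also have "\<dots> \<preceq> 2 *\<^sub>R ((N * (\<tau>\<^sup>2 * (3/4))) *\<^sub>R 1 + (N * L / 4) *\<^sub>R 1)"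
    by (intro cle_scaleR_mono cle_add_mono Tb Tk) auto
  also have "\<dots> = (N * (3/2 * \<tau>\<^sup>2 + L / 2)) *\<^sub>R 1"
    by (simp add: algebra_simps flip: scaleR_add_left)
  finally have "N *\<^sub>R (\<Sum>h\<leftarrow>hs. T h * T h) \<preceq> (N * (3/2 * \<tau>\<^sup>2 + L / 2)) *\<^sub>R 1" .
  from cle_scaleR_mono[OF this, of "1 / N"]
  show "(\<Sum>h\<leftarrow>hs. T h * T h) \<preceq> (3/2 * \<tau>\<^sup>2 + L / 2) *\<^sub>R 1" using N by simp
qed

text \<open>The a priori bound is where finite index enters: \<open>T x = \<Sum> T(v\<^sub>i) F(v\<^sub>i\<^sup>\<star> x)\<close>.\<close>

lemma T_bound_exists:
  obtains L where "L \<ge> 0" "T_bound L"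
proof -
  define K where "K = (\<Sum>i=1..n. T (v i) * (T (v i))\<^sup>\<star>)"
  define R where "R = norm K + 1"
  have R: "R > 0" by (simp add: R_def add_nonneg_pos)
  have K: "pos K" unfolding K_def by (intro pos_sum pos_self_mult_star)
  then have KR: "K \<preceq> R *\<^sub>R 1" by (simp add: norm_cle_iff R_def)
  have I: "pos Ind" unfolding Ind_def by (intro pos_sum pos_self_mult_star)
  \<comment> \<open>A bound by a multiple of \<open>F (h * h)\<close> is additive in
    \<open>h * h\<close>, so it can be summed over families of any length.\<close>
  have bound: "T h * T h \<preceq> (R * norm Ind) *\<^sub>R F (h * h)" if h: "h \<in> A" "h\<^sup>\<star> = h" for h
  proof -
    have vh: "(v i)\<^sup>\<star> * h \<in> A" if "i \<in> {1..n}" for i by (intro A_mult A_star v_in that h)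
    have hh: "h * h \<in> A" by (intro A_mult h)
    have "T h = (\<Sum>i=1..n. T (v i) * F ((v i)\<^sup>\<star> * h))"
      by (subst expansion[OF h(1)]) (auto simp: T_sum T_right E_in vh intro!: sum.cong)
    moreover have "(T h)\<^sup>\<star> = T h" using T_star[of h] h by simp
    ultimately have "T h * T h \<preceq> R *\<^sub>R (\<Sum>i=1..n. (F ((v i)\<^sup>\<star> * h))\<^sup>\<star> * F ((v i)\<^sup>\<star> * h))"
      using cle_row_column_bound[OF KR[unfolded K_def] R] by metis
    also have "\<dots> \<preceq> R *\<^sub>R (\<Sum>i=1..n. F (((v i)\<^sup>\<star> * h)\<^sup>\<star> * ((v i)\<^sup>\<star> * h)))"
      using R by (intro cle_scaleR_mono cle_sum_mono E_schwarz vh) auto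
    also have "(\<Sum>i=1..n. F (((v i)\<^sup>\<star> * h)\<^sup>\<star> * ((v i)\<^sup>\<star> * h))) = F (h\<^sup>\<star> * Ind * h)"
      by (subst E_sum[symmetric])
         (auto simp: Ind_def star_mult star_star sum_distrib_left sum_distrib_right mult.assoc
           intro!: A_mult A_star v_in h arg_cong[where f = F])
    also have "R *\<^sub>R F (h\<^sup>\<star> * Ind * h) \<preceq> R *\<^sub>R F (norm Ind *\<^sub>R (h * h))"
    proof (intro cle_scaleR_mono E_mono)
      show "h\<^sup>\<star> * Ind * h \<preceq> norm Ind *\<^sub>R (h * h)"
        using cle_conj[OF cle_norm[OF pos_star[OF I]], of h] by (simp add: h)
    qed (use R in \<open>auto intro!: A_mult A_star A_scale h Ind_in\<close>)
    also have "\<dots> = (R * norm Ind) *\<^sub>R F (h * h)" by (simp add: E_scaleR hh)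
    finally show ?thesis .
  qed
  have "T_bound (R * norm Ind)"
    unfolding T_bound_def
  proof (intro allI impI)
    fix hs
    assume hs: "\<forall>h\<in>set hs. h \<in> A \<and> h\<^sup>\<star> = h" and le1: "(\<Sum>h\<leftarrow>hs. h * h) \<preceq> 1"
    have F: "(\<Sum>h\<leftarrow>hs. F (h * h)) = F (\<Sum>h\<leftarrow>hs. h * h) \<and> (\<Sum>h\<leftarrow>hs. h * h) \<in> A"
      using hs by (induction hs) (auto simp: E_zero E_add A_mult A_add subspace_0[OF subspace_A])
    have "(\<Sum>h\<leftarrow>hs. T h * T h) \<preceq> (\<Sum>h\<leftarrow>hs. (R * norm Ind) *\<^sub>R F (h * h))"
      by (rule cle_sum_list_mono) (use hs bound in auto)
    also have "\<dots> = (R * norm Ind) *\<^sub>R F (\<Sum>h\<leftarrow>hs. h * h)" using F by (simp flip: scaleR_sum_list)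
    also have "\<dots> \<preceq> (R * norm Ind) *\<^sub>R F 1"
      using R by (intro cle_scaleR_mono E_mono conjunct2[OF F] one_A le1) auto
    finally show "(\<Sum>h\<leftarrow>hs. T h * T h) \<preceq> (R * norm Ind) *\<^sub>R 1" by (simp add: E_one)
  qed
  then show thesis using that[of "R * norm Ind"] R by simp
qed

text \<open>Iterating \<open>T_bound_step\<close> from the a priori bound \<open>L\<close>, the
  sequence \<open>l\<close> converges to the fixed point \<open>3 * \<tau>\<^sup>2\<close>, where no
  trace of \<open>L\<close> or of the index remains.\<close>

theorem T_bound_main: "T_bound (3 * \<tau>\<^sup>2)"
proof -
  obtain L where L: "L \<ge> 0" "T_bound L" by (rule T_bound_exists)
  define l where "l m = 3 * \<tau>\<^sup>2 + (L - 3 * \<tau>\<^sup>2) * (1/2) ^ m" for m :: nat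
  have l: "T_bound (l m) \<and> l m \<ge> 0" for m
  proof (induction m)
    case (Suc m)
    have "l (Suc m) = 3/2 * \<tau>\<^sup>2 + l m / 2" by (simp add: l_def field_simps)
    then show ?case using T_bound_step[of "l m"] Suc by simp
  qed (use L in \<open>simp add: l_def\<close>)
  have "(\<lambda>m. (L - 3 * \<tau>\<^sup>2) * (1/2) ^ m) \<longlonglongrightarrow> 0"
    using tendsto_mult_left[OF LIMSEQ_power_zero[of "1/2::real"], of "L - 3 * \<tau>\<^sup>2"] by simp
  from tendsto_add[OF tendsto_const this] have lim: "l \<longlonglongrightarrow> 3 * \<tau>\<^sup>2"
    unfolding l_def by simp
  show ?thesis unfolding T_bound_def
  proof (intro allI impI)
    fix hs
    assume hs: "\<forall>h\<in>set hs. h \<in> A \<and> h\<^sup>\<star> = h" and le1: "(\<Sum>h\<leftarrow>hs. h * h) \<preceq> 1"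
    have p: "pos (\<Sum>h\<leftarrow>hs. T h * T h)"
      using hs T_star by (intro pos_sum_list pos_square) metis
    have "norm (\<Sum>h\<leftarrow>hs. T h * T h) \<le> l m" for m
      using l[of m] hs le1 unfolding T_bound_def norm_cle_iff[OF p, symmetric] by blast
    then have "norm (\<Sum>h\<leftarrow>hs. T h * T h) \<le> 3 * \<tau>\<^sup>2"
      by (intro LIMSEQ_le_const[OF lim]) auto
    then show "(\<Sum>h\<leftarrow>hs. T h * T h) \<preceq> (3 * \<tau>\<^sup>2) *\<^sub>R 1" by (simp add: norm_cle_iff[OF p])
  qed
qed

section \<open>The column estimate for families that need not be self-adjoint\<close>

lemma T_square_sum:
  assumes "\<And>i. i \<in> {1..m::nat} \<Longrightarrow> h i \<in> A \<and> (h i)\<^sup>\<star> = h i" "r > 0"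
    "(\<Sum>i=1..m. h i * h i) \<preceq> r *\<^sub>R 1"
  shows "(\<Sum>i=1..m. T (h i) * T (h i)) \<preceq> (r * (3 * \<tau>\<^sup>2)) *\<^sub>R 1"
proof -
  define hs where "hs = map (\<lambda>i. (1 / sqrt r) *\<^sub>R h i) [1..<Suc m]"
  have conv: "(\<Sum>i\<leftarrow>[1..<Suc m]. f i) = (\<Sum>i=1..m. f i)" for f :: "nat \<Rightarrow> 'a"
    using sum_set_upt_conv_sum_list_nat[of f 1 "Suc m"]
    by (simp only: set_upt atLeastLessThanSuc_atLeastAtMost)
  have "(\<Sum>x\<leftarrow>hs. x * x) = (1 / r) *\<^sub>R (\<Sum>i=1..m. h i * h i)"
    using assms(2) unfolding hs_def map_map comp_def conv by (simp add: scaleR_sum_right)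
  also have "\<dots> \<preceq> (1 / r) *\<^sub>R (r *\<^sub>R 1)" using assms by (intro cle_scaleR_mono) auto
  finally have "(\<Sum>x\<leftarrow>hs. x * x) \<preceq> 1" using assms(2) by simp
  moreover have "\<forall>x\<in>set hs. x \<in> A \<and> x\<^sup>\<star> = x"
    using assms(1) by (auto simp: hs_def A_scale star_scaleR)
  ultimately have "(\<Sum>x\<leftarrow>hs. T x * T x) \<preceq> (3 * \<tau>\<^sup>2) *\<^sub>R 1"
    using T_bound_main unfolding T_bound_def by blast
  from cle_scaleR_mono[OF this, of r]
  have "r *\<^sub>R (\<Sum>x\<leftarrow>hs. T x * T x) \<preceq> (r * (3 * \<tau>\<^sup>2)) *\<^sub>R 1" using assms(2) by simp
  moreover have "r *\<^sub>R (\<Sum>x\<leftarrow>hs. T x * T x) = (\<Sum>i=1..m. T (h i) * T (h i))"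
    using assms(2) unfolding hs_def map_map comp_def conv by (simp add: scaleR_sum_right T_scaleR)
  ultimately show ?thesis by simp
qed

text \<open>Writing \<open>x = y h\<close> with \<open>h\<^sup>2 = x\<^sup>\<star> x + e\<close> and \<open>\<parallel>y\<parallel> \<le> 1\<close> reduces column sums to the self-adjoint case.\<close>

lemma T_square_polar:
  assumes x: "x \<in> A" and e: "e > 0"
  obtains h where "h \<in> A" "h\<^sup>\<star> = h" "h * h = x\<^sup>\<star> * x + e *\<^sub>R 1"
    "(T x)\<^sup>\<star> * T x \<preceq> 3 *\<^sub>R (\<tau>\<^sup>2 *\<^sub>R E (h * h) + T h * T h + \<tau>\<^sup>2 *\<^sub>R E (T h * T h))"
proof -
  \<comment> \<open>Adding \<open>e *\<^sub>R 1\<close> makes \<open>a\<close> bounded below, so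
    that its inverse root exists; \<open>T_column\<close> lets \<open>e\<close> tend to
    zero.\<close>
  define a where "a = x\<^sup>\<star> * x + e *\<^sub>R 1"
  have d: "e *\<^sub>R 1 \<preceq> a" by (simp add: a_def cle_def pos_star_mult_self)
  have aA: "a \<in> A" unfolding a_def by (intro A_add A_mult A_star A_scale x one_A)
  have as: "a\<^sup>\<star> = a" by (simp add: a_def star_add star_mult star_star star_scaleR)
  define g where "g = isqrt a"
  have gA: "g \<in> A"
    unfolding g_def by (rule isqrt_in[OF e d cstar_subalgebra_real_subalgebra[OF subalg_A one_A] aA])
  have gs: "g\<^sup>\<star> = g" unfolding g_def by (rule pos_star[OF pos_isqrt[OF e d]])
  have ag: "a * g = g * a" unfolding g_def by (rule isqrt_commute[OF e d refl])
  have gag: "g * a * g = 1" unfolding g_def by (rule isqrt_conj[OF e d])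
  define h where "h = a * g"
  define y where "y = x * g"
  have hA: "h \<in> A" and yA: "y \<in> A" by (simp_all add: h_def y_def A_mult aA gA x)
  have hs: "h\<^sup>\<star> = h" by (simp add: h_def star_mult gs as ag)
  have hh: "h * h = a"
  proof -
    have "h * h = a * (g * a * g)" by (simp only: h_def mult.assoc)
    then show ?thesis by (simp add: gag)
  qed
  have yh: "y * h = x"
  proof -
    have "y * h = x * (g * a * g)" by (simp only: y_def h_def mult.assoc)
    then show ?thesis by (simp add: gag)
  qed
  have "y\<^sup>\<star> * y = g * a * g - e *\<^sub>R (g * g)" by (simp add: y_def star_mult gs a_def algebra_simps)
  then have "y\<^sup>\<star> * y \<preceq> 1\<^sup>2 *\<^sub>R 1"
    using e pos_scaleR[OF pos_square[OF gs], of e] by (simp add: gag cle_def)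
  then have ny: "norm y \<le> 1" by (rule norm_le_if_cle) simp
  have nTy: "norm (T y) \<le> \<tau>"
    using T_norm[OF yA] mult_left_mono[OF ny tau] by linarith
  have Ths: "(T h)\<^sup>\<star> = T h" using T_star[of h] hs by simp
  \<comment> \<open>Split both factors into their \<open>E\<close> and \<open>T\<close> parts. The
    mixed terms vanish because \<open>E\<close> is \<open>B\<close>-bilinear and kills the range of
    \<open>T\<close>.\<close>
  have "E (y * h) = E y * E h + E (T y * T h)"
  proof -
    have "y * h = E y * E h + E y * T h + T y * E h + T y * T h" by (simp add: T_def algebra_simps)
    then have "E (y * h) = E (E y * E h + E y * T h + T y * E h + T y * T h)" by simp
    also have "\<dots> = E y * E h + E y * E (T h) + E (T y) * E h + E (T y * T h)"
      by (simp add: B.E_add B.E_left B.E_right B.E_in B.E_E)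
    finally show ?thesis by (simp add: E_T)
  qed
  then have Tx: "T x = T y * E h + y * T h + - E (T y * T h)"
    unfolding yh[symmetric] by (simp add: T_def algebra_simps)
  have "(T y * E h)\<^sup>\<star> * (T y * E h) \<preceq> \<tau>\<^sup>2 *\<^sub>R E (h * h)"
  proof -
    have "(T y * E h)\<^sup>\<star> * (T y * E h) \<preceq> (norm (T y))\<^sup>2 *\<^sub>R ((E h)\<^sup>\<star> * E h)" by (rule cle_mult_norm)
    also have "\<dots> \<preceq> \<tau>\<^sup>2 *\<^sub>R ((E h)\<^sup>\<star> * E h)"
      by (rule cle_scaleR_mono_left[OF pos_star_mult_self]) (simp add: nTy power_mono)
    also have "\<dots> \<preceq> \<tau>\<^sup>2 *\<^sub>R E (h\<^sup>\<star> * h)" by (intro cle_scaleR_mono B.E_schwarz) auto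
    finally show ?thesis by (simp add: hs)
  qed
  moreover have "(y * T h)\<^sup>\<star> * (y * T h) \<preceq> T h * T h"
  proof -
    have "(y * T h)\<^sup>\<star> * (y * T h) \<preceq> (norm y)\<^sup>2 *\<^sub>R ((T h)\<^sup>\<star> * T h)" by (rule cle_mult_norm)
    also have "\<dots> \<preceq> 1 *\<^sub>R ((T h)\<^sup>\<star> * T h)"
      by (rule cle_scaleR_mono_left[OF pos_star_mult_self]) (simp add: ny power_le_one)
    finally show ?thesis by (simp add: Ths)
  qed
  moreover have "(- E (T y * T h))\<^sup>\<star> * - E (T y * T h) \<preceq> \<tau>\<^sup>2 *\<^sub>R E (T h * T h)"
  proof -
    have "(E (T y * T h))\<^sup>\<star> * E (T y * T h) \<preceq> E ((T y * T h)\<^sup>\<star> * (T y * T h))" by (rule B.E_schwarz) simp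
    also have "\<dots> \<preceq> E (\<tau>\<^sup>2 *\<^sub>R ((T h)\<^sup>\<star> * T h))"
    proof (rule B.E_mono)
      have "(T y * T h)\<^sup>\<star> * (T y * T h) \<preceq> (norm (T y))\<^sup>2 *\<^sub>R ((T h)\<^sup>\<star> * T h)" by (rule cle_mult_norm)
      also have "\<dots> \<preceq> \<tau>\<^sup>2 *\<^sub>R ((T h)\<^sup>\<star> * T h)"
        by (rule cle_scaleR_mono_left[OF pos_star_mult_self]) (simp add: nTy power_mono)
      finally show "(T y * T h)\<^sup>\<star> * (T y * T h) \<preceq> \<tau>\<^sup>2 *\<^sub>R ((T h)\<^sup>\<star> * T h)" .
    qed auto
    finally show ?thesis by (simp add: Ths B.E_scaleR)
  qed
  ultimately have "3 *\<^sub>R ((T y * E h)\<^sup>\<star> * (T y * E h) + (y * T h)\<^sup>\<star> * (y * T h)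
        + (- E (T y * T h))\<^sup>\<star> * - E (T y * T h))
      \<preceq> 3 *\<^sub>R (\<tau>\<^sup>2 *\<^sub>R E (h * h) + T h * T h + \<tau>\<^sup>2 *\<^sub>R E (T h * T h))"
    by (intro cle_scaleR_mono cle_add_mono) auto
  then have "(T x)\<^sup>\<star> * T x \<preceq> 3 *\<^sub>R (\<tau>\<^sup>2 *\<^sub>R E (h * h) + T h * T h + \<tau>\<^sup>2 *\<^sub>R E (T h * T h))"
    unfolding Tx using cle_square_add3 cle_trans by blast
  then show thesis using that[of h] hA hs hh by (simp add: a_def)
qed

text \<open>Summing \<open>T_square_polar\<close> bounds the column by \<open>3 * (\<tau>\<^sup>2 +
  3 * \<tau>\<^sup>2 + 3 * \<tau>\<^sup>2 * \<tau>\<^sup>2)\<close> times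
  \<open>1 + real m * e\<close>, and smallness of \<tau> reduces this to 13. Letting
  \<open>e\<close> tend to zero removes the dependence on \<open>m\<close>.\<close>

lemma T_column:
  assumes x: "\<And>i. i \<in> {1..m::nat} \<Longrightarrow> x i \<in> A" and le1: "(\<Sum>i=1..m. (x i)\<^sup>\<star> * x i) \<preceq> 1"
    and small: "9 * \<tau>\<^sup>2 \<le> 1"
  shows "norm (\<Sum>i=1..m. (T (x i))\<^sup>\<star> * T (x i)) \<le> 13 * \<tau>\<^sup>2"
proof -
  let ?S = "\<Sum>i=1..m. (T (x i))\<^sup>\<star> * T (x i)"
  have pS: "pos ?S" by (intro pos_sum pos_star_mult_self)
  have bound: "norm ?S \<le> (1 + real m * e) * (13 * \<tau>\<^sup>2)" if e: "e > 0" for e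
  proof -
    define r where "r = 1 + real m * e"
    have r: "r > 0" using e by (simp add: r_def add_pos_nonneg)
    define Q where "Q i h \<longleftrightarrow> h \<in> A \<and> h\<^sup>\<star> = h \<and> h * h = (x i)\<^sup>\<star> * x i + e *\<^sub>R 1 \<and>
      (T (x i))\<^sup>\<star> * T (x i) \<preceq> 3 *\<^sub>R (\<tau>\<^sup>2 *\<^sub>R E (h * h) + T h * T h + \<tau>\<^sup>2 *\<^sub>R E (T h * T h))" for i h
    have "\<exists>h. Q i h" if i: "i \<in> {1..m}" for i
    proof -
      obtain h where "Q i h" using T_square_polar[OF x[OF i] e] unfolding Q_def by blast
      then show ?thesis by blast
    qed
    then obtain h where "\<And>i. i \<in> {1..m} \<Longrightarrow> Q i (h i)" by metis
    then have h: "h i \<in> A" "(h i)\<^sup>\<star> = h i" "h i * h i = (x i)\<^sup>\<star> * x i + e *\<^sub>R 1"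
      "(T (x i))\<^sup>\<star> * T (x i) \<preceq> 3 *\<^sub>R (\<tau>\<^sup>2 *\<^sub>R E (h i * h i) + T (h i) * T (h i) + \<tau>\<^sup>2 *\<^sub>R E (T (h i) * T (h i)))"
      if "i \<in> {1..m}" for i using that unfolding Q_def by blast+
    define H K where "H = (\<Sum>i=1..m. h i * h i)" and "K = (\<Sum>i=1..m. T (h i) * T (h i))"
    have "H = (\<Sum>i=1..m. (x i)\<^sup>\<star> * x i) + (real m * e) *\<^sub>R 1"
      using h(3) by (simp add: H_def sum.distrib sum_constant_scaleR del: sum_constant)
    also have "\<dots> \<preceq> 1 + (real m * e) *\<^sub>R 1" by (intro cle_add_mono le1 cle_refl)
    finally have H: "H \<preceq> r *\<^sub>R 1" by (simp add: r_def scaleR_add_left)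
    have K: "K \<preceq> (r * (3 * \<tau>\<^sup>2)) *\<^sub>R 1"
      unfolding K_def by (rule T_square_sum) (use h(1,2) r H in \<open>auto simp: H_def\<close>)
    have E1: "E (q *\<^sub>R 1) = q *\<^sub>R 1" for q by (simp add: B.E_scaleR B.E_one)
    have "?S \<preceq> (\<Sum>i=1..m. 3 *\<^sub>R (\<tau>\<^sup>2 *\<^sub>R E (h i * h i) + T (h i) * T (h i) + \<tau>\<^sup>2 *\<^sub>R E (T (h i) * T (h i))))"
      by (rule cle_sum_mono) (rule h(4))
    also have "\<dots> = 3 *\<^sub>R (\<tau>\<^sup>2 *\<^sub>R E H + K + \<tau>\<^sup>2 *\<^sub>R E K)"
      by (simp add: H_def K_def B.E_sum scaleR_sum_right sum.distrib scaleR_add_right)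
    also have "\<dots> \<preceq> 3 *\<^sub>R (\<tau>\<^sup>2 *\<^sub>R r *\<^sub>R 1 + (r * (3 * \<tau>\<^sup>2)) *\<^sub>R 1 + \<tau>\<^sup>2 *\<^sub>R (r * (3 * \<tau>\<^sup>2)) *\<^sub>R 1)"
      using B.E_mono[OF _ _ H] B.E_mono[OF _ _ K] unfolding E1
      by (intro cle_scaleR_mono cle_add_mono K) auto
    also have "\<dots> = (r * (\<tau>\<^sup>2 * (12 + 9 * \<tau>\<^sup>2))) *\<^sub>R 1"
      by (simp add: algebra_simps flip: scaleR_add_left)
    also have "\<dots> \<preceq> (r * (13 * \<tau>\<^sup>2)) *\<^sub>R 1"
    proof (intro cle_scaleR_one mult_left_mono)
      have "\<tau>\<^sup>2 * (12 + 9 * \<tau>\<^sup>2) \<le> \<tau>\<^sup>2 * 13" using small by (intro mult_left_mono) auto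
      then show "\<tau>\<^sup>2 * (12 + 9 * \<tau>\<^sup>2) \<le> 13 * \<tau>\<^sup>2" by simp
    qed (use r in simp)
    finally show ?thesis unfolding norm_cle_iff[OF pS] r_def .
  qed
  have "((\<lambda>e. (1 + real m * e) * (13 * \<tau>\<^sup>2)) \<longlongrightarrow> (1 + real m * 0) * (13 * \<tau>\<^sup>2)) (at_right 0)"
    by (intro tendsto_intros)
  moreover have "\<forall>\<^sub>F e in at_right 0. norm ?S \<le> (1 + real m * e) * (13 * \<tau>\<^sup>2)"
    using bound by (auto simp: eventually_at_right_field intro: exI[of _ 1])
  ultimately have "norm ?S \<le> (1 + real m * 0) * (13 * \<tau>\<^sup>2)"
    by (intro tendsto_lowerbound) auto
  then show ?thesis by simp
qed

section \<open>The averaged map \<open>t\<close>\<close>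

definition t :: "'a \<Rightarrow> 'a" where
  "t x = (\<Sum>i=1..n. w i * E ((w i)\<^sup>\<star> * x))"

lemma t_add: "t (x + y) = t x + t y"
  and t_diff: "t (x - y) = t x - t y"
  by (simp_all add: t_def algebra_simps B.E_add B.E_diff sum.distrib sum_subtractf)

lemma t_right: "b \<in> B \<Longrightarrow> t (x * b) = t x * b"
  by (simp add: t_def sum_distrib_right B.E_right flip: mult.assoc)

text \<open>The double expansion of \<open>Ind_central\<close> again, now with \<open>E\<close>
  inside: the coefficients lie in \<open>C\<close>, hence in \<open>B\<close>, and so pass through
  \<open>E\<close>. The normalising factor \<open>isqrt Ind\<close> commutes with
  \<open>A\<close>.\<close>

lemma t_left:
  assumes a: "a \<in> A"
  shows "t (a * x) = a * t x"
proof -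
  let ?g = "isqrt Ind"
  have tv: "t y = ?g * (\<Sum>i=1..n. v i * E ((v i)\<^sup>\<star> * (?g * y)))" for y
    by (simp add: t_def w_def star_mult isqrt_Ind_star sum_distrib_left mult.assoc)
  have ag: "a * ?g = ?g * a" by (rule isqrt_Ind_central[OF a])
  have CB: "F y * E z = E (F y * z)" if "y \<in> A" for y z
    using B.E_left[of "F y" z] E_in[OF that] C_sub_B by auto
  have "a * t x = ?g * (\<Sum>i=1..n. (a * v i) * E ((v i)\<^sup>\<star> * (?g * x)))"
    unfolding tv mult.assoc[symmetric, of a] ag by (simp add: sum_distrib_left mult.assoc)
  also have "(\<Sum>i=1..n. (a * v i) * E ((v i)\<^sup>\<star> * (?g * x)))
      = (\<Sum>i=1..n. (\<Sum>j=1..n. v j * F ((v j)\<^sup>\<star> * (a * v i))) * E ((v i)\<^sup>\<star> * (?g * x)))"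
    by (intro sum.cong refl arg_cong2[where f = "(*)"] expansion A_mult a v_in)
  also have "\<dots> = (\<Sum>i=1..n. \<Sum>j=1..n. v j * E (F ((v j)\<^sup>\<star> * (a * v i)) * ((v i)\<^sup>\<star> * (?g * x))))"
    unfolding sum_distrib_right
    by (intro sum.cong refl) (simp only: mult.assoc CB[OF A_mult[OF A_star[OF v_in] A_mult[OF a v_in]]])
  also have "\<dots> = (\<Sum>j=1..n. \<Sum>i=1..n. v j * E (F ((v j)\<^sup>\<star> * (a * v i)) * ((v i)\<^sup>\<star> * (?g * x))))"
    by (rule sum.swap)
  also have "\<dots> = (\<Sum>j=1..n. v j * E ((\<Sum>i=1..n. F (((v j)\<^sup>\<star> * a) * v i) * (v i)\<^sup>\<star>) * (?g * x)))"
    by (simp add: B.E_sum sum_distrib_left sum_distrib_right mult.assoc)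
  also have "\<dots> = (\<Sum>j=1..n. v j * E (((v j)\<^sup>\<star> * a) * (?g * x)))"
  proof (intro sum.cong refl)
    fix j assume "j \<in> {1..n}"
    then show "v j * E ((\<Sum>i=1..n. F (((v j)\<^sup>\<star> * a) * v i) * (v i)\<^sup>\<star>) * (?g * x)) = v j * E (((v j)\<^sup>\<star> * a) * (?g * x))"
      using expansion_left[OF A_mult[OF A_star[OF v_in] a], of j] by simp
  qed
  also have "\<dots> = (\<Sum>j=1..n. v j * E ((v j)\<^sup>\<star> * (?g * (a * x))))"
    unfolding mult.assoc by (simp only: mult.assoc[symmetric, of a] ag) (simp only: mult.assoc)
  finally show ?thesis by (simp add: tv)
qed

end

section \<open>Closeness of \<open>t\<close> to \<open>E\<close>\<close>

locale very_close_pair = close_pair +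
  assumes tau_small: "\<tau> \<le> 1 / 10 ^ 5"
    and B_near_A: "b \<in> B \<Longrightarrow> \<exists>a\<in>A. norm (a - b) \<le> norm b / 4"
begin

text \<open>A convenient upper bound for sqrt 13 times \<tau>, the constant of
  \<open>T_column\<close>.\<close>

definition \<kappa> :: real where
  "\<kappa> = 4 * \<tau>"

lemma kappa: "0 \<le> \<kappa>" "\<kappa> \<le> 4 / 10 ^ 5"
  using tau tau_small by (auto simp: \<kappa>_def)

lemma w_column: "(\<Sum>i=1..n. (T ((w i)\<^sup>\<star>))\<^sup>\<star> * T ((w i)\<^sup>\<star>)) \<preceq> \<kappa>\<^sup>2 *\<^sub>R 1"
proof -
  have p: "pos (\<Sum>i=1..n. (T ((w i)\<^sup>\<star>))\<^sup>\<star> * T ((w i)\<^sup>\<star>))" by (intro pos_sum pos_star_mult_self)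
  have "\<tau>\<^sup>2 \<le> (1 / 10 ^ 5)\<^sup>2" using tau tau_small by (intro power_mono) auto
  then have "9 * \<tau>\<^sup>2 \<le> 1" by (simp add: power2_eq_square)
  then have "norm (\<Sum>i=1..n. (T ((w i)\<^sup>\<star>))\<^sup>\<star> * T ((w i)\<^sup>\<star>)) \<le> 13 * \<tau>\<^sup>2"
    by (intro T_column A_star w_in) (auto simp: star_star sum_w simp del: One_nat_def)
  also have "\<dots> \<le> \<kappa>\<^sup>2" by (simp add: \<kappa>_def power2_eq_square)
  finally show ?thesis using norm_cle_iff[OF p] by blast
qed

text \<open>Since \<open>E\<close> differs from the identity by \<open>T\<close>, the difference is
  minus the product of the row of the \<open>w i\<close> with the small column of the
  \<open>T ((w i)\<^sup>\<star>)\<close>.\<close>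

lemma t_one: "norm (t 1 - 1) \<le> \<kappa>"
proof (rule norm_le_if_cle)
  have "t 1 - (\<Sum>i=1..n. w i * (w i)\<^sup>\<star>) = - (\<Sum>i=1..n. w i * T ((w i)\<^sup>\<star>))"
    by (simp add: t_def T_def algebra_simps sum_subtractf)
  then have "t 1 - 1 = - (\<Sum>i=1..n. w i * T ((w i)\<^sup>\<star>))" by (simp only: sum_w)
  then have "(t 1 - 1)\<^sup>\<star> * (t 1 - 1) = (\<Sum>i=1..n. w i * T ((w i)\<^sup>\<star>))\<^sup>\<star> * (\<Sum>i=1..n. w i * T ((w i)\<^sup>\<star>))"
    by simp
  also have "\<dots> \<preceq> (\<Sum>i=1..n. (T ((w i)\<^sup>\<star>))\<^sup>\<star> * T ((w i)\<^sup>\<star>))"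
    by (rule cle_row_column) (simp only: sum_w cle_refl)
  also note w_column
  finally show "(t 1 - 1)\<^sup>\<star> * (t 1 - 1) \<preceq> \<kappa>\<^sup>2 *\<^sub>R 1" .
qed (use kappa in simp)

text \<open>On the kernel of \<open>E\<close> the part of \<open>(w i)\<^sup>\<star>\<close> in
  \<open>B\<close> does not contribute, so only the small column enters. Together with
  \<open>t_one\<close> and right \<open>B\<close>-linearity this expresses that \<open>t\<close> is
  close to \<open>E\<close>.\<close>

lemma t_kernel:
  assumes "E z = 0"
  shows "norm (t z) \<le> \<kappa> * norm z"
proof (rule norm_le_if_cle)
  let ?z = "\<lambda>i. T ((w i)\<^sup>\<star>)"
  have "E ((w i)\<^sup>\<star> * z) = E (?z i * z)" for i
    using assms B.E_left[of "E ((w i)\<^sup>\<star>)" z] by (simp add: T_def algebra_simps B.E_diff B.E_in)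
  then have "t z = (\<Sum>i=1..n. w i * E (?z i * z))" by (simp add: t_def)
  then have "(t z)\<^sup>\<star> * t z \<preceq> (\<Sum>i=1..n. (E (?z i * z))\<^sup>\<star> * E (?z i * z))"
    using cle_row_column[of w "{1..n}" "\<lambda>i. E (?z i * z)"] by (simp only: sum_w cle_refl)
  also have "\<dots> \<preceq> (\<Sum>i=1..n. E ((?z i * z)\<^sup>\<star> * (?z i * z)))"
    by (intro cle_sum_mono B.E_schwarz) auto
  also have "\<dots> = E (z\<^sup>\<star> * (\<Sum>i=1..n. (?z i)\<^sup>\<star> * ?z i) * z)"
    by (simp add: B.E_sum star_mult sum_distrib_left sum_distrib_right mult.assoc)
  also have "\<dots> \<preceq> E (z\<^sup>\<star> * (\<kappa>\<^sup>2 *\<^sub>R 1) * z)"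
    by (intro B.E_mono cle_conj w_column) auto
  also have "\<dots> \<preceq> E ((\<kappa>\<^sup>2 * (norm z)\<^sup>2) *\<^sub>R 1)"
    using cle_scaleR_mono[OF cle_star_mult_norm[OF order_refl, of z], of "\<kappa>\<^sup>2"]
    by (intro B.E_mono) auto
  also have "\<dots> = (\<kappa> * norm z)\<^sup>2 *\<^sub>R 1" by (simp add: B.E_scaleR B.E_one power_mult_distrib)
  finally show "(t z)\<^sup>\<star> * t z \<preceq> (\<kappa> * norm z)\<^sup>2 *\<^sub>R 1" .
qed (use kappa in simp)

lemma T_norm2: "norm (T x) \<le> 2 * norm x"
  using norm_triangle_ineq4[of x "E x"] B.E_norm[of x] by (simp add: T_def)

lemma bounded_linear_E: "bounded_linear E"
  by (rule bounded_linear_intro[where K = 1]) (auto simp: B.E_add B.E_scaleR B.E_norm)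

end

subsection \<open>The intertwining unitary\<close>

text \<open>For \<open>g = isqrt x\<close> one has \<open>g * g - 1 = g * g * (1 - x)\<close>, which
  first bounds \<open>g * g\<close> by 2 and then \<open>g * g - 1\<close> by \<open>2 * s\<close>;
  \<open>norm_minus_one_le_square\<close> passes to \<open>g\<close>.\<close>

lemma near_one:
  fixes x :: "'a::cstar_algebra_1"
  assumes "x\<^sup>\<star> = x" "norm (x - 1) \<le> s" "s \<le> 1/2"
  shows "(1/2) *\<^sub>R 1 \<preceq> x" and "norm (isqrt x - 1) \<le> 2 * s"
proof -
  have "1 - x \<preceq> norm (1 - x) *\<^sub>R 1" by (rule cle_norm) (simp add: star_diff assms)
  also have "norm (1 - x) *\<^sub>R 1 \<preceq> (1/2) *\<^sub>R 1"
    using assms by (intro cle_scaleR_one) (simp add: norm_minus_commute)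
  finally have "pos ((1/2) *\<^sub>R 1 - (1 - x))" by (simp add: cle_def)
  moreover have "(1/2) *\<^sub>R 1 - (1 - x) = x - (1/2) *\<^sub>R (1::'a)"
    using scaleR_add_left[of "1/2" "1/2" "1::'a"] by (simp add: algebra_simps)
  ultimately show le: "(1/2) *\<^sub>R 1 \<preceq> x" by (simp add: cle_def)
  have half: "(0::real) < 1/2" by simp
  define g where "g = isqrt x"
  have g: "pos g" "g * g * x = 1" unfolding g_def by (rule pos_isqrt[OF half le], rule isqrt_square_mult[OF half le])
  have "g * g - 1 = g * g * (1 - x)" using g(2) by (simp add: algebra_simps)
  then have "norm (g * g - 1) \<le> norm (g * g) * norm (1 - x)" by (simp add: norm_mult_ineq)
  also have "\<dots> \<le> norm (g * g) * s" using assms by (intro mult_left_mono) (auto simp: norm_minus_commute)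
  finally have 1: "norm (g * g - 1) \<le> norm (g * g) * s" .
  also have "\<dots> \<le> norm (g * g) * (1/2)" using assms by (intro mult_left_mono) auto
  finally have "norm (g * g) \<le> 2" using norm_triangle_ineq[of "g * g - 1" 1] by simp
  moreover have "s \<ge> 0" using assms(2) norm_ge_zero order_trans by blast
  ultimately have "norm (g * g) * s \<le> 2 * s" by (intro mult_right_mono)
  then show "norm (isqrt x - 1) \<le> 2 * s"
    using norm_minus_one_le_square[OF g(1)] 1 unfolding g_def by linarith
qed

lemma norm_star_mult_minus_one:
  fixes x :: "'a::cstar_algebra_1"
  assumes "norm (x - 1) \<le> s" "s \<le> 1"
  shows "norm (x\<^sup>\<star> * x - 1) \<le> 3 * s"
proof -
  have "x\<^sup>\<star> * x - 1 = (x - 1)\<^sup>\<star> * (x - 1) + (x - 1)\<^sup>\<star> + (x - 1)"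
    by (simp add: star_diff algebra_simps)
  then have "norm (x\<^sup>\<star> * x - 1) \<le> norm ((x - 1)\<^sup>\<star> * (x - 1)) + norm ((x - 1)\<^sup>\<star>) + norm (x - 1)"
    by (metis norm_triangle_mono norm_triangle_ineq order_refl)
  also have "\<dots> = norm (x - 1) * norm (x - 1) + 2 * norm (x - 1)"
    by (simp only: norm_star_mult_self norm_star) (simp add: power2_eq_square)
  also have "norm (x - 1) * norm (x - 1) \<le> 1 * norm (x - 1)" using assms by (intro mult_right_mono) auto
  finally show ?thesis using assms by simp
qed

section \<open>The eigenvector of \<open>t\<close> as a fixed point\<close>

context very_close_pair
begin

text \<open>For \<eta> = 1 + z with \<open>E z = 0\<close>, applying \<open>E\<close> to
  \<open>t \<eta> = \<eta> * \<beta>\<close> forces \<open>\<beta> = E (t \<eta>)\<close>. What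
  remains is \<open>T (t \<eta>) = z * \<beta>\<close>, and its solutions are the fixed points of
  this map.\<close>

definition fix_map :: "'a \<Rightarrow> 'a" where
  "fix_map z = T (t (1 + z)) - z * (E (t (1 + z)) - 1)"

definition fix_domain :: "'a set" where
  "fix_domain = {z. E z = 0 \<and> norm z \<le> 3 * \<kappa>}"

lemma kappa_mult: "\<kappa> * \<kappa> \<le> \<kappa> * (1/100)"
  using kappa by (intro mult_left_mono) auto

lemma multiplier_near_one:
  assumes "z \<in> fix_domain"
  shows "norm (E (t (1 + z)) - 1) \<le> 2 * \<kappa>"
proof -
  have z: "E z = 0" "norm z \<le> 3 * \<kappa>" using assms by (auto simp: fix_domain_def)
  have "E (t (1 + z)) - 1 = E ((t 1 - 1) + t z)" by (simp add: t_add B.E_add B.E_diff B.E_one)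
  then have "norm (E (t (1 + z)) - 1) \<le> norm ((t 1 - 1) + t z)" by (simp add: B.E_norm)
  also have "\<dots> \<le> norm (t 1 - 1) + norm (t z)" by (rule norm_triangle_ineq)
  also have "\<dots> \<le> \<kappa> + \<kappa> * (3 * \<kappa>)"
    using t_one t_kernel[OF z(1)] mult_left_mono[OF z(2) kappa(1)] by linarith
  also have "\<dots> \<le> 2 * \<kappa>" using kappa_mult kappa by linarith
  finally show ?thesis .
qed

lemma fix_map_into:
  assumes "z \<in> fix_domain"
  shows "fix_map z \<in> fix_domain"
proof -
  have z: "E z = 0" "norm z \<le> 3 * \<kappa>" using assms by (auto simp: fix_domain_def)
  let ?\<beta> = "E (t (1 + z))"
  have "E (z * (?\<beta> - 1)) = E z * (?\<beta> - 1)"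
    by (rule B.E_right) (simp_all add: subspace_diff[OF B.subspace_C] B.E_in B.one_C)
  then have 1: "E (fix_map z) = 0" by (simp add: fix_map_def B.E_diff E_T z)
  \<comment> \<open>\<open>T\<close> kills 1, so \<open>t 1\<close> may be replaced by the small
    \<open>t 1 - 1\<close>.\<close>
  have "T (t (1 + z)) = T ((t 1 - 1) + t z)" by (simp add: T_add T_diff t_add) (simp add: T_def B.E_one)
  then have "norm (T (t (1 + z))) \<le> 2 * norm ((t 1 - 1) + t z)" using T_norm2 by metis
  also have "\<dots> \<le> 2 * (norm (t 1 - 1) + norm (t z))" using norm_triangle_ineq by (intro mult_left_mono) auto
  also have "\<dots> \<le> 2 * (\<kappa> + \<kappa> * (3 * \<kappa>))"
  proof (intro mult_left_mono)
    show "norm (t 1 - 1) + norm (t z) \<le> \<kappa> + \<kappa> * (3 * \<kappa>)"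
      using t_one t_kernel[OF z(1)] mult_left_mono[OF z(2) kappa(1)] by linarith
  qed simp
  finally have "norm (T (t (1 + z))) \<le> 2 * (\<kappa> + \<kappa> * (3 * \<kappa>))" .
  moreover have "norm (z * (?\<beta> - 1)) \<le> (3 * \<kappa>) * (2 * \<kappa>)"
    using norm_mult_ineq[of z "?\<beta> - 1"] mult_mono[OF z(2) multiplier_near_one[OF assms]] kappa by simp
  ultimately have "norm (fix_map z) \<le> 2 * (\<kappa> + \<kappa> * (3 * \<kappa>)) + (3 * \<kappa>) * (2 * \<kappa>)"
    unfolding fix_map_def using norm_triangle_ineq4[of "T (t (1 + z))" "z * (?\<beta> - 1)"] by linarith
  also have "\<dots> \<le> 3 * \<kappa>" using kappa_mult kappa by (simp add: algebra_simps)
  finally show ?thesis using 1 by (simp add: fix_domain_def)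
qed

text \<open>In the difference \<open>t\<close> acts only on \<open>x - y\<close>, which lies in the
  kernel of \<open>E\<close>, or occurs in the multiplier, which is near 1. Each term therefore
  carries a factor \<kappa>.\<close>

lemma fix_map_contraction:
  assumes x: "x \<in> fix_domain" and y: "y \<in> fix_domain"
  shows "dist (fix_map x) (fix_map y) \<le> 1/2 * dist x y"
proof -
  let ?\<beta> = "\<lambda>z. E (t (1 + z))"
  have xy: "E (x - y) = 0" "norm y \<le> 3 * \<kappa>" using x y by (auto simp: fix_domain_def B.E_diff)
  have \<beta>: "?\<beta> x - ?\<beta> y = E (t (x - y))" by (simp add: B.E_diff[symmetric] t_diff[symmetric])
  have "fix_map x - fix_map y = T (t (x - y)) - (x - y) * (?\<beta> x - 1) - y * (?\<beta> x - ?\<beta> y)"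
  proof -
    have "T (t (x - y)) = T (t (1 + x)) - T (t (1 + y))" by (simp add: T_diff[symmetric] t_diff[symmetric])
    then show ?thesis by (simp add: fix_map_def algebra_simps)
  qed
  then have "norm (fix_map x - fix_map y)
      \<le> norm (T (t (x - y))) + norm ((x - y) * (?\<beta> x - 1)) + norm (y * E (t (x - y)))"
    unfolding \<beta> by (smt (verit) norm_triangle_ineq4)
  also have "\<dots> \<le> 2 * (\<kappa> * norm (x - y)) + norm (x - y) * (2 * \<kappa>) + (3 * \<kappa>) * (\<kappa> * norm (x - y))"
  proof (intro add_mono)
    show "norm (T (t (x - y))) \<le> 2 * (\<kappa> * norm (x - y))"
      using T_norm2[of "t (x - y)"] t_kernel[OF xy(1)] by linarith
    show "norm ((x - y) * (?\<beta> x - 1)) \<le> norm (x - y) * (2 * \<kappa>)"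
      using norm_mult_ineq[of "x - y" "?\<beta> x - 1"] mult_left_mono[OF multiplier_near_one[OF x], of "norm (x - y)"]
      by simp
    have "norm (E (t (x - y))) \<le> \<kappa> * norm (x - y)"
      using B.E_norm[of "t (x - y)"] t_kernel[OF xy(1)] by simp
    from mult_mono[OF xy(2) this]
    show "norm (y * E (t (x - y))) \<le> (3 * \<kappa>) * (\<kappa> * norm (x - y))"
      using norm_mult_ineq[of y "E (t (x - y))"] kappa by simp
  qed
  also have "\<dots> = (4 * \<kappa> + 3 * (\<kappa> * \<kappa>)) * norm (x - y)" by (simp add: algebra_simps)
  also have "\<dots> \<le> 1/2 * norm (x - y)"
    using kappa_mult kappa by (intro mult_right_mono) auto
  finally show ?thesis by (simp add: dist_norm)
qed

text \<open>The eigenvector equation \<open>t \<eta> = \<eta> \<beta>\<close> with \<open>\<beta> \<in> B\<close> says that \<open>\<eta> B\<close> is the range of the spectral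
  projection of \<open>t\<close> close to \<open>E\<close>; as \<open>t\<close> commutes with \<open>A\<close>, this range is invariant under \<open>A\<close>.\<close>

lemma intertwiner:
  obtains \<eta> where "E \<eta> = 1" "norm (\<eta> - 1) \<le> 3 * \<kappa>" "\<And>a. a \<in> A \<Longrightarrow> a * \<eta> = \<eta> * E (a * \<eta>)"
proof -
  have "closed (E -` {0})"
    by (intro closed_vimage linear_continuous_on bounded_linear_E closed_singleton continuous_at_imp_continuous_on)
       (auto intro: linear_continuous_at bounded_linear_E)
  moreover have "fix_domain = E -` {0} \<inter> cball 0 (3 * \<kappa>)" by (auto simp: fix_domain_def)
  ultimately have "complete fix_domain" by (simp add: complete_eq_closed closed_Int)
  moreover have "0 \<in> fix_domain" using kappa by (simp add: fix_domain_def B.E_zero)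
  ultimately have "\<exists>!z\<in>fix_domain. fix_map z = z"
    by (intro Banach_fix[where c = "1/2"]) (auto intro: fix_map_into fix_map_contraction[simplified])
  then obtain z where z: "z \<in> fix_domain" "fix_map z = z" by blast
  define \<eta> where "\<eta> = 1 + z"
  define \<beta> where "\<beta> = E (t \<eta>)"
  have Ez: "E z = 0" and nz: "norm z \<le> 3 * \<kappa>" using z by (auto simp: fix_domain_def)
  have \<beta>B: "\<beta> \<in> B" by (simp add: \<beta>_def B.E_in)
  have E\<eta>: "E \<eta> = 1" by (simp add: \<eta>_def B.E_add B.E_one Ez)
  have n\<beta>: "norm (1 - \<beta>) \<le> 2 * \<kappa>"
    using multiplier_near_one[OF z(1)] by (simp add: \<beta>_def \<eta>_def norm_minus_commute)
  have n\<eta>: "norm \<eta> \<le> 2" using norm_triangle_ineq[of 1 z] nz kappa by (simp add: \<eta>_def)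
  have "t \<eta> - \<beta> - z * (\<beta> - 1) = z" using z(2) by (simp add: fix_map_def \<beta>_def \<eta>_def T_def)
  then have t\<eta>: "t \<eta> = \<eta> * \<beta>" by (simp add: \<eta>_def algebra_simps)
  have "a * \<eta> = \<eta> * E (a * \<eta>)" if a: "a \<in> A" for a
  proof -
    define e where "e = E (a * \<eta>)"
    have eB: "e \<in> B" by (simp add: e_def B.E_in)
    define y where "y = a * \<eta> - \<eta> * e"
    have Ey: "E y = 0" by (simp add: y_def B.E_diff B.E_right eB E\<eta>) (simp add: e_def)
    \<comment> \<open>As \<open>t\<close> commutes with \<open>a\<close>, the defect
      \<open>y\<close> satisfies the eigenvector equation up to an element of
      \<open>\<eta> B\<close>. Applying \<open>E\<close> identifies its coefficient as
      \<open>E (t y)\<close>, and the estimates then give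
      \<open>norm y \<le> 5 * \<kappa> * norm y\<close>, so \<open>y = 0\<close>.\<close>
    have ty: "t y - y * \<beta> = \<eta> * (e * \<beta> - \<beta> * e)"
      by (simp add: y_def t_diff t_left a t_right eB t\<eta> algebra_simps)
    have "E (t y) = E (\<eta> * (e * \<beta> - \<beta> * e) + y * \<beta>)" by (simp flip: ty)
    also have "\<dots> = e * \<beta> - \<beta> * e"
      by (simp add: B.E_add B.E_right B.C_mult \<beta>B eB subspace_diff[OF B.subspace_C] E\<eta> Ey)
    finally have "t y - y * \<beta> = \<eta> * E (t y)" using ty by (simp only:)
    then have y: "y = y * (1 - \<beta>) + (t y - \<eta> * E (t y))" by (simp add: algebra_simps)
    have tn: "norm (t y) \<le> \<kappa> * norm y" by (rule t_kernel[OF Ey])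
    have "norm (E (t y)) \<le> \<kappa> * norm y" using B.E_norm[of "t y"] tn by simp
    then have "norm (\<eta> * E (t y)) \<le> 2 * (\<kappa> * norm y)"
      using norm_mult_ineq[of \<eta> "E (t y)"] mult_mono[OF n\<eta>, of "norm (E (t y))" "\<kappa> * norm y"] by simp
    moreover have "norm (y * (1 - \<beta>)) \<le> norm y * (2 * \<kappa>)"
      using norm_mult_ineq[of y "1 - \<beta>"] mult_left_mono[OF n\<beta>, of "norm y"] by simp
    moreover have "norm y \<le> norm (y * (1 - \<beta>)) + (norm (t y) + norm (\<eta> * E (t y)))"
      using norm_triangle_ineq[of "y * (1 - \<beta>)" "t y - \<eta> * E (t y)"]
        norm_triangle_ineq4[of "t y" "\<eta> * E (t y)"] arg_cong[OF y, of norm] by linarith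
    ultimately have "norm y \<le> (5 * \<kappa>) * norm y" using tn by (simp add: algebra_simps)
    also have "\<dots> \<le> (1/2) * norm y" using kappa by (intro mult_right_mono) auto
    finally have "y = 0" by simp
    then show ?thesis by (simp add: y_def e_def)
  qed
  then show thesis using that[of \<eta>] E\<eta> nz by (simp add: \<eta>_def)
qed

section \<open>From the eigenvector to a unitary\<close>

definition \<rho> :: real where
  "\<rho> = 3 * \<kappa>"

lemma rho: "0 \<le> \<rho>" "\<rho> \<le> 12 / 10 ^ 5"
  using kappa by (auto simp: \<rho>_def)

text \<open>The coefficient \<open>E (a * \<eta>)\<close> is not visibly compatible with the
  involution. Multiplying \<eta> by the inverse root of
  \<open>h = E (\<eta>\<^sup>\<star> * \<eta>)\<close>, an element of \<open>B\<close>, turns it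
  into \<open>E (\<xi>\<^sup>\<star> * a * \<xi>)\<close>, which is.\<close>

lemma star_intertwiner:
  obtains \<xi> where "norm (\<xi> - 1) \<le> 8 * \<rho>" "\<And>c. c \<in> C \<Longrightarrow> c * \<xi> = \<xi> * c"
    "\<And>a. a \<in> A \<Longrightarrow> a * \<xi> = \<xi> * E (\<xi>\<^sup>\<star> * a * \<xi>)"
proof -
  obtain \<eta> where E\<eta>: "E \<eta> = 1" and n\<eta>: "norm (\<eta> - 1) \<le> \<rho>"
    and \<eta>: "\<And>a. a \<in> A \<Longrightarrow> a * \<eta> = \<eta> * E (a * \<eta>)"
    using intertwiner unfolding \<rho>_def by blast
  have cB: "c \<in> B" if "c \<in> C" for c using that C_sub_B by auto
  have c\<eta>: "c * \<eta> = \<eta> * c" if c: "c \<in> C" for c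
    using \<eta>[OF C_subset[OF c]] B.E_left[OF cB[OF c], of \<eta>] by (simp add: E\<eta>)
  have c\<eta>': "\<eta>\<^sup>\<star> * c = c * \<eta>\<^sup>\<star>" if c: "c \<in> C" for c
    using arg_cong[OF c\<eta>[OF C_star[OF c]], of star] by (simp add: star_mult star_star)
  define h where "h = E (\<eta>\<^sup>\<star> * \<eta>)"
  have hB: "h \<in> B" by (simp add: h_def B.E_in)
  have hs: "h\<^sup>\<star> = h" by (simp add: h_def star_mult star_star flip: B.E_star)
  have "h - 1 = E (\<eta>\<^sup>\<star> * \<eta> - 1)" by (simp add: h_def B.E_diff B.E_one)
  then have "norm (h - 1) \<le> norm (\<eta>\<^sup>\<star> * \<eta> - 1)" using B.E_norm[of "\<eta>\<^sup>\<star> * \<eta> - 1"] by simp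
  also have "\<dots> \<le> 3 * \<rho>" using rho by (intro norm_star_mult_minus_one n\<eta>) auto
  finally have nh: "norm (h - 1) \<le> 3 * \<rho>" .
  have "3 * \<rho> \<le> 1/2" using rho by simp
  note h = near_one[OF hs nh this]
  have half: "(0::real) < 1/2" by simp
  define g where "g = isqrt h"
  have gs: "g\<^sup>\<star> = g" unfolding g_def by (rule pos_star[OF pos_isqrt[OF half h(1)]])
  have ggh: "g * g * h = 1" unfolding g_def by (rule isqrt_square_mult[OF half h(1)])
  have gB: "g \<in> B"
    unfolding g_def by (rule isqrt_in[OF half h(1) cstar_subalgebra_real_subalgebra[OF B.subalg_C B.one_C] hB])
  have ng: "norm (g - 1) \<le> 6 * \<rho>" using h(2) by (simp add: g_def)
  define \<xi> where "\<xi> = \<eta> * g"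
  have "\<xi> - 1 = (\<eta> - 1) * (g - 1) + (\<eta> - 1) + (g - 1)" by (simp add: \<xi>_def algebra_simps)
  then have "norm (\<xi> - 1) \<le> norm ((\<eta> - 1) * (g - 1)) + norm (\<eta> - 1) + norm (g - 1)"
    by (metis norm_triangle_mono norm_triangle_ineq order_refl)
  moreover have "norm ((\<eta> - 1) * (g - 1)) \<le> \<rho> * (6 * \<rho>)"
    using norm_mult_ineq[of "\<eta> - 1" "g - 1"] mult_mono[OF n\<eta> ng] rho by simp
  moreover have "\<rho> * (6 * \<rho>) \<le> \<rho> * 1" using rho by (intro mult_left_mono) auto
  ultimately have n\<xi>: "norm (\<xi> - 1) \<le> 8 * \<rho>" using n\<eta> ng by linarith
  have c\<xi>: "c * \<xi> = \<xi> * c" if c: "c \<in> C" for c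
  proof -
    have "c * h = E (c * (\<eta>\<^sup>\<star> * \<eta>))" by (simp add: h_def B.E_left cB[OF c])
    also have "c * (\<eta>\<^sup>\<star> * \<eta>) = (\<eta>\<^sup>\<star> * \<eta>) * c"
      by (metis c\<eta>[OF c] c\<eta>'[OF c] mult.assoc)
    also have "E ((\<eta>\<^sup>\<star> * \<eta>) * c) = h * c" unfolding h_def by (rule B.E_right) (use cB[OF c] in auto)
    finally have "c * g = g * c" unfolding g_def by (rule isqrt_commute[OF half h(1)])
    then show ?thesis unfolding \<xi>_def by (metis c\<eta>[OF c] mult.assoc)
  qed
  have "a * \<xi> = \<xi> * E (\<xi>\<^sup>\<star> * a * \<xi>)" if a: "a \<in> A" for a
  proof -
    have "\<xi>\<^sup>\<star> * a * \<xi> = g * (\<eta>\<^sup>\<star> * (a * \<eta>)) * g" by (simp add: \<xi>_def star_mult gs mult.assoc)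
    also have "\<dots> = g * (\<eta>\<^sup>\<star> * \<eta> * E (a * \<eta>)) * g" by (subst \<eta>[OF a]) (simp only: mult.assoc)
    finally have "E (\<xi>\<^sup>\<star> * a * \<xi>) = g * E (\<eta>\<^sup>\<star> * \<eta> * E (a * \<eta>)) * g"
      using B.E_bimod[OF gB UNIV_I gB] by (simp only:)
    moreover have "E (\<eta>\<^sup>\<star> * \<eta> * E (a * \<eta>)) = h * E (a * \<eta>)"
      unfolding h_def by (rule B.E_right) (simp_all add: B.E_in)
    ultimately have "E (\<xi>\<^sup>\<star> * a * \<xi>) = g * (h * E (a * \<eta>)) * g" by (simp only:)
    then have "\<xi> * E (\<xi>\<^sup>\<star> * a * \<xi>) = \<eta> * (g * g * h) * E (a * \<eta>) * g" by (simp add: \<xi>_def mult.assoc)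
    also have "\<dots> = a * \<xi>" by (simp add: ggh \<xi>_def \<eta>[OF a, symmetric] mult.assoc[symmetric])
    finally show ?thesis ..
  qed
  with n\<xi> c\<xi> show thesis by (rule that)
qed

text \<open>Multiplying the intertwining relation by \<open>\<xi>\<^sup>\<star>\<close> gives
  \<open>\<xi>\<^sup>\<star> * a * \<xi> = k * \<Psi> a\<close>. Comparing with the adjoint of the
  relation for \<open>a\<^sup>\<star>\<close> shows that \<open>k\<close> commutes with
  \<open>\<Psi> a\<close>, so the polar part \<open>U\<close> of \<xi> still intertwines
  \<open>a\<close> with \<open>\<Psi> a\<close>.\<close>

lemma unitary_intertwiner:
  obtains U where "norm (U - 1) \<le> 64 * \<rho>" "U\<^sup>\<star> * U = 1" "U * U\<^sup>\<star> = 1"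
    "\<And>c. c \<in> C \<Longrightarrow> c * U = U * c" "\<And>a. a \<in> A \<Longrightarrow> U\<^sup>\<star> * a * U \<in> B"
proof -
  obtain \<xi> where n\<xi>: "norm (\<xi> - 1) \<le> 8 * \<rho>" and c\<xi>: "\<And>c. c \<in> C \<Longrightarrow> c * \<xi> = \<xi> * c"
    and \<xi>: "\<And>a. a \<in> A \<Longrightarrow> a * \<xi> = \<xi> * E (\<xi>\<^sup>\<star> * a * \<xi>)"
    by (rule star_intertwiner, rule that)
  define \<Psi> where "\<Psi> a = E (\<xi>\<^sup>\<star> * a * \<xi>)" for a
  have \<Psi>s: "\<Psi> (a\<^sup>\<star>) = (\<Psi> a)\<^sup>\<star>" for a
    by (simp add: \<Psi>_def star_mult star_star mult.assoc flip: B.E_star)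
  define k where "k = \<xi>\<^sup>\<star> * \<xi>"
  have ks: "k\<^sup>\<star> = k" by (simp add: k_def star_mult star_star)
  have "norm (k - 1) \<le> 3 * (8 * \<rho>)" unfolding k_def using rho by (intro norm_star_mult_minus_one n\<xi>) auto
  then have nk: "norm (k - 1) \<le> 24 * \<rho>" by simp
  have "24 * \<rho> \<le> 1/2" using rho by simp
  note k = near_one[OF ks nk this]
  have half: "(0::real) < 1/2" by simp
  define m where "m = isqrt k"
  have ms: "m\<^sup>\<star> = m" unfolding m_def by (rule pos_star[OF pos_isqrt[OF half k(1)]])
  have mkm: "m * k * m = 1" unfolding m_def by (rule isqrt_conj[OF half k(1)])
  have nm: "norm (m - 1) \<le> 48 * \<rho>" using k(2) by (simp add: m_def)
  define U where "U = \<xi> * m"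
  have "U - 1 = (\<xi> - 1) * (m - 1) + (\<xi> - 1) + (m - 1)" by (simp add: U_def algebra_simps)
  then have "norm (U - 1) \<le> norm ((\<xi> - 1) * (m - 1)) + norm (\<xi> - 1) + norm (m - 1)"
    by (metis norm_triangle_mono norm_triangle_ineq order_refl)
  moreover have "norm ((\<xi> - 1) * (m - 1)) \<le> (8 * \<rho>) * (48 * \<rho>)"
    using norm_mult_ineq[of "\<xi> - 1" "m - 1"] mult_mono[OF n\<xi> nm] rho by simp
  moreover have "(8 * \<rho>) * (48 * \<rho>) \<le> (8 * \<rho>) * 1" using rho by (intro mult_left_mono) auto
  ultimately have nU: "norm (U - 1) \<le> 64 * \<rho>" using n\<xi> nm by linarith
  have "U\<^sup>\<star> * U = m * k * m" by (simp add: U_def k_def star_mult ms mult.assoc)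
  then have UU: "U\<^sup>\<star> * U = 1" by (simp add: mkm)
  \<comment> \<open>An isometry this close to 1 is invertible, hence unitary.\<close>
  have "norm (1 - U) < 1" using nU rho by (simp add: norm_minus_commute)
  from neumann_right[OF this] have inv: "U * neumann (1 - U) = 1" by simp
  then have "U\<^sup>\<star> = neumann (1 - U)" by (metis UU mult.assoc mult.left_neutral mult.right_neutral)
  then have UU': "U * U\<^sup>\<star> = 1" using inv by simp
  have \<Psi>k: "\<Psi> a * k = k * \<Psi> a" if a: "a \<in> A" for a
  proof -
    have 1: "\<xi>\<^sup>\<star> * (b * \<xi>) = k * \<Psi> b" if "b \<in> A" for b
      by (subst \<xi>[OF that]) (simp only: k_def \<Psi>_def mult.assoc)
    have "\<Psi> a * k = (k * \<Psi> (a\<^sup>\<star>))\<^sup>\<star>" by (simp add: star_mult ks \<Psi>s star_star)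
    also have "\<dots> = \<xi>\<^sup>\<star> * (a * \<xi>)"
      by (simp add: star_mult star_star mult.assoc flip: 1[OF A_star[OF a]])
    also have "\<dots> = k * \<Psi> a" by (rule 1[OF a])
    finally show ?thesis .
  qed
  have conj: "U\<^sup>\<star> * a * U \<in> B" if a: "a \<in> A" for a
  proof -
    have "\<Psi> a * m = m * \<Psi> a" unfolding m_def by (rule isqrt_commute[OF half k(1) \<Psi>k[OF a]])
    then have "a * U = U * \<Psi> a"
      unfolding U_def by (metis \<xi>[OF a] \<Psi>_def mult.assoc)
    then have "U\<^sup>\<star> * a * U = \<Psi> a" by (metis UU mult.assoc mult.left_neutral)
    then show ?thesis by (simp add: \<Psi>_def B.E_in)
  qed
  have cU: "c * U = U * c" if c: "c \<in> C" for c
  proof -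
    have c': "c * \<xi>\<^sup>\<star> = \<xi>\<^sup>\<star> * c"
      using arg_cong[OF c\<xi>[OF C_star[OF c]], of star] by (simp add: star_mult star_star)
    have "c * k = k * c" unfolding k_def by (metis c\<xi>[OF c] c' mult.assoc)
    then have "c * m = m * c" unfolding m_def by (rule isqrt_commute[OF half k(1)])
    then show ?thesis unfolding U_def by (metis c\<xi>[OF c] mult.assoc)
  qed
  from nU UU UU' cU conj show thesis by (rule that)
qed

text \<open>Every element of \<open>B\<close> is within half its norm of the conjugate of
  \<open>A\<close>, by \<open>B_near_A\<close> and the closeness of \<open>U\<close> to 1.
  Correcting an approximant by an approximant of the error halves the distance to \<open>A\<close>,
  which is therefore zero, and \<open>A\<close> is closed.\<close>

lemma unitary_conjugation_onto:
  assumes nU: "norm (U - 1) \<le> 64 * \<rho>" and UU: "U\<^sup>\<star> * U = 1" "U * U\<^sup>\<star> = 1"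
    and into: "\<And>a. a \<in> A \<Longrightarrow> U\<^sup>\<star> * a * U \<in> B" and b: "b \<in> B"
  shows "U * b * U\<^sup>\<star> \<in> A"
proof -
  have U1: "norm U \<le> 1" using norm_star_mult_self[of U] UU by (auto simp: power2_eq_1_iff)
  have conj_norm: "norm (y * x * z) \<le> norm x" if "norm y \<le> 1" "norm z \<le> 1" for x y z :: 'a
  proof -
    have "norm (y * x * z) \<le> norm y * norm x * norm z"
      by (metis norm_mult_ineq mult_right_mono norm_ge_zero order_trans)
    also have "\<dots> \<le> 1 * norm x * 1" using that by (intro mult_mono) auto
    finally show ?thesis by simp
  qed
  have near: "\<exists>a\<in>A. norm (U\<^sup>\<star> * a * U - y) \<le> norm y / 2" if y: "y \<in> B" for y
  proof -
    obtain a where a: "a \<in> A" "norm (a - y) \<le> norm y / 4" using B_near_A[OF y] by blast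
    have na: "norm a \<le> 2 * norm y" using norm_triangle_ineq2[of a y] a(2) norm_ge_zero[of y] by linarith
    have "U\<^sup>\<star> * a * U - a = U\<^sup>\<star> * (a * (U - 1) - (U - 1) * a)"
      by (simp add: algebra_simps UU flip: mult.assoc)
    then have "norm (U\<^sup>\<star> * a * U - a) \<le> norm (U\<^sup>\<star>) * norm (a * (U - 1) - (U - 1) * a)"
      by (simp only: norm_mult_ineq)
    also have "\<dots> \<le> 1 * (norm a * norm (U - 1) + norm (U - 1) * norm a)"
    proof (rule mult_mono)
      show "norm (a * (U - 1) - (U - 1) * a) \<le> norm a * norm (U - 1) + norm (U - 1) * norm a"
        using norm_triangle_ineq4[of "a * (U - 1)" "(U - 1) * a"] norm_mult_ineq[of a "U - 1"]
          norm_mult_ineq[of "U - 1" a] by linarith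
    qed (use U1 in auto)
    also have "\<dots> = 2 * (norm (U - 1) * norm a)" by simp
    also have "\<dots> \<le> 2 * ((1/100) * (2 * norm y))"
      using nU rho na by (intro mult_left_mono mult_mono) auto
    finally have "norm (U\<^sup>\<star> * a * U - y) \<le> 2 * ((1/100) * (2 * norm y)) + norm y / 4"
      using a(2) norm_triangle_ineq[of "U\<^sup>\<star> * a * U - a" "a - y"] by simp
    also have "\<dots> \<le> norm y / 2" by simp
    finally show ?thesis using a(1) by blast
  qed
  define x where "x = U * b * U\<^sup>\<star>"
  have A0: "A \<noteq> {}" using one_A by blast
  have half: "2 * infdist x A \<le> norm (x - a)" if a: "a \<in> A" for a
  proof -
    have bB: "b - U\<^sup>\<star> * a * U \<in> B" by (intro subspace_diff[OF B.subspace_C] b into a)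
    obtain a' where a': "a' \<in> A" "norm (U\<^sup>\<star> * a' * U - (b - U\<^sup>\<star> * a * U)) \<le> norm (b - U\<^sup>\<star> * a * U) / 2"
      using near[OF bB] by blast
    have cancel: "U\<^sup>\<star> * (U * c) = c" "U * (U\<^sup>\<star> * c) = c" for c
      by (simp_all add: UU flip: mult.assoc)
    have "(a' + a) - x = U * (U\<^sup>\<star> * a' * U - (b - U\<^sup>\<star> * a * U)) * U\<^sup>\<star>"
      by (simp add: x_def algebra_simps UU cancel)
    then have 1: "norm ((a' + a) - x) \<le> norm (U\<^sup>\<star> * a' * U - (b - U\<^sup>\<star> * a * U))"
      using conj_norm[of U "U\<^sup>\<star>"] U1 by simp
    have "b - U\<^sup>\<star> * a * U = U\<^sup>\<star> * (x - a) * U"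
      by (simp add: x_def algebra_simps UU cancel)
    then have "norm (b - U\<^sup>\<star> * a * U) \<le> norm (x - a)"
      using conj_norm[of "U\<^sup>\<star>" U] U1 by simp
    with 1 a'(2) have "norm ((a' + a) - x) \<le> norm (x - a) / 2" by linarith
    moreover have "infdist x A \<le> dist x (a' + a)" by (rule infdist_le) (intro A_add a' a)
    ultimately show ?thesis by (simp add: dist_norm norm_minus_commute)
  qed
  have "2 * infdist x A \<le> infdist x A"
    unfolding infdist_notempty[OF A0] using half A0
    by (intro cINF_greatest) (auto simp: dist_norm infdist_notempty)
  then have "infdist x A = 0" using infdist_nonneg[of x A] by simp
  moreover have "closed A" using subalg_A by (simp add: cstar_subalgebra_def)
  ultimately show ?thesis using in_closed_iff_infdist_zero[OF _ A0] by (simp add: x_def)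
qed

theorem unitary_equivalence:
  "\<exists>u. unitary u \<and> u \<in> relative_commutant C UNIV \<and> (\<lambda>a. u * a * u\<^sup>\<star>) ` A = B \<and>
    norm (u - 1) \<le> 768 * \<tau>"
proof -
  obtain U where nU: "norm (U - 1) \<le> 64 * \<rho>" and UU: "U\<^sup>\<star> * U = 1" "U * U\<^sup>\<star> = 1"
    and cU: "\<And>c. c \<in> C \<Longrightarrow> c * U = U * c" and into: "\<And>a. a \<in> A \<Longrightarrow> U\<^sup>\<star> * a * U \<in> B"
    by (rule unitary_intertwiner, rule that)
  have "unitary (U\<^sup>\<star>)" by (simp add: unitary_def star_star UU)
  moreover have "U\<^sup>\<star> \<in> relative_commutant C UNIV"
  proof -
    have "c * U\<^sup>\<star> = U\<^sup>\<star> * c" if c: "c \<in> C" for c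
      using arg_cong[OF cU[OF C_star[OF c]], of star] by (simp add: star_mult star_star)
    then show ?thesis by (simp add: relative_commutant_def)
  qed
  moreover have "(\<lambda>a. U\<^sup>\<star> * a * (U\<^sup>\<star>)\<^sup>\<star>) ` A = B"
  proof (intro equalityI subsetI)
    fix b assume b: "b \<in> B"
    have "b = U\<^sup>\<star> * (U * b * U\<^sup>\<star>) * (U\<^sup>\<star>)\<^sup>\<star>"
    proof -
      have "U\<^sup>\<star> * (U * b * U\<^sup>\<star>) * U = (U\<^sup>\<star> * U) * b * (U\<^sup>\<star> * U)" by (simp only: mult.assoc)
      then show ?thesis by (simp add: star_star UU)
    qed
    then show "b \<in> (\<lambda>a. U\<^sup>\<star> * a * (U\<^sup>\<star>)\<^sup>\<star>) ` A"
      using unitary_conjugation_onto[OF nU UU into b] by blast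
  qed (auto simp: star_star into)
  \<comment> \<open>The constant is 64 * 3 * 4, from \<open>\<rho> = 3 * \<kappa>\<close> and
    \<open>\<kappa> = 4 * \<tau>\<close>.\<close>
  moreover have "norm (U\<^sup>\<star> - 1) \<le> 768 * \<tau>"
    using nU norm_star[of "U - 1"] by (simp add: star_diff \<rho>_def \<kappa>_def)
  ultimately show ?thesis by blast
qed

end

subsection \<open>The Kadison--Kastler distance\<close>

lemma zero_in_unit_ball: "cstar_subalgebra X \<Longrightarrow> 0 \<in> unit_ball X"
  by (simp add: unit_ball_def cstar_subalgebra_def)

lemma INF_unit_ball_bounds:
  assumes "cstar_subalgebra X" "norm y \<le> 1"
  shows "(INF x\<in>unit_ball X. norm (x - y)) \<le> 1" "(INF x\<in>unit_ball X. norm (x - y)) \<ge> 0"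
proof -
  have "(INF x\<in>unit_ball X. norm (x - y)) \<le> norm (0 - y)"
    by (rule cINF_lower) (auto intro: bdd_belowI[of _ 0] zero_in_unit_ball assms)
  then show "(INF x\<in>unit_ball X. norm (x - y)) \<le> 1" using assms by simp
  show "(INF x\<in>unit_ball X. norm (x - y)) \<ge> 0"
    using zero_in_unit_ball[OF assms(1)] by (intro cINF_greatest) auto
qed

lemma kadison_kastler_commute: "kadison_kastler_dist X Y = kadison_kastler_dist Y X"
  unfolding kadison_kastler_dist_def by (subst max.commute) (simp add: norm_minus_commute)

lemma
  assumes X: "cstar_subalgebra X" and Y: "cstar_subalgebra Y"
  shows INF_le_kadison_kastler:
      "y \<in> unit_ball Y \<Longrightarrow> (INF x\<in>unit_ball X. norm (x - y)) \<le> kadison_kastler_dist X Y"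
    and kadison_kastler_nonneg: "kadison_kastler_dist X Y \<ge> 0"
proof -
  show le: "(INF x\<in>unit_ball X. norm (x - y)) \<le> kadison_kastler_dist X Y" if "y \<in> unit_ball Y" for y
  proof -
    have "(INF x\<in>unit_ball X. norm (x - y)) \<le> (SUP y\<in>unit_ball Y. INF x\<in>unit_ball X. norm (x - y))"
      using INF_unit_ball_bounds(1)[OF X]
      by (intro cSUP_upper that bdd_aboveI[of _ 1]) (auto simp: unit_ball_def)
    then show ?thesis unfolding kadison_kastler_dist_def by simp
  qed
  show "kadison_kastler_dist X Y \<ge> 0"
    using le[OF zero_in_unit_ball[OF Y]] INF_unit_ball_bounds(2)[OF X, of 0] by simp
qed

text \<open>The infimum need not be attained, so a strict bound on the distance is what provides an
  actual approximant; scaling extends it beyond the unit ball.\<close>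

lemma kadison_kastler_approx:
  assumes X: "cstar_subalgebra X" and Y: "cstar_subalgebra Y"
    and "kadison_kastler_dist X Y < \<gamma>" "y \<in> Y"
  obtains x where "x \<in> X" "norm (x - y) \<le> \<gamma> * norm y"
proof (cases "y = 0")
  case True
  then show thesis using that[of 0] X by (simp add: cstar_subalgebra_def)
next
  case False
  define y' where "y' = (1 / norm y) *\<^sub>R y"
  have "y' \<in> unit_ball Y"
    using False assms(4) cstar_subalgebra_scaleR[OF Y] by (simp add: y'_def unit_ball_def)
  from INF_le_kadison_kastler[OF X Y this] assms(3)
  have "(INF x\<in>unit_ball X. norm (x - y')) < \<gamma>" by simp
  then obtain x where x: "x \<in> unit_ball X" "norm (x - y') < \<gamma>"
    using cInf_lessD[of "(\<lambda>x. norm (x - y')) ` unit_ball X" \<gamma>] zero_in_unit_ball[OF X] by blast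
  have "norm y *\<^sub>R x - y = norm y *\<^sub>R (x - y')" using False by (simp add: y'_def scaleR_diff_right)
  moreover have "norm y * norm (x - y') \<le> norm y * \<gamma>" using x(2) by (intro mult_left_mono) auto
  ultimately have "norm (norm y *\<^sub>R x - y) \<le> \<gamma> * norm y" by (simp add: mult.commute)
  moreover have "norm y *\<^sub>R x \<in> X" using x(1) cstar_subalgebra_scaleR[OF X] by (simp add: unit_ball_def)
  ultimately show thesis using that by blast
qed

theorem theorem3p7:
  fixes A B C :: "'d::cstar_algebra_1 set"
    and E_BD E_CA :: "'d \<Rightarrow> 'd"
    and \<gamma> :: real
  assumes "cstar_subalgebra C" and "1 \<in> C"
    and "cstar_subalgebra B" and "C \<subseteq> B"
    and "conditional_expectation UNIV B E_BD" and "faithful_on UNIV E_BD"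
    and "cstar_subalgebra A" and "C \<subseteq> A"
    and "conditional_expectation A C E_CA" and "finite_index A E_CA"
    and "kadison_kastler_dist A B \<le> \<gamma>" and "\<gamma> < 1 / 10 ^ 6"
  shows "\<exists>u. unitary u \<and> u \<in> relative_commutant C UNIV \<and>
    (\<lambda>a. u * a * u\<^sup>\<star>) ` A = B \<and>
    norm (u - 1) \<le> 16 * sqrt 110 * sqrt \<gamma> + 880 * \<gamma>"
proof -
  have \<gamma>: "\<gamma> \<ge> 0" using kadison_kastler_nonneg[OF assms(7,3)] assms(11) by simp
  obtain n v where qb: "quasi_basis A E_CA n v" using assms(10) by (auto simp: finite_index_def)
  interpret B: cond_exp UNIV B E_BD
    by standard (use assms cstar_subalgebra_UNIV in auto)
  have "norm (x - E_BD x) \<le> 2 * \<gamma> * norm x" if x: "x \<in> A" for x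
  proof -
    \<comment> \<open>Since \<open>E_BD\<close> fixes \<open>b\<close>, the difference is
      \<open>E_BD (b - x) - (b - x)\<close>, whence the factor 2. The margin \<open>e\<close>
      provides the strict inequality for the distance and is then sent to zero.\<close>
    have "norm (x - E_BD x) \<le> 2 * (\<gamma> + e) * norm x" if e: "e > 0" for e
    proof -
      have "kadison_kastler_dist B A < \<gamma> + e" using assms(11) e kadison_kastler_commute[of A B] by simp
      then obtain b where b: "b \<in> B" "norm (b - x) \<le> (\<gamma> + e) * norm x"
        using kadison_kastler_approx[OF assms(3,7) _ x] by blast
      have "x - E_BD x = E_BD (b - x) - (b - x)" by (simp add: B.E_diff B.E_id[OF b(1)])
      then have "norm (x - E_BD x) \<le> norm (E_BD (b - x)) + norm (b - x)"
        by (metis norm_triangle_ineq4)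
      then show ?thesis using B.E_norm[of "b - x"] b(2) by (simp add: algebra_simps)
    qed
    then have "\<forall>\<^sub>F e in at_right 0. norm (x - E_BD x) \<le> 2 * (\<gamma> + e) * norm x"
      by (auto simp: eventually_at_right_field intro: exI[of _ 1])
    moreover have "((\<lambda>e. 2 * (\<gamma> + e) * norm x) \<longlongrightarrow> 2 * (\<gamma> + 0) * norm x) (at_right 0)"
      by (intro tendsto_intros)
    ultimately have "norm (x - E_BD x) \<le> 2 * (\<gamma> + 0) * norm x"
      by (intro tendsto_lowerbound) auto
    then show ?thesis by simp
  qed
  moreover have "\<exists>a\<in>A. norm (a - b) \<le> norm b / 4" if b: "b \<in> B" for b
  proof -
    have "kadison_kastler_dist A B < 1/4" using assms(11,12) by simp
    then show ?thesis using kadison_kastler_approx[OF assms(7,3) _ b, of "1/4"] by auto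
  qed
  ultimately interpret very_close_pair A C E_CA n v B E_BD "2 * \<gamma>"
    using assms qb \<gamma> by unfold_locales auto
  obtain u where u: "unitary u" "u \<in> relative_commutant C UNIV" "(\<lambda>a. u * a * u\<^sup>\<star>) ` A = B"
    "norm (u - 1) \<le> 768 * (2 * \<gamma>)"
    using unitary_equivalence by blast
  \<comment> \<open>The bound obtained is linear, \<open>1536 * \<gamma>\<close>. For such small
    \<gamma> the excess \<open>656 * \<gamma>\<close> over \<open>880 * \<gamma>\<close> is below
    \<open>sqrt \<gamma>\<close>, hence below the square root term.\<close>
  have "sqrt \<gamma> \<le> sqrt ((1/1000)\<^sup>2)"
    using assms(12) by (intro real_sqrt_le_mono) (simp add: power2_eq_square)
  then have "sqrt \<gamma> \<le> 1/1000" by simp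
  then have "sqrt \<gamma> * sqrt \<gamma> \<le> 1/1000 * sqrt \<gamma>" using \<gamma> by (intro mult_right_mono) auto
  then have "\<gamma> \<le> 1/1000 * sqrt \<gamma>" using \<gamma> by simp
  moreover have "1 * sqrt \<gamma> \<le> sqrt 110 * sqrt \<gamma>" using \<gamma> by (intro mult_right_mono) auto
  moreover have "sqrt \<gamma> \<ge> 0" using \<gamma> by simp
  ultimately have "768 * (2 * \<gamma>) \<le> 16 * (sqrt 110 * sqrt \<gamma>) + 880 * \<gamma>" using \<gamma> by linarith
  then have "768 * (2 * \<gamma>) \<le> 16 * sqrt 110 * sqrt \<gamma> + 880 * \<gamma>" by (simp only: mult.assoc)
  then show ?thesis using u(1,2,3) order_trans[OF u(4)] by blast
qed

end
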